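(* Let $\alpha>-1$ and let $\kappa=\sqrt[3]{2}$. For fixed $t>0$, the recurrence coefficients $\alpha_n(t)$ and $\beta_n(t)$ have the following asymptotic expansions as $n\to\infty$: $$\begin{aligned}\alpha_n(t)=\;&2n+\alpha+1+\frac{t^{2/3}}{\kappa n^{1/3}}-\frac{\alpha t^{1/3}}{3\kappa^2n^{2/3}}+\frac{(\alpha+1)[\alpha(\alpha-1)-27t]}{162\kappa t^{1/3}n^{4/3}}\\&+\frac{\alpha^2(\alpha^2-1)+54\alpha(\alpha+1)t-81t^2}{486\kappa^2t^{2/3}n^{5/3}}+\frac{\alpha(\alpha^2+81t^2-1)}{972tn^2}+O(n^{-7/3}),\end{aligned}$$ $$\begin{aligned}\beta_n(t)=\;&n^2+\alpha n+\frac{t^{2/3}n^{2/3}}{2\kappa}-\frac{\kappa\alpha t^{1/3}n^{1/3}}{3}+\frac{6\alpha^2-1}{36}-\frac{\alpha(4\alpha^2-27t-4)}{162\kappa t^{1/3}n^{1/3}}\\&-\frac{5\alpha^4+\alpha^2(108t-5)+81t^2}{972\kappa^2t^{2/3}n^{2/3}}-\frac{\alpha(\alpha^2-1)}{486tn}+O(n^{-4/3}).\end{aligned}$$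
   Context: For $\alpha>-1$, $t\ge0$, let $w(x;t,\alpha)=x^\alpha e^{-x-t/x}$ on $(0,\infty)$, and let $P_n(x;t,\alpha)$, $n=0,1,2,\dots$, be the monic orthogonal polynomials of degree $n$ with respect to $w$: $\int_0^\infty P_jP_kw\,dx=h_j\delta_{jk}$, $h_j>0$. The recurrence coefficients $\alpha_n(t)$, $\beta_n(t)$ (depending also on the fixed parameter $\alpha$, with which $\alpha_n$ should not be confused) are defined by $xP_n=P_{n+1}+\alpha_nP_n+\beta_nP_{n-1}$ with $P_0=1$, $\beta_0P_{-1}=0$. *)

theory Defs
  imports
    "HOL-Analysis.Analysis"
    "HOL-Computational_Algebra.Polynomial"
    "HOL-Library.Landau_Symbols"
begin

definition sing_laguerre_weight :: "real \<Rightarrow> real \<Rightarrow> real \<Rightarrow> real" where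
  "sing_laguerre_weight t \<alpha> x = x powr \<alpha> * exp (- x - t / x)"

(* For \<alpha> > -1 and t \<ge> 0 a polynomial times the weight is always integrable on {0<..},
   so the integrals below never take the default value 0 of a divergent Bochner integral. *)
definition monic_orthogonal_polys :: "real \<Rightarrow> real \<Rightarrow> (nat \<Rightarrow> real poly) \<Rightarrow> bool" where
  "monic_orthogonal_polys t \<alpha> P \<longleftrightarrow>
     (\<forall>n. degree (P n) = n \<and> lead_coeff (P n) = 1) \<and>
     (\<exists>h :: nat \<Rightarrow> real. (\<forall>j. h j > 0) \<and>
        (\<forall>j k. (LBINT x:{0<..}. poly (P j) x * poly (P k) x * sing_laguerre_weight t \<alpha> x)
               = (if j = k then h j else 0)))"

(* x P_n = P_{n+1} + a_n P_n + b_n P_{n-1} with P_0 = 1 and b_0 P_{-1} = 0; [:0, 1:] is the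
   polynomial x.  The value of b 0 is left unconstrained. *)
definition recurrence_coeffs ::
    "(nat \<Rightarrow> real poly) \<Rightarrow> (nat \<Rightarrow> real) \<Rightarrow> (nat \<Rightarrow> real) \<Rightarrow> bool" where
  "recurrence_coeffs P a b \<longleftrightarrow>
     P 0 = 1 \<and>
     (\<forall>n. [:0, 1:] * P n =
            P (n + 1) + smult (a n) (P n) + (if n = 0 then 0 else smult (b n) (P (n - 1))))"

definition kappa :: real where
  "kappa = root 3 2"

end

theory Submission
  imports Defs "HOL-Real_Asymp.Real_Asymp"
begin

text \<open>The auxiliary quantities \<open>R n\<close> and \<open>\<rho> n\<close> (moments of \<open>t P\<^sub>n\<^sup>2 w / x\<close> and
  \<open>- t P\<^sub>n\<^sub>+\<^sub>1 P\<^sub>n w / x\<close>, normalised) satisfy discrete equations coming from integration by parts.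
  With \<open>x n = 1 / R n\<close> and \<open>s n = \<rho> n + t / 2\<close> they become
  \<open>(x\<^sub>n + x\<^sub>n\<^sub>+\<^sub>1) (s\<^sub>n\<^sup>2 - t\<^sup>2/4) = (2n + 2 + \<alpha>) s\<^sub>n - \<alpha> t/2\<close> and
  \<open>s\<^sub>n + s\<^sub>n\<^sub>+\<^sub>1 = (2n + 3 + \<alpha>) / x\<^sub>n\<^sub>+\<^sub>1 + 1 / x\<^sub>n\<^sub>+\<^sub>1\<^sup>2\<close>,
  where \<open>a\<^sub>n = 2n + 1 + \<alpha> + 1 / x\<^sub>n\<close> and \<open>b\<^sub>n\<^sub>+\<^sub>1 = (s\<^sub>n\<^sup>2 - t\<^sup>2/4) x\<^sub>n x\<^sub>n\<^sub>+\<^sub>1\<close>.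
  The right-hand sides are monotone enough that positive solutions obey a maximum principle. A truncated formal
  solution in powers of \<open>v = (2 t z)\<^bsup>-1/3\<^esup>\<close>, multiplied or divided by \<open>1 + A v\<^sup>7 + \<epsilon> v\<^sup>-\<^sup>6\<close>, is a strict
  super- or subsolution; the \<open>\<epsilon>\<close>-term dominates any solution at infinity, so letting \<open>\<epsilon>\<close> tend to 0 shows that the true
  solution is the truncated one up to a factor \<open>1 + O(v\<^sup>7)\<close>. Re-expanding in \<open>n\<close> gives the theorem.\<close>

subsection \<open>The discrete system for the recurrence coefficients\<close>

text \<open>Let z be half the coefficient of s in the first equation and of 1 / x in the second. To
  leading order both equations say x s = z, so the size of x is fixed only by the smaller terms: x
  t^2 / (4 s) has to balance 1 / (2 x). This gives s = t^2 x^2 / 2 and x^3 = 2 z / t^2, hence the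
  scale v with x close to 1 / (t v) and s close to 1 / (2 v^2). The same degeneracy governs the
  comparison. Multiplying x and dividing s by 1 + \<delta> disturbs either equation only by relative
  order v^4 \<delta>, so an accuracy of v^7 demands approximants whose residuals have relative order
  v^11. The growing term v^-6, of order z^2, is large enough to dominate the crude bounds x = O(n),
  1 / x = O(n) and s = O(n^2), which positivity and the equations alone provide; no asymptotic
  information on the solution is presupposed.\<close>

definition wint :: "real \<Rightarrow> real \<Rightarrow> real poly \<Rightarrow> real" where
  "wint t \<beta> q = (LBINT x:{0<..}. poly q x * sing_laguerre_weight t \<beta> x)"

text \<open>The exponential series of t / x dominates its m-th term. Since m is free, exp (- t / x)
  cancels any power singularity at 0.\<close>

lemma exp_neg_inverse_le:
  fixes t x :: real
  assumes "t > 0" "x > 0"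
  shows "exp (- (t / x)) \<le> fact m / t ^ m * x ^ m"
proof -
  have y: "t / x \<ge> 0" using assms by simp
  have "(t / x) ^ m / fact m \<le> exp (t / x)"
  proof -
    have "(\<Sum>n\<in>{m}. inverse (fact n) * (t/x) ^ n) \<le> (\<Sum>n. inverse (fact n) * (t/x) ^ n)"
      using y by (intro sum_le_suminf summable_exp) auto
    also have "\<dots> = exp (t/x)" by (simp add: exp_def divide_inverse scaleR_conv_of_real)
    finally show ?thesis by (simp add: field_simps)
  qed
  hence "1 / exp (t / x) \<le> 1 / ((t / x) ^ m / fact m)"
    using assms by (intro divide_left_mono) auto
  thus ?thesis using assms by (simp add: exp_minus field_simps power_divide)
qed

text \<open>There is no restriction on \<beta> because t > 0 makes the weight vanish rapidly at 0.
  This matters for the exponent \<alpha> - 1, produced by dividing by x, which may be below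
  -1.\<close>

lemma weight_integrable:
  fixes t \<beta> :: real
  assumes t: "t > 0"
  shows "set_integrable lborel {0<..} (sing_laguerre_weight t \<beta>)"
proof -
  \<comment> \<open>Once exp (- t / x) is traded for x ^ m, the exponent \<beta> + m is positive and
    a Gamma integral with parameter \<open>?s\<close> is a majorant.\<close>
  obtain m :: nat where m: "real m > - \<beta>" using reals_Archimedean2 by blast
  let ?s = "\<beta> + real m + 1"
  have s: "?s > 0" using m by simp
  have g: "set_integrable lborel {0<..} (\<lambda>x. x powr (?s - 1) / exp x)"
  proof -
    have "(\<lambda>x. x powr (?s - 1) / exp x) absolutely_integrable_on {0<..}"
      using Gamma_integral_real[OF s]
      by (intro nonnegative_absolutely_integrable_1)
         (auto simp: has_integral_iff negligible_subset[of "{0}"]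
               elim!: integrable_spike_set intro: negligible_subset[of "{0}"])
    thus ?thesis
      unfolding absolutely_integrable_on_def set_integrable_def
      by (subst (asm) integrable_completion) (auto intro!: borel_measurable_continuous_on_indicator continuous_intros)
  qed
  have g': "set_integrable lborel {0<..} (\<lambda>x. fact m / t ^ m * (x powr (?s - 1) / exp x))"
    using g by (rule set_integrable_mult_right)
  show ?thesis
  proof (rule set_integrable_bound[OF g'])
    show "set_borel_measurable lborel {0<..} (sing_laguerre_weight t \<beta>)"
      unfolding set_borel_measurable_def sing_laguerre_weight_def
      by (auto intro!: borel_measurable_continuous_on_indicator continuous_intros)
    have "norm (sing_laguerre_weight t \<beta> x) \<le> norm (fact m / t ^ m * (x powr (?s - 1) / exp x))"
      if x: "x > 0" for x
    proof -
      have "sing_laguerre_weight t \<beta> x = x powr \<beta> * exp (-x) * exp (- (t/x))"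
        by (simp add: sing_laguerre_weight_def exp_diff exp_minus field_simps)
      also have "\<dots> \<le> x powr \<beta> * exp (-x) * (fact m / t ^ m * x ^ m)"
        using exp_neg_inverse_le[OF t x, of m] by (intro mult_left_mono) auto
      also have "\<dots> = fact m / t ^ m * (x powr (?s - 1) / exp x)"
        using x by (simp add: powr_add powr_realpow exp_minus field_simps)
      finally show ?thesis using t x by (simp add: sing_laguerre_weight_def)
    qed
    thus "AE x in lborel. x \<in> {0<..} \<longrightarrow> norm (sing_laguerre_weight t \<beta> x) \<le> norm (fact m / t ^ m * (x powr (?s - 1) / exp x))"
      by auto
  qed
qed

lemma weight_mult_x: "x > 0 \<Longrightarrow> x * sing_laguerre_weight t \<beta> x = sing_laguerre_weight t (\<beta> + 1) x"
  by (simp add: sing_laguerre_weight_def powr_add)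

lemma wint_integrable:
  assumes t: "t > 0"
  shows "set_integrable lborel {0<..} (\<lambda>x. poly q x * sing_laguerre_weight t \<beta> x)"
proof (induction q arbitrary: \<beta>)
  case 0
  show ?case by (simp add: set_integrable_def)
next
  case (pCons c q)
  have "set_integrable lborel {0<..} (\<lambda>x. c * sing_laguerre_weight t \<beta> x + poly q x * sing_laguerre_weight t (\<beta>+1) x)"
    using pCons.IH weight_integrable[OF t, of \<beta>] by (intro set_integral_add set_integrable_mult_right)
  also have "?this \<longleftrightarrow> ?case"
    by (intro set_integrable_cong) (auto simp: weight_mult_x[symmetric] distrib_right)
  finally show ?case .
qed

lemma wint_add: "t > 0 \<Longrightarrow> wint t \<beta> (p + q) = wint t \<beta> p + wint t \<beta> q"
  unfolding wint_def
  by (subst set_integral_add(2)[symmetric]) (auto intro!: wint_integrable simp: algebra_simps)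

lemma wint_smult: "wint t \<beta> (smult c p) = c * wint t \<beta> p"
  unfolding wint_def by (subst set_integral_mult_right[symmetric]) (simp add: algebra_simps)

lemma wint_0 [simp]: "wint t \<beta> 0 = 0"
  by (simp add: wint_def)

lemma wint_diff: "t > 0 \<Longrightarrow> wint t \<beta> (p - q) = wint t \<beta> p - wint t \<beta> q"
  using wint_add[of t \<beta> p "smult (-1) q"] wint_smult[of t \<beta> "-1" q] by simp

lemma wint_shift: "wint t \<beta> ([:0, 1:] * q) = wint t (\<beta> + 1) q"
  unfolding wint_def
  by (intro set_lebesgue_integral_cong) (auto simp: weight_mult_x[symmetric])

lemma wint_square_nonneg: "wint t \<beta> (q * q) \<ge> 0"
  unfolding wint_def set_lebesgue_integral_def by (intro integral_nonneg_AE) (auto simp: indicator_def sing_laguerre_weight_def)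

lemma weight_tendsto_0_at_right:
  assumes "t > 0"
  shows "((\<lambda>x. poly q x * sing_laguerre_weight t \<beta> x) \<longlongrightarrow> 0) (at_right 0)"
proof (induction q arbitrary: \<beta>)
  case 0
  show ?case by simp
next
  case (pCons c q)
  have "(sing_laguerre_weight t \<beta> \<longlongrightarrow> 0) (at_right 0)"
    using assms unfolding sing_laguerre_weight_def by real_asymp
  hence "((\<lambda>x. c * sing_laguerre_weight t \<beta> x + poly q x * sing_laguerre_weight t (\<beta> + 1) x) \<longlongrightarrow> c * 0 + 0) (at_right 0)"
    using pCons.IH by (intro tendsto_intros)
  moreover have "\<forall>\<^sub>F x in (at_right 0). c * sing_laguerre_weight t \<beta> x + poly q x * sing_laguerre_weight t (\<beta> + 1) x
      = poly (pCons c q) x * sing_laguerre_weight t \<beta> x"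
    using eventually_at_right_less[of "0::real"]
    by (elim eventually_mono) (simp add: weight_mult_x[symmetric] distrib_right)
  ultimately show ?case
    using Lim_transform_eventually by fastforce
qed

lemma weight_tendsto_0_at_top:
  assumes "t > 0"
  shows "((\<lambda>x. poly q x * sing_laguerre_weight t \<beta> x) \<longlongrightarrow> 0) at_top"
proof (induction q arbitrary: \<beta>)
  case 0
  show ?case by simp
next
  case (pCons c q)
  have "(sing_laguerre_weight t \<beta> \<longlongrightarrow> 0) at_top"
    using assms unfolding sing_laguerre_weight_def by real_asymp
  hence "((\<lambda>x. c * sing_laguerre_weight t \<beta> x + poly q x * sing_laguerre_weight t (\<beta> + 1) x) \<longlongrightarrow> c * 0 + 0) at_top"
    using pCons.IH by (intro tendsto_intros)
  moreover have "\<forall>\<^sub>F x in at_top. c * sing_laguerre_weight t \<beta> x + poly q x * sing_laguerre_weight t (\<beta> + 1) x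
      = poly (pCons c q) x * sing_laguerre_weight t \<beta> x"
    using eventually_gt_at_top[of "0::real"]
    by (elim eventually_mono) (simp add: weight_mult_x[symmetric] distrib_right)
  ultimately show ?case
    using Lim_transform_eventually by fastforce
qed

text \<open>The integral of the derivative of q x^(\<beta>+1) exp (- x - t / x) vanishes. The factor
  x in front turns the logarithmic derivative of the weight into \<beta> - x + t / x, each term of
  which is a multiple of a shift of the exponent.\<close>

lemma wint_by_parts:
  assumes t: "t > 0"
  shows "wint t \<beta> (q + [:0, 1:] * pderiv q) + \<beta> * wint t \<beta> q - wint t \<beta> ([:0, 1:] * q)
           + t * wint t (\<beta> - 1) q = 0"
proof -
  let ?w = "sing_laguerre_weight t"
  let ?F = "\<lambda>x. poly q x * ?w (\<beta> + 1) x"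
  let ?f = "\<lambda>x. poly (q + [:0, 1:] * pderiv q) x * ?w \<beta> x + \<beta> * (poly q x * ?w \<beta> x)
     - poly ([:0, 1:] * q) x * ?w \<beta> x + t * (poly q x * ?w (\<beta> - 1) x)"
  have int: "set_integrable lborel {0<..} ?f"
    using wint_integrable[OF t] by (intro set_integral_add set_integral_diff set_integrable_mult_right)
  have deriv: "(?F has_real_derivative ?f x) (at x)" if x: "x > 0" for x
  proof -
    have "(?F has_real_derivative
       poly (pderiv q) x * ?w (\<beta>+1) x + poly q x * (((\<beta>+1) * x powr \<beta>) * exp (- x - t / x)
         + x powr (\<beta>+1) * (exp (- x - t / x) * (- 1 + t / x^2)))) (at x)"
      unfolding sing_laguerre_weight_def using x
      by (auto intro!: derivative_eq_intros simp: field_simps power2_eq_square)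
    also have "poly (pderiv q) x * ?w (\<beta>+1) x + poly q x * (((\<beta>+1) * x powr \<beta>) * exp (- x - t / x)
         + x powr (\<beta>+1) * (exp (- x - t / x) * (- 1 + t / x^2))) = ?f x"
      using x by (simp add: sing_laguerre_weight_def powr_add powr_diff field_simps power2_eq_square)
    finally show ?thesis .
  qed
  have "(LBINT x=ereal 0..\<infinity>. ?f x) = 0 - 0"
  proof (rule interval_integral_FTC_integrable)
    show "(?F has_vector_derivative ?f x) (at x)" if "ereal 0 < ereal x" "ereal x < \<infinity>" for x
      using deriv[of x] that by (simp add: has_real_derivative_iff_has_vector_derivative)
    show "isCont ?f x" if "ereal 0 < ereal x" "ereal x < \<infinity>" for x
      using that unfolding sing_laguerre_weight_def by (auto intro!: continuous_intros)
    show "set_integrable lborel (einterval (ereal 0) \<infinity>) ?f" using int by simp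
    show "((?F \<circ> real_of_ereal) \<longlongrightarrow> 0) (at_right (ereal 0))"
      using weight_tendsto_0_at_right[OF t] by (simp add: ereal_tendsto_simps)
    show "((?F \<circ> real_of_ereal) \<longlongrightarrow> 0) (at_left \<infinity>)"
      using weight_tendsto_0_at_top[OF t] by (simp add: ereal_tendsto_simps)
  qed simp
  hence "(LBINT x:{0<..}. ?f x) = 0"
    by (simp add: interval_integral_to_infinity_eq)
  also have "(LBINT x:{0<..}. ?f x) = wint t \<beta> (q + [:0, 1:] * pderiv q) + \<beta> * wint t \<beta> q
      - wint t \<beta> ([:0, 1:] * q) + t * wint t (\<beta> - 1) q"
  proof -
    have *: "(LBINT x:{0<..}. f1 x + \<beta> * f2 x - f3 x + t * f4 x)
        = (LBINT x:{0<..}. f1 x) + \<beta> * (LBINT x:{0<..}. f2 x) - (LBINT x:{0<..}. f3 x) + t * (LBINT x:{0<..}. f4 x)"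
      if "set_integrable lborel {0<..} f1" "set_integrable lborel {0<..} f2"
         "set_integrable lborel {0<..} f3" "set_integrable lborel {0<..} f4" for f1 f2 f3 f4 :: "real \<Rightarrow> real"
      using that by simp
    show ?thesis unfolding wint_def by (intro * wint_integrable[OF t])
  qed
  finally show ?thesis .
qed

section \<open>Orthogonal polynomials and the auxiliary quantities\<close>

locale sing_laguerre =
  fixes t \<alpha> :: real and P :: "nat \<Rightarrow> real poly" and a b h :: "nat \<Rightarrow> real"
  assumes t: "t > 0" and \<alpha>: "\<alpha> > -1"
    and deg: "degree (P n) = n" and lead: "coeff (P n) n = 1"
    and h_pos: "h n > 0"
    and orth: "wint t \<alpha> (P j * P k) = (if j = k then h j else 0)"
    and rec0: "[:0, 1:] * P 0 = P 1 + smult (a 0) (P 0)"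
    and rec: "[:0, 1:] * P (Suc n) = P (Suc (Suc n)) + smult (a (Suc n)) (P (Suc n)) + smult (b (Suc n)) (P n)"
begin

abbreviation L where "L \<equiv> wint t \<alpha>"
abbreviation M where "M \<equiv> wint t (\<alpha> - 1)"

lemmas L_lin = wint_add[OF t] wint_diff[OF t] wint_smult

lemma M_shift: "M ([:0, 1:] * q) = L q"
  using wint_shift[of t "\<alpha> - 1" q] by simp

lemma P_0: "P 0 = 1"
  using deg[of 0] lead[of 0] by (metis degree_0_id one_pCons)

text \<open>Induction on the degree bound k: subtracting a multiple of \<open>P k\<close> removes
  the top coefficient, and the bound k \<le> n ensures that only polynomials orthogonal to
  \<open>P n\<close> are subtracted.\<close>

lemma L_P_lower: "k \<le> n \<Longrightarrow> (\<And>i. i \<ge> k \<Longrightarrow> coeff q i = 0) \<Longrightarrow> L (P n * q) = 0"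
proof (induction k arbitrary: q)
  case 0
  hence "q = 0" by (simp add: poly_eq_iff)
  thus ?case by simp
next
  case (Suc k)
  define r where "r = q - smult (coeff q k) (P k)"
  have "coeff r i = 0" if "i \<ge> k" for i
    using that Suc.prems(2)[of i] lead[of k] deg[of k]
    by (cases "i = k") (auto simp: r_def coeff_eq_0)
  hence "L (P n * r) = 0" using Suc by auto
  moreover have "P n * q = P n * r + smult (coeff q k) (P n * P k)"
    by (simp add: r_def algebra_simps)
  ultimately show ?case using orth[of n k] Suc.prems(1) by (simp add: L_lin)
qed

lemma L_P: 
  assumes "degree q \<le> n"
  shows "L (P n * q) = coeff q n * h n"
proof -
  define r where "r = q - smult (coeff q n) (P n)"
  have "coeff r i = 0" if "i \<ge> n" for i
    using that assms lead[of n] deg[of n]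
    by (cases "i = n") (auto simp: r_def coeff_eq_0)
  hence "L (P n * r) = 0" by (intro L_P_lower[of n]) auto
  moreover have "P n * q = P n * r + smult (coeff q n) (P n * P n)"
    by (simp add: r_def algebra_simps)
  ultimately show ?thesis using orth[of n n] by (simp add: L_lin)
qed

text \<open>Split q into its value at 0 and x times a remainder r. The factor x cancels the division
  by x hidden in \<open>M\<close>, and \<open>L_P\<close> evaluates what is left.\<close>

lemma M_P:
  assumes "degree q \<le> Suc n"
  shows "M (P n * q) = poly q 0 * M (P n) + coeff q (Suc n) * h n"
proof -
  obtain c r where q: "q = pCons c r" by (cases q)
  have "P n * q = smult c (P n) + [:0, 1:] * (P n * r)" by (simp add: q algebra_simps)
  hence "M (P n * q) = c * M (P n) + L (P n * r)"
    by (simp only: L_lin M_shift)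
  moreover have "degree r \<le> n" using assms by (cases "r = 0") (auto simp: q)
  ultimately show ?thesis using L_P[of r n] by (simp add: q)
qed

definition R where "R n = t * M (P n * P n) / h n"
definition \<rho> where "\<rho> n = - t * M (P (Suc n) * P n) / h n"
text \<open>By the recurrence this is the sum of a 0, ..., a n. It differs from the quantity \<rho>
  n + t / 2, which is called s after the change of variables.\<close>

definition s where "s n = - coeff (P (Suc n)) n"

lemma deg_xP: "degree ([:0, 1:] * P n) \<le> Suc n"
  using degree_mult_le[of "[:0, 1:]" "P n"] deg[of n] by simp

lemma a_eq: "L ([:0, 1:] * P n * P n) = a n * h n"
proof (cases n)
  case 0
  have "[:0, 1:] * P 0 * P 0 = P 1 * P 0 + smult (a 0) (P 0 * P 0)"
    by (simp only: rec0 distrib_right mult_smult_left)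
  thus ?thesis using orth 0 by (simp only: L_lin) simp
next
  case (Suc m)
  have "[:0, 1:] * P n * P n = P (Suc n) * P n + smult (a n) (P n * P n) + smult (b n) (P m * P n)"
    by (simp only: Suc rec distrib_right mult_smult_left)
  thus ?thesis using orth Suc by (simp only: L_lin) simp
qed

lemma b_eq: "b (Suc n) * h n = h (Suc n)"
proof -
  have "[:0, 1:] * P (Suc n) * P n = P (Suc (Suc n)) * P n + smult (a (Suc n)) (P (Suc n) * P n) + smult (b (Suc n)) (P n * P n)"
    by (simp only: rec distrib_right mult_smult_left)
  hence "L ([:0, 1:] * P (Suc n) * P n) = b (Suc n) * h n"
    using orth by (simp only: L_lin) simp
  moreover have "L ([:0, 1:] * P (Suc n) * P n) = L (P (Suc n) * ([:0, 1:] * P n))"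
    by (simp add: algebra_simps)
  moreover have "\<dots> = h (Suc n)"
    using L_P[OF deg_xP, of n] lead[of n] by simp
  ultimately show ?thesis by simp
qed

lemma b_pos: "b (Suc n) > 0"
  using b_eq[of n] h_pos[of n] h_pos[of "Suc n"] by (metis zero_less_mult_pos2)

lemma M_square: "M (P n * P n) = poly (P n) 0 * M (P n)"
  using M_P[of "P n" n] deg[of n] by (simp add: coeff_eq_0)

lemma M_Suc1: "M (P (Suc n) * P n) = poly (P n) 0 * M (P (Suc n))"
  using M_P[of "P n" "Suc n"] deg[of n] by (simp add: coeff_eq_0)

lemma M_Suc2: "M (P (Suc n) * P n) = h n + poly (P (Suc n)) 0 * M (P n)"
  using M_P[of "P (Suc n)" n] deg[of "Suc n"] lead[of "Suc n"] by (simp add: mult.commute)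

text \<open>Nonnegativity is immediate, strictness is not. If the integral of the square of
  \<open>P n\<close> against w / x vanished, the integral of the square of (x - c)
  \<open>P n\<close> against w / x would lose its c^2 term and reduce to (a n - 2 c) h n, which is
  negative for the chosen c.\<close>

lemma R_pos: "R n > 0"
proof -
  have "M (P n * P n) \<noteq> 0"
  proof
    assume 0: "M (P n * P n) = 0"
    define c where "c = a n / 2 + 1"
    have "0 \<le> M (([:-c, 1:] * P n) * ([:-c, 1:] * P n))" by (rule wint_square_nonneg)
    also have "([:-c, 1:] * P n) * ([:-c, 1:] * P n) =
       [:0, 1:] * ([:0, 1:] * P n * P n) - (smult c ([:0, 1:] * (P n * P n)) + smult c ([:0, 1:] * (P n * P n))) + smult (c^2) (P n * P n)"
      by (simp add: algebra_simps power2_eq_square smult_add_left)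
    also have "M \<dots> = a n * h n - 2 * c * h n"
      unfolding L_lin M_shift using 0 orth a_eq by simp
    also have "\<dots> = - 2 * h n" by (simp add: c_def algebra_simps)
    finally show False using h_pos[of n] by simp
  qed
  with wint_square_nonneg[of t "\<alpha> - 1" "P n"] have "M (P n * P n) > 0" by simp
  thus ?thesis using t h_pos[of n] by (simp add: R_def)
qed

text \<open>Integration by parts for q = \<open>P n * P n\<close>. The polynomial x times the
  derivative of \<open>P n\<close> has leading coefficient n, so it contributes n h n twice.\<close>

lemma a_R: "a n = 2 * real n + 1 + \<alpha> + R n"
proof -
  have "L (P n * P n + [:0, 1:] * pderiv (P n * P n)) + \<alpha> * L (P n * P n)
      - L ([:0, 1:] * (P n * P n)) + t * M (P n * P n) = 0"
    by (rule wint_by_parts[OF t])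
  moreover have "[:0, 1:] * pderiv (P n * P n) = P n * ([:0, 1:] * pderiv (P n)) + P n * ([:0, 1:] * pderiv (P n))"
    by (simp add: pderiv_mult algebra_simps)
  moreover have "L (P n * ([:0, 1:] * pderiv (P n))) = real n * h n"
  proof -
    have "degree ([:0, 1:] * pderiv (P n)) \<le> n"
      using degree_mult_le[of "[:0, 1:]" "pderiv (P n)"] deg[of n]
      by (cases n) (auto simp: degree_pderiv pderiv_eq_0_iff degree_pCons_eq_if)
    moreover have "coeff ([:0, 1:] * pderiv (P n)) n = real n"
      by (cases n) (simp_all add: coeff_pderiv lead)
    ultimately show ?thesis by (simp only: L_P)
  qed
  ultimately have "h n + 2 * (real n * h n) + \<alpha> * h n - a n * h n + t * M (P n * P n) = 0"
    using a_eq[of n] orth[of n n] by (simp only: L_lin mult.assoc) simp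
  thus ?thesis using h_pos[of n] by (simp add: R_def field_simps)
qed

text \<open>The mixed integral \<open>M (P (Suc n) * P n)\<close> can be reduced by expanding either
  factor at 0. The two reductions differ by h n, which becomes the shift by t, and their product
  regroups into the two squares behind \<open>R n\<close> and \<open>R (Suc n)\<close>.\<close>

lemma \<rho>_mult: "\<rho> n * (\<rho> n + t) = b (Suc n) * R n * R (Suc n)"
proof -
  have e1: "\<rho> n + t = - t * (poly (P (Suc n)) 0 * M (P n)) / h n"
    using h_pos[of n] unfolding \<rho>_def M_Suc2 by (simp add: field_simps)
  have e2: "\<rho> n = - t * (poly (P n) 0 * M (P (Suc n))) / h n"
    by (simp add: \<rho>_def M_Suc1)
  show ?thesis
    using h_pos[of n] b_pos[of n]
    by (subst e1, subst e2) (simp add: R_def M_square b_eq[of n, symmetric] field_simps)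
qed

lemma \<rho>_0: "\<rho> 0 + t = a 0 * R 0"
proof -
  have "[:0, 1:] * (P 0 * P 0) = P 1 * P 0 + smult (a 0) (P 0 * P 0)"
    by (simp only: mult.assoc[symmetric] rec0 distrib_right mult_smult_left)
  hence "M ([:0, 1:] * (P 0 * P 0)) = M (P 1 * P 0) + a 0 * M (P 0 * P 0)"
    by (simp only: L_lin)
  hence "h 0 = M (P 1 * P 0) + a 0 * M (P 0 * P 0)"
    unfolding M_shift using orth by simp
  thus ?thesis using h_pos[of 0] by (simp add: \<rho>_def R_def field_simps)
qed

text \<open>Apply \<open>M\<close> to the recurrence multiplied by \<open>P (Suc n)\<close>: the
  factor x on the left turns \<open>M\<close> into \<open>L\<close> and leaves the norm, which after
  scaling is the term t.\<close>

lemma \<rho>_Suc: "\<rho> n + \<rho> (Suc n) + t = a (Suc n) * R (Suc n)"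
proof -
  let ?m = "Suc n"
  have "[:0, 1:] * (P ?m * P ?m) = P (Suc ?m) * P ?m + smult (a ?m) (P ?m * P ?m) + smult (b ?m) (P ?m * P n)"
    by (simp only: mult.assoc[symmetric] rec distrib_right mult_smult_left) (simp add: mult.commute)
  hence "M ([:0, 1:] * (P ?m * P ?m)) = M (P (Suc ?m) * P ?m) + a ?m * M (P ?m * P ?m) + b ?m * M (P ?m * P n)"
    by (simp only: L_lin)
  hence "h ?m = M (P (Suc ?m) * P ?m) + a ?m * M (P ?m * P ?m) + b ?m * M (P ?m * P n)"
    unfolding M_shift using orth by simp
  hence "t * h ?m / h ?m = t * (M (P (Suc ?m) * P ?m) + a ?m * M (P ?m * P ?m) + b ?m * M (P ?m * P n)) / h ?m"
    by simp
  moreover have "\<rho> n = - t * (b ?m * M (P ?m * P n)) / h ?m"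
    unfolding b_eq[of n, symmetric] using h_pos[of n] b_pos[of n] by (simp add: \<rho>_def field_simps)
  ultimately show ?thesis using h_pos[of ?m] by (simp add: \<rho>_def R_def field_simps)
qed

text \<open>Integration by parts for q = \<open>P (Suc n) * P n\<close>; orthogonality removes
  everything from the derivative terms except the subleading coefficient of
  \<open>P (Suc n)\<close>.\<close>

lemma b_\<rho>: "b (Suc n) + \<rho> n = s n"
proof -
  let ?m = "Suc n" and ?q = "P (Suc n) * P n" and ?x = "[:0, 1 :: real:]"
  have "L (?q + ?x * pderiv ?q) + \<alpha> * L ?q - L (?x * ?q) + t * M ?q = 0"
    by (rule wint_by_parts[OF t])
  moreover have "?x * pderiv ?q = P ?m * (?x * pderiv (P n)) + P n * (?x * pderiv (P ?m))"
    by (simp add: pderiv_mult algebra_simps)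
  moreover have "L (P ?m * (?x * pderiv (P n))) = 0"
    using deg[of n] by (intro L_P_lower[of ?m]) (auto simp: coeff_pCons coeff_pderiv coeff_eq_0 split: nat.splits)
  moreover have "L (P n * (?x * pderiv (P ?m))) = s n * h n"
  proof -
    \<comment> \<open>The subtracted multiple of \<open>P ?m\<close> is orthogonal to
      \<open>P n\<close> and cancels the top coefficient. What remains at degree n is (n - (n + 1))
      times the coefficient of \<open>P ?m\<close>, that is \<open>s n\<close>.\<close>
    define r where "r = ?x * pderiv (P ?m) - smult (real ?m) (P ?m)"
    have c: "coeff r i = (real i - real ?m) * coeff (P ?m) i" for i
      by (cases i) (auto simp: r_def coeff_pderiv algebra_simps)
    have "degree r \<le> n"
    proof (rule degree_le, intro allI impI)
      fix i assume "n < i"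
      thus "coeff r i = 0" using deg[of ?m] by (cases "i = ?m") (auto simp: c coeff_eq_0)
    qed
    hence "L (P n * r) = s n * h n" by (subst L_P) (auto simp: c s_def)
    moreover have "P n * (?x * pderiv (P ?m)) = P n * r + smult (real ?m) (P n * P ?m)"
      by (simp add: r_def algebra_simps)
    ultimately show ?thesis using orth[of n ?m] by (simp add: L_lin)
  qed
  moreover have "L (?x * ?q) = h ?m"
  proof -
    have "?x * ?q = P ?m * (?x * P n)" by (simp add: algebra_simps)
    thus ?thesis using L_P[OF deg_xP, of n] lead[of n] by simp
  qed
  moreover have "L ?q = 0" using orth[of ?m n] by simp
  ultimately have "s n * h n - h ?m + t * M ?q = 0"
    by (simp only: L_lin)
  thus ?thesis unfolding b_eq[of n, symmetric] using h_pos[of n] by (simp add: \<rho>_def field_simps)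
qed

lemma s_0: "s 0 = a 0"
proof -
  have "coeff ([:0, 1:] * P 0) 0 = coeff (P 1 + smult (a 0) (P 0)) 0" by (simp only: rec0)
  thus ?thesis by (simp add: s_def P_0)
qed

lemma s_Suc: "s (Suc n) = s n + a (Suc n)"
proof -
  have "coeff ([:0, 1:] * P (Suc n)) (Suc n)
     = coeff (P (Suc (Suc n)) + smult (a (Suc n)) (P (Suc n)) + smult (b (Suc n)) (P n)) (Suc n)"
    by (simp only: rec)
  thus ?thesis using lead[of "Suc n"] deg[of n] by (simp add: s_def coeff_eq_0)
qed

text \<open>A first integral of the preceding relations: it no longer contains the running sum
  \<open>s n\<close>, so with \<open>\<rho>_mult\<close> and \<open>\<rho>_Suc\<close> it closes the
  system.\<close>

lemma b_R: "real (Suc n) * t + (2 * real (Suc n) + \<alpha>) * \<rho> n = b (Suc n) * (R n + R (Suc n))"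
proof (induction n)
  case 0
  have "R 0 * (b 1 * (R 0 + R 1)) = R 0 * (t + (2 + \<alpha>) * \<rho> 0)"
  proof -
    have "R 0 * (b 1 * (R 0 + R 1)) = \<rho> 0 * (\<rho> 0 + t) + b 1 * R 0 * R 0"
      using \<rho>_mult[of 0] by (simp add: algebra_simps)
    also have "\<dots> = R 0 * (\<rho> 0 * a 0 + (a 0 - \<rho> 0) * R 0)"
    proof -
      have b0: "b 1 = a 0 - \<rho> 0" using b_\<rho>[of 0] by (simp add: s_0)
      show ?thesis unfolding \<rho>_0 b0 by (simp add: algebra_simps)
    qed
    also have "\<rho> 0 * a 0 + (a 0 - \<rho> 0) * R 0 = \<rho> 0 * (1 + \<alpha>) + a 0 * R 0"
      using a_R[of 0] by (simp add: algebra_simps)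
    also have "\<dots> = t + (2 + \<alpha>) * \<rho> 0" unfolding \<rho>_0[symmetric] by (simp add: algebra_simps)
    finally show ?thesis .
  qed
  thus ?case using R_pos[of 0] by simp
next
  case (Suc n)
  let ?m = "Suc n"
  define r where "r = R ?m"
  have r: "r > 0" using R_pos by (simp add: r_def)
  have ar: "a ?m = 2 * real ?m + 1 + \<alpha> + r" by (simp add: a_R r_def)
  have e1: "\<rho> n + \<rho> ?m + t = a ?m * r" by (simp add: \<rho>_Suc r_def)
  \<comment> \<open>The difference of \<open>\<rho>_mult\<close> at two consecutive indices factors,
    and one factor is \<rho> n + \<rho> (n + 1) + t = a R by \<open>\<rho>_Suc\<close>; the common R
    then cancels.\<close>
  have "r * (b (Suc ?m) * R (Suc ?m) - b ?m * R n) = \<rho> ?m * (\<rho> ?m + t) - \<rho> n * (\<rho> n + t)"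
    unfolding \<rho>_mult r_def by (simp add: algebra_simps)
  also have "\<dots> = (\<rho> ?m - \<rho> n) * (\<rho> n + \<rho> ?m + t)" by (simp add: algebra_simps)
  also have "\<dots> = r * ((\<rho> ?m - \<rho> n) * a ?m)" unfolding e1 by simp
  finally have e2: "b (Suc ?m) * R (Suc ?m) - b ?m * R n = (\<rho> ?m - \<rho> n) * a ?m"
    using r by simp
  have e3: "b (Suc ?m) - b ?m = a ?m - \<rho> ?m + \<rho> n"
    using b_\<rho>[of n] b_\<rho>[of ?m] s_Suc[of n] by simp
  have "b (Suc ?m) * (r + R (Suc ?m)) = b ?m * (R n + r) + (b (Suc ?m) * R (Suc ?m) - b ?m * R n) + (b (Suc ?m) - b ?m) * r"
    by (simp add: algebra_simps)
  also have "\<dots> = b ?m * (R n + r) + (\<rho> ?m - \<rho> n) * (a ?m - r) + a ?m * r"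
    unfolding e2 e3 by (simp add: algebra_simps)
  also have "\<dots> = real ?m * t + (2 * real ?m + \<alpha>) * \<rho> n + (\<rho> ?m - \<rho> n) * (2 * real ?m + 1 + \<alpha>) + (\<rho> n + \<rho> ?m + t)"
    unfolding e1 using Suc.IH by (simp add: ar r_def)
  also have "\<dots> = real (Suc ?m) * t + (2 * real (Suc ?m) + \<alpha>) * \<rho> ?m"
    by (simp add: algebra_simps)
  finally show ?case by (simp add: r_def)
qed

text \<open>The product formula leaves \<rho> n > 0 or \<rho> n < - t. In the second case the left
  side of \<open>b_R\<close> would be at most - (n + 1 + \<alpha>) t < 0, while its right side is
  positive.\<close>

lemma \<rho>_pos: "\<rho> n > 0"
proof (rule ccontr)
  assume "\<not> \<rho> n > 0"
  moreover have "\<rho> n * (\<rho> n + t) > 0"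
    unfolding \<rho>_mult using b_pos R_pos by (intro mult_pos_pos)
  ultimately have "\<rho> n < 0" "\<rho> n < -t" by (auto simp: zero_less_mult_iff)
  hence "(2 * real (Suc n) + \<alpha>) * \<rho> n \<le> (2 * real (Suc n) + \<alpha>) * (-t)"
    using \<alpha> by (intro mult_left_mono) auto
  moreover have "real (Suc n) * t + (2 * real (Suc n) + \<alpha>) * \<rho> n > 0"
    unfolding b_R using b_pos[of n] R_pos[of n] R_pos[of "Suc n"] by (intro mult_pos_pos) auto
  ultimately have "0 < (real (Suc n) - (2 * real (Suc n) + \<alpha>)) * t" by (simp add: algebra_simps)
  thus False using t \<alpha> by (simp add: zero_less_mult_iff)
qed

end

lemma recurrence_system:
  fixes \<alpha> t :: real
  assumes "\<alpha> > -1" "t > 0" "monic_orthogonal_polys t \<alpha> P" "recurrence_coeffs P a b"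
  obtains x s :: "nat \<Rightarrow> real"
  where "\<And>n. x n > 0" "\<And>n. s n > t / 2"
    "\<And>n. (x n + x (Suc n)) * ((s n)\<^sup>2 - (t/2)\<^sup>2) = (2 * real n + 2 + \<alpha>) * s n - \<alpha> * (t/2)"
    "\<And>n. s n + s (Suc n) = (2 * real n + 3 + \<alpha>) / x (Suc n) + 1 / (x (Suc n))\<^sup>2"
    "\<And>n. a n = 2 * real n + 1 + \<alpha> + 1 / x n"
    "\<And>n. b (Suc n) = ((s n)\<^sup>2 - (t/2)\<^sup>2) * x n * x (Suc n)"
proof -
  obtain h where h: "\<And>j. h j > (0::real)"
    "\<And>j k. (LBINT x:{0<..}. poly (P j) x * poly (P k) x * sing_laguerre_weight t \<alpha> x) = (if j = k then h j else 0)"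
    using assms(3) unfolding monic_orthogonal_polys_def by blast
  have rec: "[:0, 1:] * P n = P (n + 1) + smult (a n) (P n) + (if n = 0 then 0 else smult (b n) (P (n - 1)))" for n
    using assms(4) unfolding recurrence_coeffs_def by blast
  interpret sing_laguerre t \<alpha> P a b h
  proof
    show "degree (P n) = n" "coeff (P n) n = 1" for n
      using assms(3) unfolding monic_orthogonal_polys_def by metis+
    show "wint t \<alpha> (P j * P k) = (if j = k then h j else 0)" for j k
      using h(2)[of j k] by (simp add: wint_def)
    show "[:0, 1:] * P 0 = P 1 + smult (a 0) (P 0)" using rec[of 0] by simp
    show "[:0, 1:] * P (Suc n) = P (Suc (Suc n)) + smult (a (Suc n)) (P (Suc n)) + smult (b (Suc n)) (P n)" for n
      using rec[of "Suc n"] by simp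
  qed (use assms h in auto)
  show ?thesis
  \<comment> \<open>Adding t / 2 completes the square in \<rho> (\<rho> + t). Taking reciprocals of
    R turns (R n + R (n + 1)) / (R n R (n + 1)) into a plain sum.\<close>
  proof (rule that[of "\<lambda>n. 1 / R n" "\<lambda>n. \<rho> n + t / 2"])
    fix n
    show "1 / R n > 0" using R_pos by simp
    show "\<rho> n + t / 2 > t / 2" using \<rho>_pos by simp
    have sq: "(\<rho> n + t/2)\<^sup>2 - (t/2)\<^sup>2 = b (Suc n) * R n * R (Suc n)"
      unfolding \<rho>_mult[symmetric] by (simp add: power2_eq_square algebra_simps)
    show "b (Suc n) = ((\<rho> n + t/2)\<^sup>2 - (t/2)\<^sup>2) * (1 / R n) * (1 / R (Suc n))"
      unfolding sq using R_pos[of n] R_pos[of "Suc n"] by simp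
    have "(1 / R n + 1 / R (Suc n)) * (b (Suc n) * R n * R (Suc n)) = b (Suc n) * (R n + R (Suc n))"
      using R_pos[of n] R_pos[of "Suc n"] by (simp add: field_simps)
    also have "\<dots> = (2 * real n + 2 + \<alpha>) * (\<rho> n + t/2) - \<alpha> * (t/2)"
      unfolding b_R[symmetric] by (simp add: field_simps)
    finally show "(1 / R n + 1 / R (Suc n)) * ((\<rho> n + t/2)\<^sup>2 - (t/2)\<^sup>2) = (2 * real n + 2 + \<alpha>) * (\<rho> n + t/2) - \<alpha> * (t/2)"
      unfolding sq .
    show "(\<rho> n + t/2) + (\<rho> (Suc n) + t/2) = (2 * real n + 3 + \<alpha>) / (1 / R (Suc n)) + 1 / (1 / R (Suc n))\<^sup>2"
      using \<rho>_Suc[of n] by (simp add: a_R power2_eq_square algebra_simps)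
    show "a n = 2 * real n + 1 + \<alpha> + 1 / (1 / R n)" by (simp add: a_R)
  qed
qed

subsection \<open>The formal solution\<close>

lemma powr_taylor_bound:
  fixes r :: real
  obtains K where "K \<ge> 0" "\<And>u. \<bar>u\<bar> \<le> 1/2 \<Longrightarrow>
    \<bar>(1 + u) powr r - (\<Sum>m<n. (r gchoose m) * u ^ m)\<bar> \<le> K * \<bar>u\<bar> ^ n"
proof -
  define D where "D m x = fact m * (r gchoose m) * (1 + x) powr (r - real m)" for m x
  \<comment> \<open>The Lagrange remainder contains (1 + x) powr (r - n) with 1 + x between 1/2 and
    3/2; adding the values at both endpoints covers either sign of the exponent.\<close>
  define K where "K = \<bar>r gchoose n\<bar> * ((1/2) powr (r - real n) + (3/2) powr (r - real n))"
  have "\<bar>(1 + u) powr r - (\<Sum>m<n. (r gchoose m) * u ^ m)\<bar> \<le> K * \<bar>u\<bar> ^ n" if u: "\<bar>u\<bar> \<le> 1/2" for u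
  proof -
    have "DERIV (D m) x :> D (Suc m) x" if "\<bar>x\<bar> \<le> \<bar>u\<bar>" for m x
    proof -
      have "fact (Suc m) * (r gchoose Suc m) = fact m * (r gchoose m) * (r - real m)"
        by (simp only: gbinomial_mult_fact prod.atLeast0_lessThan_Suc)
      moreover have "((\<lambda>x. (1 + x) powr (r - real m)) has_real_derivative
          (r - real m) * (1 + x) powr (r - real (Suc m))) (at x)"
        using that u by (auto intro!: derivative_eq_intros simp: algebra_simps)
      ultimately show ?thesis unfolding D_def
        by (metis DERIV_cmult mult.assoc)
    qed
    then obtain x where x: "\<bar>x\<bar> \<le> \<bar>u\<bar>"
      "(1 + u) powr r = (\<Sum>m<n. D m 0 / fact m * u ^ m) + D n x / fact n * u ^ n"
      using Maclaurin_bi_le[of D "\<lambda>u. (1 + u) powr r" n u] by (auto simp: D_def fun_eq_iff)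
    have "\<bar>(1 + u) powr r - (\<Sum>m<n. (r gchoose m) * u ^ m)\<bar> = \<bar>r gchoose n\<bar> * (1 + x) powr (r - real n) * \<bar>u\<bar> ^ n"
      unfolding x(2) by (simp add: D_def abs_mult power_abs)
    also have "(1 + x) powr (r - real n) \<le> (1/2) powr (r - real n) + (3/2) powr (r - real n)"
    proof (cases "r - real n \<ge> 0")
      case True
      hence "(1 + x) powr (r - real n) \<le> (3/2) powr (r - real n)"
        using x u by (intro powr_mono2) auto
      thus ?thesis using powr_ge_zero[of "1/2" "r - real n"] by linarith
    next
      case False
      hence "(1 + x) powr (r - real n) \<le> (1/2) powr (r - real n)"
        using x u by (intro powr_mono2') auto
      thus ?thesis using powr_ge_zero[of "3/2" "r - real n"] by linarith
    qed
    finally show ?thesis by (simp add: K_def mult_right_mono mult_left_mono)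
  qed
  moreover have "K \<ge> 0" by (simp add: K_def)
  ultimately show ?thesis using that by blast
qed

lemma powr_central_difference_bound:
  fixes r :: real
  obtains K where "K \<ge> 0" "\<And>u. \<bar>u\<bar> \<le> 1/2 \<Longrightarrow>
    \<bar>(1 + u) powr r + (1 - u) powr r - (2 + r * (r - 1) * u\<^sup>2)\<bar> \<le> K * u ^ 4"
proof -
  obtain K where K: "K \<ge> 0" "\<And>u. \<bar>u\<bar> \<le> 1/2 \<Longrightarrow>
    \<bar>(1 + u) powr r - (\<Sum>m<4. (r gchoose m) * u ^ m)\<bar> \<le> K * \<bar>u\<bar> ^ 4"
    using powr_taylor_bound by blast
  have "\<bar>(1 + u) powr r + (1 - u) powr r - (2 + r * (r - 1) * u\<^sup>2)\<bar> \<le> 2 * K * u ^ 4"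
    if u: "\<bar>u\<bar> \<le> 1/2" for u
  proof -
    have g2: "r gchoose 2 = r * (r - 1) / 2"
      by (simp add: gbinomial_prod_rev numeral_2_eq_2)
    have "(\<Sum>m<4. (r gchoose m) * u ^ m) + (\<Sum>m<4. (r gchoose m) * (-u) ^ m) = 2 + r * (r - 1) * u\<^sup>2"
      by (simp add: eval_nat_numeral(2,3) g2[unfolded numeral_2_eq_2] algebra_simps power2_eq_square)
    moreover have "\<bar>(1 + u) powr r - (\<Sum>m<4. (r gchoose m) * u ^ m)\<bar> \<le> K * u ^ 4"
      "\<bar>(1 - u) powr r - (\<Sum>m<4. (r gchoose m) * (-u) ^ m)\<bar> \<le> K * u ^ 4"
      using K(2)[of u] K(2)[of "-u"] u by (auto simp: power_even_abs)
    ultimately show ?thesis by linarith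
  qed
  thus ?thesis using that[of "2 * K"] K(1) by auto
qed

text \<open>Truncations of the formal power series solution: the approximants of \<open>x\<close> and \<open>s\<close> are
  \<open>x_poly (v/9) / (t v)\<close> and \<open>s_poly (v/9) / (2 v\<^sup>2)\<close> with \<open>v = (2 t z)\<^bsup>-1/3\<^esup>\<close>. Scaling the argument by 9 makes all
  coefficients integral.\<close>

definition x_poly :: "real \<Rightarrow> real \<Rightarrow> real poly" where
  "x_poly t \<alpha> =
    [:1,
     3 * \<alpha>,
     9 * \<alpha>^2,
     18 * \<alpha>^3 + 9 * \<alpha>,
     81 * \<alpha>^2 + 2187 * t^2,
     - 162 * \<alpha>^5 + 162 * \<alpha>^3 - 6561 * \<alpha> * t^2 + 243 * \<alpha>,
     - 567 * \<alpha>^6 - 2025 * \<alpha>^4 - 19683 * \<alpha>^2 * t^2 + 3321 * \<alpha>^2 + 26244 * t^2:]"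

definition s_poly :: "real \<Rightarrow> real \<Rightarrow> real poly" where
  "s_poly t \<alpha> =
    [:1,
     - 3 * \<alpha>,
     0,
     9 * \<alpha>^3 - 9 * \<alpha>,
     27 * \<alpha>^4 - 27 * \<alpha>^2 + 4374 * t^2,
     243 * \<alpha>^3 - 19683 * \<alpha> * t^2 - 243 * \<alpha>,
     - 324 * \<alpha>^6 + 2106 * \<alpha>^4 + 19683 * \<alpha>^2 * t^2 - 1782 * \<alpha>^2 + 32805 * t^2,
     - 1215 * \<alpha>^7 - 15066 * \<alpha>^5 + 19683 * \<alpha>^3 * t^2 + 18468 * \<alpha>^3 - 98415 * \<alpha> * t^2,
     8019 * \<alpha>^8 + 16767 * \<alpha>^6 + 295245 * \<alpha>^4 * t^2 - 35721 * \<alpha>^4 - 354294 * \<alpha>^2 * t^2 + 4374 * \<alpha>^2 - 23914845 * t^4,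
     2187 * \<alpha>^9 + 54675 * \<alpha>^7 - 354294 * \<alpha>^5 * t^2 - 115911 * \<alpha>^5 + 944784 * \<alpha>^3 * t^2 + 59049 * \<alpha>^3 + 272629233 * \<alpha> * t^4 - 590490 * \<alpha> * t^2,
     - 41553 * \<alpha>^10 + 72171 * \<alpha>^8 - 3542940 * \<alpha>^6 * t^2 + 78732 * \<alpha>^6 + 7617321 * \<alpha>^4 * t^2 - 168399 * \<alpha>^4 - 947027862 * \<alpha>^2 * t^4 - 4074381 * \<alpha>^2 * t^2 + 59049 * \<alpha>^2 - 1520984142 * t^4:]"

lemma sum_atMost_numeral:
  "(\<Sum>i\<le>numeral k. f i) = (\<Sum>i\<le>pred_numeral k. f i) + f (numeral k)"
  by (simp add: numeral_eq_Suc)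

lemma coeff_pCons_numeral: "coeff (pCons a p) (numeral k) = coeff p (pred_numeral k)"
  by (simp add: numeral_eq_Suc)

text \<open>With the square tabulated, each coefficient of the residuals below requires only a
  single convolution.\<close>

lemma coeff_s_poly_square:
  "coeff (s_poly t \<alpha> * s_poly t \<alpha>) 0 = 1"
  "coeff (s_poly t \<alpha> * s_poly t \<alpha>) 1 = - 6 * \<alpha>"
  "coeff (s_poly t \<alpha> * s_poly t \<alpha>) 2 = 9 * \<alpha>^2"
  "coeff (s_poly t \<alpha> * s_poly t \<alpha>) 3 = 18 * \<alpha>^3 - 18 * \<alpha>"
  "coeff (s_poly t \<alpha> * s_poly t \<alpha>) 4 = 8748 * t^2"
  "coeff (s_poly t \<alpha> * s_poly t \<alpha>) 5 = - 162 * \<alpha>^5 + 648 * \<alpha>^3 - 65610 * \<alpha> * t^2 - 486 * \<alpha>"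
  "coeff (s_poly t \<alpha> * s_poly t \<alpha>) 6 = - 567 * \<alpha>^6 + 2592 * \<alpha>^4 + 157464 * \<alpha>^2 * t^2 - 2025 * \<alpha>^2 + 65610 * t^2"
  "coeff (s_poly t \<alpha> * s_poly t \<alpha>) 7 = - 43740 * \<alpha>^5 + 48114 * \<alpha>^3 - 472392 * \<alpha> * t^2"
  "coeff (s_poly t \<alpha> * s_poly t \<alpha>) 8 = 24057 * \<alpha>^8 + 126846 * \<alpha>^6 + 354294 * \<alpha>^4 * t^2 - 190269 * \<alpha>^4 + 13122 * \<alpha>^2 - 28697814 * t^4"
  "coeff (s_poly t \<alpha> * s_poly t \<alpha>) 9 = - 49572 * \<alpha>^9 + 65610 * \<alpha>^7 - 3188646 * \<alpha>^5 * t^2 - 113724 * \<alpha>^5 + 7440174 * \<alpha>^3 * t^2 + 137052 * \<alpha>^3 + 516560652 * \<alpha> * t^4 - 3897234 * \<alpha> * t^2"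
  "coeff (s_poly t \<alpha> * s_poly t \<alpha>) 10 = - 135594 * \<alpha>^10 - 301806 * \<alpha>^8 - 6377292 * \<alpha>^6 * t^2 + 1305639 * \<alpha>^6 + 17006112 * \<alpha>^4 * t^2 - 1045386 * \<alpha>^4 - 2970223749 * \<alpha>^2 * t^4 - 10628820 * \<alpha>^2 * t^2 + 177147 * \<alpha>^2 - 2754990144 * t^4"
  unfolding coeff_mult s_poly_def
  by (simp add: sum_atMost_numeral coeff_pCons_numeral; (algebra)?)+


lemma coeff_x_poly_square:
  "coeff (x_poly t \<alpha> * x_poly t \<alpha>) 0 = 1"
  "coeff (x_poly t \<alpha> * x_poly t \<alpha>) 1 = 6 * \<alpha>"
  "coeff (x_poly t \<alpha> * x_poly t \<alpha>) 2 = 27 * \<alpha>^2"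
  "coeff (x_poly t \<alpha> * x_poly t \<alpha>) 3 = 90 * \<alpha>^3 + 18 * \<alpha>"
  "coeff (x_poly t \<alpha> * x_poly t \<alpha>) 4 = 189 * \<alpha>^4 + 216 * \<alpha>^2 + 4374 * t^2"
  "coeff (x_poly t \<alpha> * x_poly t \<alpha>) 5 = 972 * \<alpha>^3 + 486 * \<alpha>"
  "coeff (x_poly t \<alpha> * x_poly t \<alpha>) 6 = - 1782 * \<alpha>^6 - 1296 * \<alpha>^4 - 39366 * \<alpha>^2 * t^2 + 8181 * \<alpha>^2 + 52488 * t^2"
  "coeff (x_poly t \<alpha> * x_poly t \<alpha>) 7 = - 6318 * \<alpha>^7 - 6318 * \<alpha>^5 - 157464 * \<alpha>^3 * t^2 + 25758 * \<alpha>^3 + 196830 * \<alpha> * t^2"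
  "coeff (x_poly t \<alpha> * x_poly t \<alpha>) 8 = - 16038 * \<alpha>^8 - 33534 * \<alpha>^6 - 590490 * \<alpha>^4 * t^2 + 78003 * \<alpha>^4 + 708588 * \<alpha>^2 * t^2 + 4374 * \<alpha>^2 + 4782969 * t^4"
  "coeff (x_poly t \<alpha> * x_poly t \<alpha>) 9 = - 20412 * \<alpha>^9 - 109350 * \<alpha>^7 - 1417176 * \<alpha>^5 * t^2 + 109350 * \<alpha>^5 + 236196 * \<alpha>^3 * t^2 + 99144 * \<alpha>^3 - 28697814 * \<alpha> * t^4 + 1535274 * \<alpha> * t^2"
  "coeff (x_poly t \<alpha> * x_poly t \<alpha>) 10 = 26244 * \<alpha>^10 - 144342 * \<alpha>^8 - 354294 * \<alpha>^6 * t^2 - 380538 * \<alpha>^6 - 14171760 * \<alpha>^4 * t^2 + 616734 * \<alpha>^4 - 43046721 * \<alpha>^2 * t^4 + 15588936 * \<alpha>^2 * t^2 + 59049 * \<alpha>^2 + 114791256 * t^4"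
  unfolding coeff_mult x_poly_def
  by (simp add: sum_atMost_numeral coeff_pCons_numeral; (algebra)?)+


text \<open>For \<open>f = poly p (v/9) / v\<^sup>r\<close> the polynomial of \<open>f (z + 1/2) + f (z - 1/2)\<close> up to terms of relative order \<open>v\<^sup>1\<^sup>2\<close>:
  the second difference of \<open>v\<^sup>k\<close> is \<open>k (k + 3) / 9 * t\<^sup>2 v\<^sup>k\<^sup>+\<^sup>6\<close> to leading order, and \<open>59049 = 9\<^sup>6 / 9\<close>.\<close>

definition central_sum_poly :: "real \<Rightarrow> real \<Rightarrow> real poly \<Rightarrow> real poly" where
  "central_sum_poly t r p = smult 2 p + monom (59049 * t\<^sup>2) 6 *
     (\<Sum>i\<le>degree p. monom (coeff p i * ((real i - r) * (real i - r + 3))) i)"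

lemma coeff_central_sum_poly:
  "coeff (central_sum_poly t r p) k = 2 * coeff p k +
     (if k < 6 then 0 else 59049 * t\<^sup>2 * (coeff p (k - 6) * ((real (k - 6) - r) * (real (k - 6) - r + 3))))"
proof -
  have "coeff (\<Sum>i\<le>degree p. monom (coeff p i * ((real i - r) * (real i - r + 3))) i) j
      = coeff p j * ((real j - r) * (real j - r + 3))" for j
  proof -
    have "coeff (\<Sum>i\<le>degree p. monom (coeff p i * ((real i - r) * (real i - r + 3))) i) j
      = (\<Sum>i\<le>degree p. if i = j then coeff p j * ((real j - r) * (real j - r + 3)) else 0)"
      unfolding coeff_sum by (intro sum.cong) auto
    thus ?thesis by (simp add: coeff_eq_0)
  qed
  thus ?thesis by (simp add: central_sum_poly_def coeff_monom_mult)
qed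

text \<open>At w = v / 9 this is 4 t v^5 times the defect of the approximants in the x-equation,
  with the neighbour sum replaced by its truncation. Here 6561 = 9^4 and 118098 = 2 * 9^5.\<close>

definition residual_x_poly where
  "residual_x_poly t \<alpha> = central_sum_poly t 1 (x_poly t \<alpha>) * (s_poly t \<alpha> * s_poly t \<alpha> - monom (6561 * t\<^sup>2) 4)
     - smult 2 (s_poly t \<alpha>) + monom (118098 * \<alpha> * t\<^sup>2) 5"

text \<open>Likewise for the s-equation, whose defect is multiplied by 2 v^2 and the square of the
  value of \<open>x_poly\<close>; 13122 = 2 * 9^4.\<close>

definition residual_s_poly where
  "residual_s_poly t \<alpha> = central_sum_poly t 2 (s_poly t \<alpha>) * (x_poly t \<alpha> * x_poly t \<alpha>)
     - smult 2 (x_poly t \<alpha>) - monom (13122 * t\<^sup>2) 4"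

lemma less_11_cases: "(k::nat) < 11 \<longleftrightarrow> k \<in> {0, 1, 2, 3, 4, 5, 6, 7, 8, 9, 10}"
  by (auto simp: eval_nat_numeral less_Suc_eq)

text \<open>The k-th coefficients of \<open>x_poly\<close> and \<open>s_poly\<close> enter the k-th
  condition of either residual only through their sum; comparing the two conditions constrains
  coefficients four orders lower. Hence degree 6 suffices for \<open>x_poly\<close>, while
  \<open>s_poly\<close> runs to degree 10 and makes up for the missing terms of
  \<open>x_poly\<close>.\<close>

lemma residual_x_poly_dvd: "monom 1 11 dvd residual_x_poly t \<alpha>"
proof -
  have c: "coeff (residual_x_poly t \<alpha>) k = (\<Sum>i\<le>k. coeff (central_sum_poly t 1 (x_poly t \<alpha>)) i *
       (coeff (s_poly t \<alpha> * s_poly t \<alpha>) (k - i) - (if 4 = k - i then 6561 * t\<^sup>2 else 0)))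
       - 2 * coeff (s_poly t \<alpha>) k + (if 5 = k then 118098 * \<alpha> * t\<^sup>2 else 0)" for k
      by (simp only: residual_x_poly_def coeff_add coeff_diff coeff_smult coeff_monom coeff_mult[of "central_sum_poly t 1 (x_poly t \<alpha>)"])
  have "\<And>k. k < 11 \<Longrightarrow> coeff (residual_x_poly t \<alpha>) k = 0"
      unfolding less_11_cases c
      apply (elim insertE emptyE; hypsubst)
      apply (simp_all add: coeff_central_sum_poly sum_atMost_numeral coeff_s_poly_square[unfolded One_nat_def])
      apply (simp add: x_poly_def s_poly_def coeff_pCons_numeral; (algebra)?)+
      done
  thus ?thesis by (simp add: monom_1_dvd_iff')
qed

lemma residual_s_poly_dvd: "monom 1 11 dvd residual_s_poly t \<alpha>"
proof -
  have c: "coeff (residual_s_poly t \<alpha>) k = (\<Sum>i\<le>k. coeff (central_sum_poly t 2 (s_poly t \<alpha>)) i *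
       coeff (x_poly t \<alpha> * x_poly t \<alpha>) (k - i))
       - 2 * coeff (x_poly t \<alpha>) k - (if 4 = k then 13122 * t\<^sup>2 else 0)" for k
      by (simp only: residual_s_poly_def coeff_add coeff_diff coeff_smult coeff_monom coeff_mult[of "central_sum_poly t 2 (s_poly t \<alpha>)"])
  have "\<And>k. k < 11 \<Longrightarrow> coeff (residual_s_poly t \<alpha>) k = 0"
      unfolding less_11_cases c
      apply (elim insertE emptyE; hypsubst)
      apply (simp_all add: coeff_central_sum_poly sum_atMost_numeral coeff_x_poly_square[unfolded One_nat_def])
      apply (simp add: x_poly_def s_poly_def coeff_pCons_numeral; (algebra)?)+
      done
  thus ?thesis by (simp add: monom_1_dvd_iff')
qed

subsection \<open>The comparison principle\<close>

lemma null_sequence_attains_max: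
  fixes r :: "nat \<Rightarrow> real"
  assumes lim: "r \<longlonglongrightarrow> 0" and n: "n \<ge> n0" "r n > c" and c: "c > 0"
  obtains m where "m \<ge> n0" "r m > c" "\<And>k. k \<ge> n0 \<Longrightarrow> r k \<le> r m"
proof -
  obtain N where N: "\<And>k. k \<ge> N \<Longrightarrow> r k < c"
    using order_tendstoD(2)[OF lim c] by (auto simp: eventually_sequentially)
  have "n \<le> N" using N[of n] n by (cases "n \<le> N") auto
  have fin: "finite {n0..N}" "{n0..N} \<noteq> {}" using n \<open>n \<le> N\<close> by auto
  obtain m where m: "m \<in> {n0..N}" "\<And>k. k \<in> {n0..N} \<Longrightarrow> r k \<le> r m"
    using Max_in[of "r ` {n0..N}"] Max_ge[of "r ` {n0..N}"] fin by (metis (no_types, lifting) finite_imageI image_iff image_is_empty imageI)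
  have "r m > c" using m(2)[of n] n \<open>n \<le> N\<close> by simp
  moreover have "r k \<le> r m" if "k \<ge> n0" for k
    using N[of k] m(2)[of k] that \<open>r m > c\<close> by (cases "k \<le> N") auto
  ultimately show ?thesis using that m(1) by auto
qed

locale positive_solution =
  fixes t \<alpha> :: real and x s :: "nat \<Rightarrow> real"
  assumes t: "t > 0" and \<alpha>: "\<alpha> > -1"
    and x_pos: "x n > 0" and s_gt: "s n > t / 2"
    and x_eq: "(x n + x (Suc n)) * ((s n)\<^sup>2 - (t/2)\<^sup>2) = (2 * real n + 2 + \<alpha>) * s n - \<alpha> * (t/2)"
    and s_eq: "s n + s (Suc n) = (2 * real n + 3 + \<alpha>) / x (Suc n) + 1 / (x (Suc n))\<^sup>2"
begin

lemma s_pos: "s n > 0"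
  using s_gt[of n] t by linarith

text \<open>In quotient form, (2 z S - \<alpha> T) / (S^2 - T^2) is compared at T and at t / 2. The
  last assumption makes z large enough for the growth caused by the denominator to outweigh the term
  with \<alpha>, whatever its sign.\<close>

lemma shift_mono:
  assumes "S > 0" "T \<ge> 0" "T < S" "t/2 < S" "2 * \<bar>\<alpha>\<bar> * S \<le> z * t"
  shows "T \<ge> t/2 \<Longrightarrow> (2*z*S - \<alpha>*(t/2)) * (S\<^sup>2 - T\<^sup>2) \<le> (2*z*S - \<alpha>*T) * (S\<^sup>2 - (t/2)\<^sup>2)"
    and "T \<le> t/2 \<Longrightarrow> (2*z*S - \<alpha>*T) * (S\<^sup>2 - (t/2)\<^sup>2) \<le> (2*z*S - \<alpha>*(t/2)) * (S\<^sup>2 - T\<^sup>2)"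
proof -
  have id: "(2*z*S - \<alpha>*T) * (S\<^sup>2 - (t/2)\<^sup>2) - (2*z*S - \<alpha>*(t/2)) * (S\<^sup>2 - T\<^sup>2)
      = (T - t/2) * (2*z*S*(T + t/2) - \<alpha> * (S\<^sup>2 + T*(t/2)))"
    by (simp add: power2_eq_square field_simps)
  have "z * t \<ge> 0" using assms(1,5) by (smt (verit) mult_nonneg_nonneg)
  hence z: "z \<ge> 0" using t by (simp add: zero_le_mult_iff)
  have "T * (t/2) \<le> S * S" using assms t by (intro mult_mono) auto
  hence "\<alpha> * (S\<^sup>2 + T*(t/2)) \<le> \<bar>\<alpha>\<bar> * (2 * S\<^sup>2)"
    using assms t by (intro mult_mono) (auto simp: power2_eq_square)
  also have "\<dots> = 2 * \<bar>\<alpha>\<bar> * S * S" by (simp add: power2_eq_square)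
  also have "\<dots> \<le> z * t * S" using assms by (intro mult_right_mono) auto
  also have "\<dots> \<le> 2*z*S*(T + t/2)" using z assms by (simp add: algebra_simps)
  finally have *: "2*z*S*(T + t/2) - \<alpha> * (S\<^sup>2 + T*(t/2)) \<ge> 0" by simp
  show "T \<ge> t/2 \<Longrightarrow> (2*z*S - \<alpha>*(t/2)) * (S\<^sup>2 - T\<^sup>2) \<le> (2*z*S - \<alpha>*T) * (S\<^sup>2 - (t/2)\<^sup>2)"
    using id mult_nonneg_nonneg[of "T - t/2", OF _ *] by simp
  show "T \<le> t/2 \<Longrightarrow> (2*z*S - \<alpha>*T) * (S\<^sup>2 - (t/2)\<^sup>2) \<le> (2*z*S - \<alpha>*(t/2)) * (S\<^sup>2 - T\<^sup>2)"
  proof -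
    assume "T \<le> t/2"
    hence "(T - t/2) * (2*z*S*(T + t/2) - \<alpha> * (S\<^sup>2 + T*(t/2))) \<le> 0"
      using * by (intro mult_nonpos_nonneg) auto
    thus ?thesis using id by linarith
  qed
qed

text \<open>If the maximum \<open>\<Theta>\<close> over all \<open>n\<close> of the ratios of the solution to the barrier exceeds 1, then at the index where it is
  attained the recurrence for the solution contradicts the strict inequality for the barrier scaled by \<open>\<Theta>\<close>. The equation for
  \<open>x\<close> is not homogeneous in \<open>s\<close>; \<open>shift_mono\<close> absorbs the resulting change of \<open>t / 2\<close>.\<close>

lemma upper_comparison:
  assumes S: "\<And>n. n \<ge> n0 \<Longrightarrow> S n > t/2"
      "\<And>n. n \<ge> n0 \<Longrightarrow> 2 * \<bar>\<alpha>\<bar> * S n \<le> (real n + 1 + \<alpha>/2) * t"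
    and E: "\<And>n. n \<ge> n0 \<Longrightarrow> E n \<ge> 1" and Y: "\<And>n. n \<ge> n0 \<Longrightarrow> Y n > 0"
    and super_x: "\<And>n. n \<ge> n0 \<Longrightarrow> (Y n + Y (Suc n)) * ((S n)\<^sup>2 - (t/2)\<^sup>2)
                     < E n * ((2 * real n + 2 + \<alpha>) * S n - \<alpha> * (t/2))"
    and super_s: "\<And>n. n \<ge> n0 \<Longrightarrow> (2 * real n + 3 + \<alpha>) / Y (Suc n) + 1 / (Y (Suc n))\<^sup>2
                     < S n / E n + S (Suc n) / E (Suc n)"
    and start: "x n0 \<le> Y n0"
    and lim: "(\<lambda>n. x n / Y n) \<longlonglongrightarrow> 0" "(\<lambda>n. S n / (E n * s n)) \<longlonglongrightarrow> 0"
    and n: "n \<ge> n0"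
  shows "x n \<le> Y n \<and> S n / E n \<le> s n"
proof -
  define r where "r n = max (x n / Y n) (S n / (E n * s n))" for n
  have "r n \<le> 1"
  proof (rule ccontr)
    assume "\<not> r n \<le> 1"
    moreover have "r \<longlonglongrightarrow> 0"
      using tendsto_max[OF lim] by (simp add: r_def[abs_def])
    ultimately obtain m where m: "m \<ge> n0" "r m > 1" "\<And>k. k \<ge> n0 \<Longrightarrow> r k \<le> r m"
      using null_sequence_attains_max[of r n0 n 1] n by auto
    define \<Theta> where "\<Theta> = r m"
    have \<Theta>: "\<Theta> > 1" using m by (simp add: \<Theta>_def)
    have hx: "x k \<le> \<Theta> * Y k" and hs: "S k / E k \<le> \<Theta> * s k" if "k \<ge> n0" for k
      using m(3)[OF that] that Y[of k] E[of k] s_pos[of k] \<Theta>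
      by (auto simp: r_def[of k] \<Theta>_def[symmetric] field_simps)
    consider "x m = \<Theta> * Y m" | "S m = \<Theta> * E m * s m"
      using m(1) Y[of m] E[of m] s_pos[of m] unfolding \<Theta>_def r_def
      by (cases "x m / Y m \<le> S m / (E m * s m)") (auto simp: max_def)
    thus False
    proof cases
      case 1
      \<comment> \<open>\<open>start\<close> excludes n0, so the s-equation at m - 1 is available.
        Its term 1 / x^2 has degree -2, so scaling by \<Theta> leaves a factor 1 / \<Theta> < 1 on
        it, which errs in the favourable direction.\<close>
      have "m \<noteq> n0" using 1 start \<Theta> Y[of n0] by (auto simp: not_le)
      then obtain k where k: "m = Suc k" "k \<ge> n0" using m(1) by (cases m) auto
      have Ym: "Y m > 0" using Y m(1) by simp
      have "(2 * real k + 3 + \<alpha>) / Y m + 1 / (Y m)\<^sup>2 < S k / E k + S (Suc k) / E (Suc k)"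
        using super_s[OF k(2)] k(1) by simp
      also have "\<dots> \<le> \<Theta> * (s k + s (Suc k))"
        using hs[of k] hs[of "Suc k"] k by (simp add: distrib_left)
      also have "\<dots> = \<Theta> * ((2 * real k + 3 + \<alpha>) / (\<Theta> * Y m) + 1 / (\<Theta> * Y m)\<^sup>2)"
        using s_eq[of k] 1 k by simp
      also have "\<dots> = (2 * real k + 3 + \<alpha>) / Y m + 1 / (Y m)\<^sup>2 / \<Theta>"
        using \<Theta> Ym by (simp add: field_simps power2_eq_square)
      also have "1 / (Y m)\<^sup>2 / \<Theta> \<le> 1 / (Y m)\<^sup>2"
        using \<Theta> Ym by (simp add: field_simps)
      finally show False by simp
    next
      case 2
      \<comment> \<open>Since S m = F s m, multiplying the x-equation by F^2 replaces s m by S m, at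
        the price of turning t / 2 into T = F t / 2.\<close>
      define F T z where "F = E m * \<Theta>" and "T = F * (t/2)" and "z = real m + 1 + \<alpha>/2"
      have E1: "E m \<ge> 1" using E m(1) by simp
      have "1 * 1 \<le> E m * \<Theta>" using E1 \<Theta> by (intro mult_mono) auto
      hence F: "F \<ge> 1" by (simp add: F_def)
      have SF: "S m = F * s m" using 2 by (simp add: F_def)
      have T: "T \<ge> t/2" using F t by (simp add: T_def)
      have TS: "T < S m" unfolding SF T_def using F s_gt[of m] by (intro mult_strict_left_mono) auto
      have "(x m + x (Suc m)) * ((s m)\<^sup>2 - (t/2)\<^sup>2) = 2 * z * s m - \<alpha> * (t/2)"
        unfolding x_eq by (simp add: z_def algebra_simps)
      hence "F\<^sup>2 * ((x m + x (Suc m)) * ((s m)\<^sup>2 - (t/2)\<^sup>2)) = F\<^sup>2 * (2 * z * s m - \<alpha> * (t/2))"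
        by simp
      hence eq: "(x m + x (Suc m)) * ((S m)\<^sup>2 - T\<^sup>2) = F * (2 * z * S m - \<alpha> * T)"
        by (simp add: SF T_def power2_eq_square algebra_simps)
      have D: "(S m)\<^sup>2 - T\<^sup>2 > 0" "(S m)\<^sup>2 - (t/2)\<^sup>2 > 0"
        using T TS t by (auto intro!: power_strict_mono)
      have "\<Theta> * (E m * (2 * z * S m - \<alpha> * T)) \<le> \<Theta> * ((Y m + Y (Suc m)) * ((S m)\<^sup>2 - T\<^sup>2))"
        using mult_right_mono[OF add_mono[OF hx[of m] hx[of "Suc m"]], of "(S m)\<^sup>2 - T\<^sup>2"] D m(1)
        unfolding eq by (simp add: F_def algebra_simps)
      hence "E m * (2 * z * S m - \<alpha> * T) \<le> (Y m + Y (Suc m)) * ((S m)\<^sup>2 - T\<^sup>2)"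
        using \<Theta> by simp
      hence "E m * (2 * z * S m - \<alpha> * T) * ((S m)\<^sup>2 - (t/2)\<^sup>2) \<le> (Y m + Y (Suc m)) * ((S m)\<^sup>2 - T\<^sup>2) * ((S m)\<^sup>2 - (t/2)\<^sup>2)"
        using D by (intro mult_right_mono) auto
      moreover have "E m * ((2 * z * S m - \<alpha> * (t/2)) * ((S m)\<^sup>2 - T\<^sup>2)) \<le> E m * ((2 * z * S m - \<alpha> * T) * ((S m)\<^sup>2 - (t/2)\<^sup>2))"
        using S[of m] m(1) T TS t E1
        by (intro mult_left_mono shift_mono(1)) (auto simp: z_def)
      ultimately have "(E m * (2 * z * S m - \<alpha> * (t/2))) * ((S m)\<^sup>2 - T\<^sup>2) \<le> ((Y m + Y (Suc m)) * ((S m)\<^sup>2 - (t/2)\<^sup>2)) * ((S m)\<^sup>2 - T\<^sup>2)"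
        by (simp add: mult_ac)
      hence "E m * (2 * z * S m - \<alpha> * (t/2)) \<le> (Y m + Y (Suc m)) * ((S m)\<^sup>2 - (t/2)\<^sup>2)"
        using D by (simp only: mult_le_cancel_right_pos)
      moreover have "2 * z = 2 * real m + 2 + \<alpha>" by (simp add: z_def)
      ultimately show False using super_x[OF m(1)] by simp
    qed
  qed
  thus ?thesis using Y[OF n] E[OF n] s_pos[of n] by (simp add: r_def field_simps)
qed

text \<open>The mirror image of the upper comparison: \<Theta> now scales the solution instead of
  the barrier, so t / 2 shrinks to T \<le> t / 2 and the second half of \<open>shift_mono\<close>
  applies.\<close>

lemma lower_comparison:
  assumes S: "\<And>n. n \<ge> n0 \<Longrightarrow> S n > t/2"
      "\<And>n. n \<ge> n0 \<Longrightarrow> 2 * \<bar>\<alpha>\<bar> * S n \<le> (real n + 1 + \<alpha>/2) * t"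
    and E: "\<And>n. n \<ge> n0 \<Longrightarrow> E n \<ge> 1" and Y: "\<And>n. n \<ge> n0 \<Longrightarrow> Y n > 0"
    and sub_x: "\<And>n. n \<ge> n0 \<Longrightarrow> (2 * real n + 2 + \<alpha>) * S n - \<alpha> * (t/2)
                     < E n * ((Y n + Y (Suc n)) * ((S n)\<^sup>2 - (t/2)\<^sup>2))"
    and sub_s: "\<And>n. n \<ge> n0 \<Longrightarrow> S n * E n + S (Suc n) * E (Suc n)
                     < (2 * real n + 3 + \<alpha>) / Y (Suc n) + 1 / (Y (Suc n))\<^sup>2"
    and start: "Y n0 \<le> x n0"
    and lim: "(\<lambda>n. Y n / x n) \<longlonglongrightarrow> 0" "(\<lambda>n. s n / (S n * E n)) \<longlonglongrightarrow> 0"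
    and n: "n \<ge> n0"
  shows "Y n \<le> x n \<and> s n \<le> S n * E n"
proof -
  have S_pos: "S n > 0" if "n \<ge> n0" for n using S(1)[OF that] t by linarith
  define r where "r n = max (Y n / x n) (s n / (S n * E n))" for n
  have SE: "S n * E n > 0" if "n \<ge> n0" for n using S_pos[OF that] E[OF that] by simp
  have "r n \<le> 1"
  proof (rule ccontr)
    assume "\<not> r n \<le> 1"
    moreover have "r \<longlonglongrightarrow> 0"
      using tendsto_max[OF lim] by (simp add: r_def[abs_def])
    ultimately obtain m where m: "m \<ge> n0" "r m > 1" "\<And>k. k \<ge> n0 \<Longrightarrow> r k \<le> r m"
      using null_sequence_attains_max[of r n0 n 1] n by auto
    define \<Theta> where "\<Theta> = r m"
    have \<Theta>: "\<Theta> > 1" using m by (simp add: \<Theta>_def)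
    have hx: "Y k \<le> \<Theta> * x k" and hs: "s k \<le> \<Theta> * (S k * E k)" if "k \<ge> n0" for k
      using m(3)[OF that] SE[OF that] x_pos[of k]
      by (auto simp: r_def[of k] \<Theta>_def[symmetric] pos_divide_le_eq)
    consider "Y m = \<Theta> * x m" | "s m = \<Theta> * (S m * E m)"
      using S_pos[OF m(1)] E[OF m(1)] x_pos[of m] unfolding \<Theta>_def r_def
      by (cases "Y m / x m \<le> s m / (S m * E m)") (auto simp: max_def)
    thus False
    proof cases
      case 1
      have "m \<noteq> n0" using 1 start \<Theta> x_pos[of n0] by (auto simp: not_le)
      then obtain k where k: "m = Suc k" "k \<ge> n0" using m(1) by (cases m) auto
      have xm: "x m > 0" by (rule x_pos)
      have "s k + s (Suc k) \<le> \<Theta> * (S k * E k + S (Suc k) * E (Suc k))"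
        using hs[of k] hs[of "Suc k"] k by (simp add: algebra_simps)
      also have "\<dots> < \<Theta> * ((2 * real k + 3 + \<alpha>) / (\<Theta> * x m) + 1 / (\<Theta> * x m)\<^sup>2)"
        using sub_s[OF k(2)] 1 k \<Theta> by simp
      also have "\<dots> = (2 * real k + 3 + \<alpha>) / x m + 1 / (x m)\<^sup>2 / \<Theta>"
        using \<Theta> xm by (simp add: field_simps power2_eq_square)
      also have "1 / (x m)\<^sup>2 / \<Theta> \<le> 1 / (x m)\<^sup>2"
        using \<Theta> xm by (simp add: field_simps)
      also have "(2 * real k + 3 + \<alpha>) / x m + 1 / (x m)\<^sup>2 = s k + s (Suc k)"
        using s_eq[of k] k by simp
      finally show False by simp
    next
      case 2
      define F T z where "F = E m * \<Theta>" and "T = t/2 / F" and "z = real m + 1 + \<alpha>/2"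
      have E1: "E m \<ge> 1" using E m(1) by simp
      have "1 * 1 \<le> E m * \<Theta>" using E1 \<Theta> by (intro mult_mono) auto
      hence F: "F \<ge> 1" by (simp add: F_def)
      have SF: "s m = F * S m" using 2 by (simp add: F_def mult_ac)
      have FT: "t/2 = F * T" using F by (simp add: T_def)
      have T: "T \<le> t/2" "T \<ge> 0" using F t by (auto simp: T_def field_simps)
      have TS: "T < S m" using T S(1)[OF m(1)] by linarith
      have "F * ((x m + x (Suc m)) * (F * ((S m)\<^sup>2 - T\<^sup>2))) = F * (2 * z * S m - \<alpha> * T)"
        using x_eq[of m] unfolding FT SF by (simp add: z_def power2_eq_square algebra_simps)
      hence eq: "(x m + x (Suc m)) * (F * ((S m)\<^sup>2 - T\<^sup>2)) = 2 * z * S m - \<alpha> * T"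
        using F by simp
      have D: "(S m)\<^sup>2 - T\<^sup>2 > 0" "(S m)\<^sup>2 - (t/2)\<^sup>2 > 0"
        using T TS t S(1)[OF m(1)] by (auto intro!: power_strict_mono)
      have "E m * ((Y m + Y (Suc m)) * ((S m)\<^sup>2 - T\<^sup>2)) \<le> E m * ((\<Theta> * x m + \<Theta> * x (Suc m)) * ((S m)\<^sup>2 - T\<^sup>2))"
        using hx[of m] hx[of "Suc m"] m(1) D E1 by (intro mult_left_mono mult_right_mono add_mono) auto
      also have "\<dots> = 2 * z * S m - \<alpha> * T"
        unfolding eq[symmetric] by (simp add: F_def algebra_simps)
      finally have "E m * ((Y m + Y (Suc m)) * ((S m)\<^sup>2 - T\<^sup>2)) * ((S m)\<^sup>2 - (t/2)\<^sup>2) \<le> (2 * z * S m - \<alpha> * T) * ((S m)\<^sup>2 - (t/2)\<^sup>2)"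
        using D by (intro mult_right_mono) auto
      also have "\<dots> \<le> (2 * z * S m - \<alpha> * (t/2)) * ((S m)\<^sup>2 - T\<^sup>2)"
        using S[OF m(1)] S_pos[OF m(1)] T TS by (intro shift_mono(2)) (auto simp: z_def)
      finally have "(E m * ((Y m + Y (Suc m)) * ((S m)\<^sup>2 - (t/2)\<^sup>2))) * ((S m)\<^sup>2 - T\<^sup>2) \<le> (2 * z * S m - \<alpha> * (t/2)) * ((S m)\<^sup>2 - T\<^sup>2)"
        by (simp add: mult_ac)
      hence "E m * ((Y m + Y (Suc m)) * ((S m)\<^sup>2 - (t/2)\<^sup>2)) \<le> 2 * z * S m - \<alpha> * (t/2)"
        using D by (simp only: mult_le_cancel_right_pos)
      moreover have "2 * z = 2 * real m + 2 + \<alpha>" by (simp add: z_def)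
      ultimately show False using sub_x[OF m(1)] by simp
    qed
  qed
  thus ?thesis using SE[OF n] x_pos[of n] by (simp add: r_def pos_divide_le_eq)
qed

section \<open>A priori growth bounds\<close>

text \<open>Since s exceeds t / 2, the left side of the s-equation exceeds t, and its right side
  would be smaller than that for a large x. Together with the next bound this yields the limits
  required by the comparison lemmas.\<close>

lemma x_upper: "x (Suc n) \<le> 1 + (2 * real n + 4 + \<alpha>) / t"
proof (rule ccontr)
  assume "\<not> ?thesis"
  hence big: "x (Suc n) > 1 + (2 * real n + 4 + \<alpha>) / t" by simp
  have pos: "(2 * real n + 4 + \<alpha>) / t > 0" using \<alpha> t by simp
  hence x1: "x (Suc n) > 1" using big by linarith
  have "t < s n + s (Suc n)" using s_gt[of n] s_gt[of "Suc n"] by simp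
  also have "\<dots> = (2 * real n + 3 + \<alpha>) / x (Suc n) + 1 / (x (Suc n))\<^sup>2" by (rule s_eq)
  also have "1 / (x (Suc n))\<^sup>2 \<le> 1 / x (Suc n)"
    using x1 by (simp add: field_simps power2_eq_square)
  also have "(2 * real n + 3 + \<alpha>) / x (Suc n) + 1 / x (Suc n) = (2 * real n + 4 + \<alpha>) / x (Suc n)"
    by (simp add: add_divide_distrib)
  finally have "t * x (Suc n) < 2 * real n + 4 + \<alpha>" using x1 by (simp add: field_simps)
  moreover have "t * x (Suc n) > t * (1 + (2 * real n + 4 + \<alpha>) / t)" using big t by simp
  moreover have "t * (1 + (2 * real n + 4 + \<alpha>) / t) = t + (2 * real n + 4 + \<alpha>)"
    using t by (simp add: field_simps)
  ultimately show False using t by simp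
qed

text \<open>The x-equations at n and n + 1 bound (s - t / 2) \<open>x (Suc n)\<close> for both
  neighbouring s. Adding them and inserting the s-equation leaves a single 1 / x to be
  estimated.\<close>

lemma inverse_x_upper: "1 / x (Suc n) \<le> 1 + t + 2 * real n + 3 + \<alpha>"
proof -
  \<comment> \<open>The factor s k + t / 2 cancels from s^2 - (t / 2)^2; the term dropped on the
    right has a sign because 2 k + 2 + 2 \<alpha> > 0.\<close>
  have key: "(s k - t/2) * y \<le> 2 * real k + 2 + \<alpha>" if y: "0 < y" "y \<le> x k + x (Suc k)" for k y
  proof -
    have "(s k - t/2) * y * (s k + t/2) \<le> (x k + x (Suc k)) * ((s k)\<^sup>2 - (t/2)\<^sup>2)"
      using mult_right_mono[OF y(2), of "(s k - t/2) * (s k + t/2)", OF mult_nonneg_nonneg] s_gt[of k] t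
      by (simp add: power2_eq_square algebra_simps)
    also have "\<dots> = (2 * real k + 2 + \<alpha>) * (s k + t/2) - (2 * real k + 2 + 2 * \<alpha>) * (t/2)"
      unfolding x_eq by (simp add: algebra_simps)
    also have "\<dots> \<le> (2 * real k + 2 + \<alpha>) * (s k + t/2)"
      using \<alpha> t by simp
    finally show ?thesis using s_gt[of k] t by simp
  qed
  let ?x = "x (Suc n)"
  have "(s n - t/2) * ?x \<le> 2 * real n + 2 + \<alpha>" "(s (Suc n) - t/2) * ?x \<le> 2 * real n + 4 + \<alpha>"
    using key[of ?x n] key[of ?x "Suc n"] x_pos[of n] x_pos[of "Suc n"] x_pos[of "Suc (Suc n)"] by auto
  hence "(s n + s (Suc n)) * ?x \<le> t * ?x + 2 * (2 * real n + 3 + \<alpha>)" by (simp add: algebra_simps)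
  moreover have "(s n + s (Suc n)) * ?x = (2 * real n + 3 + \<alpha>) + 1 / ?x"
    unfolding s_eq using x_pos[of "Suc n"] by (simp add: field_simps power2_eq_square)
  ultimately have *: "1 / ?x \<le> t * ?x + (2 * real n + 3 + \<alpha>)" by simp
  show ?thesis
  proof (cases "?x \<le> 1")
    case True
    hence "t * ?x \<le> t * 1" using t by (intro mult_left_mono) auto
    thus ?thesis using * by simp
  next
    case False
    hence "1 / ?x \<le> 1" using x_pos[of "Suc n"] by (simp add: field_simps)
    thus ?thesis using t \<alpha> by linarith
  qed
qed

end

subsection \<open>Barriers\<close>

lemma quotient_variation:
  fixes wp wm dp dm L M h :: real
  assumes "wm > 0" "dp > 0" "dm > 0" "h \<ge> 0" "L \<ge> 0"
    "\<bar>wp - wm\<bar> \<le> L * h * wm" "\<bar>dp - dm\<bar> \<le> M * h * dm" "M * h \<le> 1/2"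
  shows "\<bar>wp / dp - wm / dm\<bar> \<le> 2 * (L + M) * h * (wm / dm)"
proof -
  have "M * h * dm \<le> 1/2 * dm" using assms by (intro mult_right_mono) auto
  hence dd: "dm \<le> 2 * dp" using assms(7) by linarith
  have "M * h * dm \<ge> 0" using assms(7) by linarith
  hence *: "(L * h + M * h) * dm \<ge> 0" using assms by (simp add: distrib_right)
  have "wp / dp - wm / dm = ((wp - wm) * dm - wm * (dp - dm)) / (dp * dm)"
    using assms by (simp add: field_simps)
  also have "\<bar>\<dots>\<bar> = \<bar>(wp - wm) * dm - wm * (dp - dm)\<bar> / (dp * dm)"
    using assms by (simp add: abs_mult)
  also have "\<bar>(wp - wm) * dm - wm * (dp - dm)\<bar> \<le> \<bar>wp - wm\<bar> * dm + wm * \<bar>dp - dm\<bar>"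
    using assms abs_triangle_ineq4[of "(wp - wm) * dm" "wm * (dp - dm)"] by (simp add: abs_mult)
  also have "\<dots> \<le> (L * h * wm) * dm + wm * (M * h * dm)"
    using assms by (intro add_mono mult_right_mono mult_left_mono) auto
  also have "\<dots> = wm * ((L * h + M * h) * dm)" by (simp add: algebra_simps)
  finally have "\<bar>wp / dp - wm / dm\<bar> \<le> wm * ((L * h + M * h) * dm) / (dp * dm)"
    using assms by (simp add: divide_right_mono)
  also have "\<dots> = (L * h + M * h) * dm * (wm / dm) / dp"
    using assms by (simp add: field_simps)
  also have "\<dots> \<le> (L * h + M * h) * (2 * dp) * (wm / dm) / dp"
  proof -
    have "L * h + M * h \<ge> 0" using * assms by (simp add: zero_le_mult_iff)
    thus ?thesis using dd assms by (intro divide_right_mono mult_right_mono mult_left_mono) auto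
  qed
  also have "\<dots> = 2 * (L + M) * h * (wm / dm)" using assms by (simp add: field_simps)
  finally show ?thesis .
qed

text \<open>Pointwise form of the barrier inequalities. Later \<open>\<delta> = A v\<^sup>7 + \<epsilon> v\<^sup>-\<^sup>6\<close>, with \<open>\<delta>p\<close>, \<open>\<delta>m\<close> its values at \<open>z + 1/2\<close>,
  \<open>z - 1/2\<close>, and \<open>\<eta>p\<close>, \<open>\<eta>m\<close> those of \<open>v\<^sup>4 \<delta>\<close>. The factor \<open>1 + \<delta>\<close> alone is neutral to leading order; the correction
  \<open>c v\<^sup>4 \<delta>\<close> in the factor of \<open>s\<close> distributes the gain, which is of relative order \<open>v\<^sup>4 \<delta>\<close>, between the two equations.\<close>

locale barrier_point =
  fixes t c K B v \<delta> \<delta>p \<delta>m \<eta>p \<eta>m :: real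
  assumes t: "t > 0" and c: "c = t\<^sup>2 / 1024" and K: "K \<ge> 1" and v: "v > 0" and \<delta>: "\<delta> > 0"
    and \<delta>p: "\<bar>\<delta>p - \<delta>\<bar> \<le> K * v^3 * \<delta>" and \<delta>m: "\<bar>\<delta>m - \<delta>\<bar> \<le> K * v^3 * \<delta>"
    and \<delta>2: "\<bar>\<delta>p + \<delta>m - 2 * \<delta>\<bar> \<le> K * v^6 * \<delta>"
    and \<eta>p: "\<bar>\<eta>p - v^4 * \<delta>\<bar> \<le> K * v^3 * (v^4 * \<delta>)" and \<eta>m: "\<bar>\<eta>m - v^4 * \<delta>\<bar> \<le> K * v^3 * (v^4 * \<delta>)"
    and small: "K * v^3 \<le> 1/16" "100 * K\<^sup>2 * v\<^sup>2 \<le> c" "c * v^4 \<le> 1"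
    and B: "B * v^7 * (1 + 2 * \<delta>) < \<delta>" "B \<ge> 128 * t * K / c" "B \<ge> 8 * K / t\<^sup>2"
begin

lemma c_pos: "c > 0"
  by (subst c) (use t in simp)

text \<open>These are the sizes tolerated by the s-equation: there the correction costs 16 c or 20
  c, against a gain of t^2 / 4, half of which is reserved for the residual.\<close>

lemma c_le: "16 * c \<le> t\<^sup>2 / 8" "20 * c \<le> t\<^sup>2 / 8"
  by (subst c; simp)+

lemma v3: "K * v^3 * a \<le> a / 16" if "a \<ge> 0"
  using mult_right_mono[OF small(1) that] by simp

lemma \<delta>_bounds: "15/16 * \<delta> \<le> \<delta>p" "\<delta>p \<le> 17/16 * \<delta>" "15/16 * \<delta> \<le> \<delta>m" "\<delta>m \<le> 17/16 * \<delta>"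
  using \<delta>p \<delta>m v3[of \<delta>] \<delta> by linarith+

lemma \<eta>_bounds: "15/16 * (v^4*\<delta>) \<le> \<eta>p" "\<eta>p \<le> 17/16 * (v^4*\<delta>)" "15/16 * (v^4*\<delta>) \<le> \<eta>m" "\<eta>m \<le> 17/16 * (v^4*\<delta>)"
  "v^4 * \<delta> > 0"
proof -
  show p: "v^4 * \<delta> > 0" using v \<delta> by simp
  show "15/16 * (v^4*\<delta>) \<le> \<eta>p" "\<eta>p \<le> 17/16 * (v^4*\<delta>)" "15/16 * (v^4*\<delta>) \<le> \<eta>m" "\<eta>m \<le> 17/16 * (v^4*\<delta>)"
    using \<eta>p \<eta>m v3[of "v^4*\<delta>"] p by linarith+
qed

abbreviation "D \<equiv> 1 + \<delta>"
abbreviation "Dp \<equiv> 1 + \<delta>p"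
abbreviation "Dm \<equiv> 1 + \<delta>m"
abbreviation "E \<equiv> 1 + \<delta> + c * (v^4 * \<delta>)"
abbreviation "Ep \<equiv> 1 + \<delta>p + c * \<eta>p"
abbreviation "Em \<equiv> 1 + \<delta>m + c * \<eta>m"

lemma E_le: "E \<le> 1 + 2 * \<delta>"
proof -
  have "c * (v^4 * \<delta>) = (c * v^4) * \<delta>" by simp
  also have "\<dots> \<le> 1 * \<delta>" using small(3) \<delta> by (intro mult_right_mono) auto
  finally show ?thesis by simp
qed

lemma D_variation: "\<bar>Dp - Dm\<bar> \<le> 4 * K * v^3 * Dm"
proof -
  have "\<bar>Dp - Dm\<bar> \<le> 2 * (K * v^3 * \<delta>)" using \<delta>p \<delta>m by linarith
  also have "\<dots> \<le> 2 * (K * v^3 * (2 * Dm))"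
    using \<delta>_bounds \<delta> K v by (intro mult_left_mono) auto
  also have "\<dots> = 4 * K * v^3 * Dm" by (simp add: algebra_simps)
  finally show ?thesis .
qed

lemma E_variation: "\<bar>Ep - Em\<bar> \<le> 4 * K * v^3 * Em"
proof -
  have "\<bar>c * \<eta>p - c * \<eta>m\<bar> = c * \<bar>\<eta>p - \<eta>m\<bar>" using c_pos by (simp add: abs_mult flip: right_diff_distrib)
  also have "\<dots> \<le> c * (2 * (K * v^3 * (v^4 * \<delta>)))" using \<eta>p \<eta>m c_pos by (intro mult_left_mono) auto
  finally have "\<bar>Ep - Em\<bar> \<le> 2 * (K * v^3 * \<delta>) + c * (2 * (K * v^3 * (v^4 * \<delta>)))"
    using \<delta>p \<delta>m by linarith
  also have "\<dots> = 2 * (K * v^3 * (\<delta> + c * (v^4 * \<delta>)))" by (simp add: algebra_simps)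
  also have "\<dots> \<le> 2 * (K * v^3 * (2 * Em))"
  proof -
    have "c * (v^4 * \<delta>) \<le> c * (2 * \<eta>m)" using \<eta>_bounds c_pos by (intro mult_left_mono) auto
    hence "\<delta> + c * (v^4 * \<delta>) \<le> 2 * Em" using \<delta>_bounds \<delta> by auto
    thus ?thesis using K v by (intro mult_left_mono) auto
  qed
  also have "\<dots> = 4 * K * v^3 * Em" by (simp add: algebra_simps)
  finally show ?thesis .
qed

text \<open>A weighted mean of the neighbouring \<delta> deviates from the central value by a second
  difference and a product of two first differences. Both are O(v^6 \<delta>), and 100 K^2 v^2 \<le>
  c puts them below the correction of order v^4 \<delta>.\<close>

lemma second_difference:
  assumes "wm > 0" "\<bar>wp - wm\<bar> \<le> 10 * K * v^3 * wm"
  shows "\<bar>wp * (\<delta>p - \<delta>) + wm * (\<delta>m - \<delta>)\<bar> \<le> c / 2 * (v^4 * \<delta>) * wm"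
proof -
  have "wp * (\<delta>p - \<delta>) + wm * (\<delta>m - \<delta>) = wm * (\<delta>p + \<delta>m - 2 * \<delta>) + (wp - wm) * (\<delta>p - \<delta>)"
    by (simp add: algebra_simps)
  also have "\<bar>\<dots>\<bar> \<le> wm * \<bar>\<delta>p + \<delta>m - 2 * \<delta>\<bar> + \<bar>wp - wm\<bar> * \<bar>\<delta>p - \<delta>\<bar>"
    using assms abs_triangle_ineq[of "wm * (\<delta>p + \<delta>m - 2 * \<delta>)" "(wp - wm) * (\<delta>p - \<delta>)"]
    by (simp add: abs_mult)
  also have "\<dots> \<le> wm * (K * v^6 * \<delta>) + (10 * K * v^3 * wm) * (K * v^3 * \<delta>)"
    using assms \<delta>2 \<delta>p K v by (intro add_mono mult_mono) auto
  also have "\<dots> = (K + 10 * K\<^sup>2) * v^6 * \<delta> * wm" by (simp add: algebra_simps power2_eq_square flip: power_add)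
  also have "\<dots> \<le> (50 * K\<^sup>2) * v^6 * \<delta> * wm"
    using K v \<delta> assms by (intro mult_right_mono) (auto simp: power2_eq_square)
  also have "\<dots> = (100 * K\<^sup>2 * v\<^sup>2) / 2 * (v^4 * \<delta>) * wm" by (simp flip: power_add)
  also have "\<dots> \<le> c / 2 * (v^4 * \<delta>) * wm"
    using small(2) v \<delta> assms by (intro mult_right_mono) auto
  finally show ?thesis .
qed

text \<open>The neighbouring values of \<delta> average out to the central one, so at least half of
  the correction c v^4 \<delta> contained in \<open>E\<close> survives. This is the margin of the
  x-equation.\<close>

lemma center_gain:
  assumes "wp > 0" "wm > 0" "\<bar>wp - wm\<bar> \<le> 10 * K * v^3 * wm"
  shows "wp * (E - Dp) + wm * (E - Dm) \<ge> c / 2 * (v^4 * \<delta>) * (wp + wm)"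
proof -
  have "wp * (E - Dp) + wm * (E - Dm) = c * (v^4 * \<delta>) * (wp + wm) - (wp * (\<delta>p - \<delta>) + wm * (\<delta>m - \<delta>))"
    by (simp add: algebra_simps)
  moreover have "c / 2 * (v^4 * \<delta>) * wm \<le> c / 2 * (v^4 * \<delta>) * (wp + wm)"
    using assms c_pos v \<delta> by (intro mult_left_mono) auto
  moreover have "c * (v^4 * \<delta>) * (wp + wm) = 2 * (c / 2 * (v^4 * \<delta>) * (wp + wm))" by simp
  ultimately show ?thesis using second_difference[OF assms(2,3)] by linarith
qed

text \<open>In the s-equation \<open>E\<close> sits at the neighbours and \<open>D\<close> at the
  centre, so the same correction works against the barrier; its cost is bounded here.\<close>

lemma center_loss:
  assumes "wp > 0" "wm > 0" "\<bar>wp - wm\<bar> \<le> 10 * K * v^3 * wm"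
  shows "wp * (Ep - D) + wm * (Em - D) \<le> 2 * c * (v^4 * \<delta>) * (wp + wm)"
proof -
  have "wp * (Ep - D) + wm * (Em - D) = (wp * (\<delta>p - \<delta>) + wm * (\<delta>m - \<delta>)) + c * (wp * \<eta>p + wm * \<eta>m)"
    by (simp add: algebra_simps)
  moreover have "c * (wp * \<eta>p + wm * \<eta>m) \<le> c * (wp * (3/2 * (v^4 * \<delta>)) + wm * (3/2 * (v^4 * \<delta>)))"
    using assms \<eta>_bounds c_pos by (intro mult_left_mono add_mono) auto
  moreover have "c * (wp * (3/2 * (v^4 * \<delta>)) + wm * (3/2 * (v^4 * \<delta>))) = 3/2 * (c * (v^4 * \<delta>) * (wp + wm))"
    by (simp add: algebra_simps)
  moreover have "c / 2 * (v^4 * \<delta>) * wm \<le> c / 2 * (v^4 * \<delta>) * (wp + wm)"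
    using assms c_pos v \<delta> by (intro mult_left_mono) auto
  moreover have "c / 2 * (v^4 * \<delta>) * (wp + wm) = 1/2 * (c * (v^4 * \<delta>) * (wp + wm))"
    "2 * c * (v^4 * \<delta>) * (wp + wm) = 2 * (c * (v^4 * \<delta>) * (wp + wm))" by simp_all
  ultimately show ?thesis using second_difference[OF assms(2,3)] by linarith
qed

lemma variation_10: "\<bar>wp - wm\<bar> \<le> K * v^3 * wm \<Longrightarrow> wm > 0 \<Longrightarrow> \<bar>wp - wm\<bar> \<le> 10 * K * v^3 * wm"
  using mult_right_mono[of "K * v^3" "10 * K * v^3" wm] K v by simp

text \<open>The constant is 10 = 2 (1 + 4): K from the numerator, 4 K from a denominator
  \<open>Dp\<close>, \<open>Dm\<close> or \<open>Ep\<close>, \<open>Em\<close>, and a factor 2 from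
  \<open>quotient_variation\<close>.\<close>

lemma variation_quotient:
  assumes "wm > 0" "dp > 0" "dm > 0" "\<bar>wp - wm\<bar> \<le> K * v^3 * wm" "\<bar>dp - dm\<bar> \<le> 4 * K * v^3 * dm"
  shows "\<bar>wp / dp - wm / dm\<bar> \<le> 10 * K * v^3 * (wm / dm)"
  using quotient_variation[of wm dp dm "v^3" K wp "4 * K"] assms K v small(1) by simp

text \<open>The right sides are the gain of the x-equation computed in \<open>sum_gain\<close> and
  half the gain of the s-equation. The lower bounds on B are exactly what keeps the residuals below
  them.\<close>

lemma B_bounds:
  shows "K * v^6 * (1 + 2 * \<delta>) < c * \<delta> / (128 * t * v)"
    and "K * v^9 * (1 + 2 * \<delta>) < t\<^sup>2 / 8 * v\<^sup>2 * \<delta>"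
proof -
  have p: "v^7 * (1 + 2 * \<delta>) > 0" using v \<delta> by simp
  have power7: "v^7 = v * v^6" and power9: "v^9 = v\<^sup>2 * v^7" by (simp_all flip: power_Suc power_add)
  have "128 * t * K / c * (v^7 * (1 + 2 * \<delta>)) \<le> B * (v^7 * (1 + 2 * \<delta>))"
    using B(2) p by (intro mult_right_mono) auto
  also have "\<dots> < \<delta>" using B(1) by (simp add: mult.assoc)
  finally have "128 * t * K / c * (v^7 * (1 + 2 * \<delta>)) * (c / (128 * t * v)) < \<delta> * (c / (128 * t * v))"
    using c_pos t v by (intro mult_strict_right_mono) auto
  moreover have "128 * t * K / c * (v^7 * (1 + 2 * \<delta>)) * (c / (128 * t * v)) = K * v^6 * (1 + 2 * \<delta>)"
    using c_pos t v by (simp add: field_simps power7)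
  ultimately show "K * v^6 * (1 + 2 * \<delta>) < c * \<delta> / (128 * t * v)" by (simp add: mult.commute)
  have "8 * K / t\<^sup>2 * (v^7 * (1 + 2 * \<delta>)) \<le> B * (v^7 * (1 + 2 * \<delta>))"
    using B(3) p by (intro mult_right_mono) auto
  also have "\<dots> < \<delta>" using B(1) by (simp add: mult.assoc)
  finally have "8 * K / t\<^sup>2 * (v^7 * (1 + 2 * \<delta>)) * (t\<^sup>2 / 8 * v\<^sup>2) < \<delta> * (t\<^sup>2 / 8 * v\<^sup>2)"
    using t v by (intro mult_strict_right_mono) auto
  moreover have "8 * K / t\<^sup>2 * (v^7 * (1 + 2 * \<delta>)) * (t\<^sup>2 / 8 * v\<^sup>2) = K * v^9 * (1 + 2 * \<delta>)"
  proof -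
    have "8 * K / t\<^sup>2 * (w * y) * (t\<^sup>2 / 8 * q) = K * (q * w) * y" for w y q
      using t by (simp add: field_simps)
    thus ?thesis unfolding power9 .
  qed
  ultimately show "K * v^9 * (1 + 2 * \<delta>) < t\<^sup>2 / 8 * v\<^sup>2 * \<delta>" by (simp add: mult.commute)
qed

lemma sum_gain:
  assumes "W \<ge> 1 / (32 * v^4)" "wp \<ge> 1 / (4 * t * v) / a" "wm \<ge> 1 / (4 * t * v) / a" "a > 0"
    "w \<ge> c / 2 * (v^4 * \<delta>) * (wp + wm)"
  shows "w * W \<ge> c * \<delta> / (128 * t * v) / a"
proof -
  have "c * \<delta> / (128 * t * v) / a = (c / 2 * (v^4 * \<delta>) * (1 / (4 * t * v) / a + 1 / (4 * t * v) / a)) * (1 / (32 * v^4))"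
    using t v assms(4) by (simp add: field_simps)
  also have "\<dots> \<le> (c / 2 * (v^4 * \<delta>) * (wp + wm)) * (1 / (32 * v^4))"
    using assms c_pos v \<delta> by (intro mult_right_mono mult_left_mono add_mono) auto
  also have "\<dots> \<le> w * (1 / (32 * v^4))"
    using assms(5) v by (intro mult_right_mono) auto
  also have "\<dots> \<le> w * W"
  proof -
    have "1 / (4 * t * v) / a > 0" using t v assms(4) by simp
    hence "wp > 0" "wm > 0" using assms(2,3) by linarith+
    hence "c / 2 * (v^4 * \<delta>) * (wp + wm) \<ge> 0" using c_pos v \<delta> by simp
    thus ?thesis using assms by (intro mult_left_mono) auto
  qed
  finally show ?thesis .
qed

lemma super_x:
  assumes X: "Xp \<ge> 1 / (4 * t * v)" "Xm \<ge> 1 / (4 * t * v)" "\<bar>Xp - Xm\<bar> \<le> K * v^3 * Xm"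
    and W: "W \<ge> 1 / (32 * v^4)" and G: "\<bar>(Xp + Xm) * W - G\<bar> \<le> K * v^6"
  shows "(Xp * Dp + Xm * Dm) * W < E * G"
proof -
  have "1 / (4 * t * v) > 0" using t v by simp
  hence pos: "Xp > 0" "Xm > 0" using X by linarith+
  have E: "E \<ge> 0" using \<delta> c_pos v by simp
  have "(Xp * (E - Dp) + Xm * (E - Dm)) * W \<ge> c * \<delta> / (128 * t * v) / 1"
    using X W by (intro sum_gain[OF _ _ _ _ center_gain] variation_10) (auto simp: pos)
  moreover have "E * ((Xp + Xm) * W - G) \<le> E * (K * v^6)"
    using E G by (intro mult_left_mono) auto
  moreover have "E * (K * v^6) \<le> (1 + 2 * \<delta>) * (K * v^6)"
    using E_le K v by (intro mult_right_mono) auto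
  ultimately show ?thesis using B_bounds(1) by (simp add: algebra_simps)
qed

text \<open>Dividing by \<open>Dp\<close> and \<open>Dm\<close> weakens the gain by up to 1 + 2
  \<delta>; this is where the factor 1 + 2 \<delta> in \<open>B_bounds\<close> is fully
  needed.\<close>

lemma sub_x:
  assumes X: "Xp \<ge> 1 / (4 * t * v)" "Xm \<ge> 1 / (4 * t * v)" "\<bar>Xp - Xm\<bar> \<le> K * v^3 * Xm"
    and W: "W \<ge> 1 / (32 * v^4)" and G: "\<bar>(Xp + Xm) * W - G\<bar> \<le> K * v^6"
  shows "G < E * ((Xp / Dp + Xm / Dm) * W)"
proof -
  have "1 / (4 * t * v) > 0" using t v by simp
  hence pos: "Xp > 0" "Xm > 0" using X by linarith+
  have Dpos: "Dp > 0" "Dm > 0" "Dp \<le> 1 + 2 * \<delta>" "Dm \<le> 1 + 2 * \<delta>" using \<delta>_bounds \<delta> by auto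
  have lb: "y / d \<ge> 1 / (4 * t * v) / (1 + 2 * \<delta>)" if "y \<ge> 1 / (4 * t * v)" "d > 0" "d \<le> 1 + 2 * \<delta>" for y d
    using that t v by (intro frac_le) (auto intro: order_trans[rotated])
  have "(Xp / Dp * (E - Dp) + Xm / Dm * (E - Dm)) * W \<ge> c * \<delta> / (128 * t * v) / (1 + 2 * \<delta>)"
    using X W pos Dpos \<delta>
    by (intro sum_gain[OF _ _ _ _ center_gain] lb variation_quotient D_variation) auto
  moreover have "c * \<delta> / (128 * t * v) / (1 + 2 * \<delta>) > K * v^6"
    using B_bounds(1) \<delta> by (simp only: pos_less_divide_eq)
  moreover have "(xp * (E - Dp) + xm * (E - Dm)) * W = E * ((xp + xm) * W) - (xp * Dp + xm * Dm) * W" for xp xm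
    by (simp add: algebra_simps)
  from this[of "Xp / Dp" "Xm / Dm"]
  have "(Xp / Dp * (E - Dp) + Xm / Dm * (E - Dm)) * W = E * ((Xp / Dp + Xm / Dm) * W) - (Xp + Xm) * W"
    using Dpos by simp
  ultimately show ?thesis using G by linarith
qed

text \<open>Scaling x by \<open>D\<close> affects z / x and 1 / x^2 by different powers. The
  mismatch (\<delta> / D) / X^2 is at least t^2 / 4 v^2 \<delta> / D; one half pays for the loss
  through \<open>E\<close>, the other for the residual.\<close>

lemma super_s:
  assumes S: "Sp > 0" "Sm > 0" "Sp \<le> 4 / v\<^sup>2" "Sm \<le> 4 / v\<^sup>2" "\<bar>Sp - Sm\<bar> \<le> K * v^3 * Sm"
    and X: "X > 0" "X \<le> 2 / (t * v)" and R: "\<bar>Sp + Sm - (z / X + 1 / X\<^sup>2)\<bar> \<le> K * v^9"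
  shows "z / (X * D) + 1 / (X * D)\<^sup>2 < Sm / Em + Sp / Ep"
proof -
  have D: "D > 0" using \<delta> by simp
  have "c * \<eta>p \<ge> 0" "c * \<eta>m \<ge> 0" using \<eta>_bounds c_pos by auto
  hence Epos: "Ep \<ge> D / (5/4)" "Em \<ge> D / (5/4)" and Epos': "Ep > 0" "Em > 0"
    using \<delta>_bounds \<delta> by auto
  have w: "y / e \<le> 5 / v\<^sup>2 / D" if "y > 0" "y \<le> 4 / v\<^sup>2" "e \<ge> D / (5/4)" for y e
  proof -
    have "y / e \<le> (4 / v\<^sup>2) / (D / (5/4))"
      using that D by (intro frac_le) auto
    also have "(4 / v\<^sup>2) / (d / (5/4)) = 5 / v\<^sup>2 / d" for d by simp
    finally show ?thesis .
  qed
  have "Sp / Ep * (Ep - D) + Sm / Em * (Em - D) \<le> 2 * c * (v^4 * \<delta>) * (Sp / Ep + Sm / Em)"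
    using S Epos' by (intro center_loss variation_quotient E_variation) auto
  also have "\<dots> \<le> 2 * c * (v^4 * \<delta>) * (5 / v\<^sup>2 / D + 5 / v\<^sup>2 / D)"
    using S Epos c_pos \<eta>_bounds(5) by (intro mult_left_mono add_mono w) auto
  also have "\<dots> = 20 * c * v\<^sup>2 * \<delta> / D"
    using v by (simp add: eval_nat_numeral)
  also have "\<dots> \<le> t\<^sup>2 / 8 * v\<^sup>2 * \<delta> / D"
    using \<delta> c_le by (intro divide_right_mono mult_right_mono) auto
  finally have *: "Sp / Ep * (Ep - D) + Sm / Em * (Em - D) \<le> t\<^sup>2 / 8 * v\<^sup>2 * \<delta> / D" .
  have loss: "Sp + Sm - D * (Sp / Ep + Sm / Em) \<le> t\<^sup>2 / 8 * v\<^sup>2 * \<delta> / D"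
  proof -
    have "wp * (Ep - D) + wm * (Em - D) = wp * Ep + wm * Em - D * (wp + wm)" for wp wm
      by (simp add: algebra_simps)
    from this[of "Sp / Ep" "Sm / Em"] show ?thesis using * Epos' by simp
  qed
  have "K * v^9 * D \<le> K * v^9 * (1 + 2 * \<delta>)" using K v \<delta> by (intro mult_left_mono) auto
  hence "K * v^9 * D < t\<^sup>2 / 8 * v\<^sup>2 * \<delta>" using B_bounds(2) by linarith
  hence res: "K * v^9 < t\<^sup>2 / 8 * v\<^sup>2 * \<delta> / D" using D by (simp only: pos_less_divide_eq)
  have "X\<^sup>2 \<le> (2 / (t * v))\<^sup>2" using X by (intro power_mono) auto
  hence "1 / (2 / (t * v))\<^sup>2 \<le> 1 / X\<^sup>2" using X by (intro divide_left_mono) (auto intro!: mult_pos_pos)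
  hence "t\<^sup>2 / 4 * v\<^sup>2 \<le> 1 / X\<^sup>2" by (simp add: power_divide power_mult_distrib)
  hence "t\<^sup>2 / 4 * v\<^sup>2 * (\<delta> / D) \<le> 1 / X\<^sup>2 * (\<delta> / D)"
    using \<delta> by (intro mult_right_mono) auto
  moreover have "t\<^sup>2 / 8 * v\<^sup>2 * \<delta> / D = t\<^sup>2 / 8 * v\<^sup>2 * (\<delta> / D)"
    by simp
  ultimately have "z / X + 1 / X\<^sup>2 - 1 / X\<^sup>2 * (\<delta> / D) < D * (Sp / Ep + Sm / Em)"
    using loss res R by linarith
  moreover have "z / X + 1 / X\<^sup>2 - 1 / X\<^sup>2 * (\<delta> / D) = D * (z / (X * D) + 1 / (X * D)\<^sup>2)"
  proof -
    have "z / X + 1 / X\<^sup>2 - 1 / X\<^sup>2 * ((d - 1) / d) = d * (z / (X * d) + 1 / (X * d)\<^sup>2)" if "d > 0" for d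
      using that X by (simp add: field_simps power2_eq_square)
    from this[OF D] show ?thesis by simp
  qed
  ultimately show ?thesis using D by (simp add: add.commute)
qed

text \<open>As in \<open>super_s\<close>, but with x divided by \<open>D\<close> the mismatch
  between the two powers is \<delta> D / X^2.\<close>

lemma sub_s:
  assumes S: "Sp > 0" "Sm > 0" "Sp \<le> 4 / v\<^sup>2" "Sm \<le> 4 / v\<^sup>2" "\<bar>Sp - Sm\<bar> \<le> K * v^3 * Sm"
    and X: "X > 0" "X \<le> 2 / (t * v)" and R: "\<bar>Sp + Sm - (z / X + 1 / X\<^sup>2)\<bar> \<le> K * v^9"
  shows "Sm * Em + Sp * Ep < z / (X / D) + 1 / (X / D)\<^sup>2"
proof -
  have D: "D > 0" "D \<ge> 1" using \<delta> by auto
  have "Sp * (Ep - D) + Sm * (Em - D) \<le> 2 * c * (v^4 * \<delta>) * (Sp + Sm)"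
    using S by (intro center_loss variation_10) auto
  also have "\<dots> \<le> 2 * c * (v^4 * \<delta>) * (4 / v\<^sup>2 + 4 / v\<^sup>2)"
    using S c_pos \<eta>_bounds(5) by (intro mult_left_mono add_mono) auto
  also have "\<dots> = 16 * c * v\<^sup>2 * \<delta>"
    using v by (simp add: eval_nat_numeral)
  also have "\<dots> \<le> t\<^sup>2 / 8 * v\<^sup>2 * \<delta>"
    using \<delta> c_le by (intro mult_right_mono) auto
  also have "\<dots> \<le> t\<^sup>2 / 8 * v\<^sup>2 * \<delta> * D"
    using mult_left_mono[OF D(2), of "t\<^sup>2 / 8 * v\<^sup>2 * \<delta>"] \<delta> by simp
  finally have "Sp * (Ep - D) + Sm * (Em - D) \<le> t\<^sup>2 / 8 * v\<^sup>2 * \<delta> * D" .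
  moreover have "Sp * Ep + Sm * Em = D * (Sp + Sm) + (Sp * (Ep - D) + Sm * (Em - D))" by (simp add: algebra_simps)
  ultimately have loss: "Sp * Ep + Sm * Em \<le> D * (Sp + Sm) + t\<^sup>2 / 8 * v\<^sup>2 * \<delta> * D" by linarith
  have "K * v^9 \<le> K * v^9 * (1 + 2 * \<delta>)" 
    using mult_left_mono[of 1 "1 + 2 * \<delta>" "K * v^9"] K v \<delta> by simp
  hence "K * v^9 < t\<^sup>2 / 8 * v\<^sup>2 * \<delta>" using B_bounds(2) by linarith
  hence "K * v^9 * D < t\<^sup>2 / 8 * v\<^sup>2 * \<delta> * D" using D by (intro mult_strict_right_mono) auto
  moreover have "(Sp + Sm - (z / X + 1 / X\<^sup>2)) * D \<le> K * v^9 * D"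
    using R D by (intro mult_right_mono) auto
  moreover have "t\<^sup>2 / 4 * v\<^sup>2 * (\<delta> * D) \<le> 1 / X\<^sup>2 * (\<delta> * D)"
  proof -
    have "X\<^sup>2 \<le> (2 / (t * v))\<^sup>2" using X by (intro power_mono) auto
    hence "1 / (2 / (t * v))\<^sup>2 \<le> 1 / X\<^sup>2" using X by (intro divide_left_mono) (auto intro!: mult_pos_pos)
    hence "t\<^sup>2 / 4 * v\<^sup>2 \<le> 1 / X\<^sup>2" by (simp add: power_divide power_mult_distrib)
    thus ?thesis using \<delta> D by (intro mult_right_mono) auto
  qed
  moreover have "z / (X / D) + 1 / (X / D)\<^sup>2 = D * (z / X + 1 / X\<^sup>2) + 1 / X\<^sup>2 * (\<delta> * D)"
  proof -
    have "z / (X / d) + 1 / (X / d)\<^sup>2 = d * (z / X + 1 / X\<^sup>2) + 1 / X\<^sup>2 * ((d - 1) * d)" if "d > 0" for d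
      using that X by (simp add: field_simps power2_eq_square)
    from this[OF D(1)] show ?thesis by simp
  qed
  moreover have "(Sp + Sm - (z / X + 1 / X\<^sup>2)) * D = D * (Sp + Sm) - D * (z / X + 1 / X\<^sup>2)"
  proof -
    have "(u - a) * d = d * u - d * a" for u a d :: real by (simp add: algebra_simps)
    thus ?thesis .
  qed
  moreover have "t\<^sup>2 / 4 * v\<^sup>2 * (\<delta> * D) = 2 * (t\<^sup>2 / 8 * v\<^sup>2 * \<delta> * D)" by simp
  ultimately have "Sp * Ep + Sm * Em < z / (X / D) + 1 / (X / D)\<^sup>2" using loss by linarith
  thus ?thesis by (simp add: add.commute)
qed

end

section \<open>The scale v under shifts of its argument\<close>

text \<open>Normalised so that t v^3 = 1 / (2 z): moving z by 1/2 multiplies it by 1 + t v^3, and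
  every difference therefore costs a relative factor v^3.\<close>

definition vscale :: "real \<Rightarrow> real \<Rightarrow> real" where
  "vscale t z = (2 * t * z) powr (-1/3)"

definition x_approx :: "real \<Rightarrow> real \<Rightarrow> real \<Rightarrow> real" where
  "x_approx t \<alpha> z = poly (x_poly t \<alpha>) (vscale t z / 9) / (t * vscale t z)"

definition s_approx :: "real \<Rightarrow> real \<Rightarrow> real \<Rightarrow> real" where
  "s_approx t \<alpha> z = poly (s_poly t \<alpha>) (vscale t z / 9) / (2 * (vscale t z)\<^sup>2)"

locale scaling =
  fixes t :: real assumes t: "t > 0"
begin

abbreviation "v \<equiv> vscale t"

lemma vscale_pos: "z > 0 \<Longrightarrow> v z > 0"
  using t by (simp add: vscale_def)

lemma vscale_powr: "z > 0 \<Longrightarrow> v z powr r = (2 * t * z) powr (- r / 3)"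
  using t by (simp add: vscale_def powr_powr)

lemma vscale_cube: "z > 0 \<Longrightarrow> t * v z ^ 3 = 1 / (2 * z)"
  using t vscale_powr[of z 3] vscale_pos[of z] by (simp add: powr_numeral powr_minus_divide)

lemma vscale_tendsto_0: "(v \<longlongrightarrow> 0) at_top"
  unfolding vscale_def using t by real_asymp

lemma vscale_shift:
  assumes "z \<ge> 1" "\<bar>h\<bar> = 1/2"
  shows "v (z + h) powr r = v z powr r * (1 + 2 * h * (t * v z ^ 3)) powr (- r / 3)"
proof -
  have h: "h = 1/2 \<or> h = -1/2" using assms(2) by linarith
  hence p: "1 + h / z > 0" "z + h > 0" using assms(1) by (auto simp: field_simps)
  have "v (z + h) powr r = (2 * t * z * (1 + h / z)) powr (- r / 3)"
  proof -
    have "2 * t * z * (1 + h / z) = 2 * t * (z + h)" using assms(1) by (simp add: distrib_left)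
    thus ?thesis unfolding vscale_powr[OF p(2)] by (simp only:)
  qed
  also have "\<dots> = v z powr r * (1 + h / z) powr (- r / 3)"
    using t assms(1) p by (simp add: powr_mult vscale_powr)
  also have "h / z = 2 * h * (t * v z ^ 3)"
    using assms(1) by (simp add: vscale_cube)
  finally show ?thesis .
qed

lemma vscale_cube_le: "z \<ge> 1 \<Longrightarrow> \<bar>t * v z ^ 3\<bar> \<le> 1/2"
  by (subst vscale_cube) (auto simp: field_simps)

lemma vscale_shift_bound:
  obtains K where "K \<ge> 0" "\<And>z h. z \<ge> 1 \<Longrightarrow> \<bar>h\<bar> = 1/2 \<Longrightarrow>
    \<bar>v (z + h) powr r - v z powr r\<bar> \<le> K * (v z ^ 3 * v z powr r)"
proof -
  obtain K where K: "K \<ge> 0" "\<And>u. \<bar>u\<bar> \<le> 1/2 \<Longrightarrow>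
    \<bar>(1 + u) powr (- r / 3) - (\<Sum>m<1. (- r / 3 gchoose m) * u ^ m)\<bar> \<le> K * \<bar>u\<bar> ^ 1"
    using powr_taylor_bound[of "- r / 3" 1] by metis
  show ?thesis
  proof (rule that[of "K * t"])
    fix z h :: real assume z: "z \<ge> 1" and h: "\<bar>h\<bar> = 1/2"
    define u where "u = 2 * h * (t * v z ^ 3)"
    have u1: "\<bar>u\<bar> = t * v z ^ 3"
      using h t vscale_pos[of z] z by (simp add: u_def abs_mult)
    hence u2: "\<bar>u\<bar> \<le> 1/2" using vscale_cube_le[OF z] by simp
    have "v (z + h) powr r - v z powr r = v z powr r * ((1 + u) powr (- r / 3) - 1)"
      unfolding vscale_shift[OF z h] u_def by (simp add: algebra_simps)
    also have "\<bar>\<dots>\<bar> = v z powr r * \<bar>(1 + u) powr (- r / 3) - 1\<bar>"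
      by (simp add: abs_mult)
    also have "\<dots> \<le> v z powr r * (K * \<bar>u\<bar>)"
      using K(2)[OF u2] by (intro mult_left_mono) auto
    also have "\<dots> = K * t * (v z ^ 3 * v z powr r)" by (simp add: u1)
    finally show "\<bar>v (z + h) powr r - v z powr r\<bar> \<le> K * t * (v z ^ 3 * v z powr r)" .
  qed (use K t in simp)
qed

lemma vscale_central_bound:
  obtains K where "K \<ge> 0" "\<And>z. z \<ge> 1 \<Longrightarrow>
    \<bar>v (z + 1/2) powr r + v (z - 1/2) powr r - v z powr r * (2 + t\<^sup>2 * v z ^ 6 * (r * (r + 3) / 9))\<bar>
      \<le> K * (v z ^ 12 * v z powr r)"
proof -
  obtain K where K: "K \<ge> 0" "\<And>u. \<bar>u\<bar> \<le> 1/2 \<Longrightarrow>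
    \<bar>(1 + u) powr (- r / 3) + (1 - u) powr (- r / 3) - (2 + (- r / 3) * (- r / 3 - 1) * u\<^sup>2)\<bar> \<le> K * u ^ 4"
    using powr_central_difference_bound by blast
  show ?thesis
  proof (rule that[of "K * t ^ 4"])
    fix z :: real assume z: "z \<ge> 1"
    define u where "u = t * v z ^ 3"
    have u: "\<bar>u\<bar> \<le> 1/2" using vscale_cube_le[OF z] by (simp add: u_def)
    have "v (z + 1/2) powr r = v z powr r * (1 + u) powr (- r / 3)"
      "v (z - 1/2) powr r = v z powr r * (1 - u) powr (- r / 3)"
      using vscale_shift[OF z, of "1/2" r] vscale_shift[OF z, of "-1/2" r] by (simp_all add: u_def)
    moreover have "t\<^sup>2 * v z ^ 6 * (r * (r + 3) / 9) = (- r / 3) * (- r / 3 - 1) * u\<^sup>2"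
      by (simp add: u_def power_mult_distrib field_simps flip: power_mult)
    ultimately have "v (z + 1/2) powr r + v (z - 1/2) powr r - v z powr r * (2 + t\<^sup>2 * v z ^ 6 * (r * (r + 3) / 9))
       = v z powr r * ((1 + u) powr (- r / 3) + (1 - u) powr (- r / 3) - (2 + (- r / 3) * (- r / 3 - 1) * u\<^sup>2))"
      by (simp only:) (simp add: algebra_simps)
    also have "\<bar>\<dots>\<bar> = v z powr r * \<bar>(1 + u) powr (- r / 3) + (1 - u) powr (- r / 3) - (2 + (- r / 3) * (- r / 3 - 1) * u\<^sup>2)\<bar>"
      by (simp add: abs_mult)
    also have "\<dots> \<le> v z powr r * (K * u ^ 4)"
      using K(2)[OF u] by (intro mult_left_mono) auto
    also have "\<dots> = K * t ^ 4 * (v z ^ 12 * v z powr r)"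
      by (simp add: u_def power_mult_distrib flip: power_mult)
    finally show "\<bar>v (z + 1/2) powr r + v (z - 1/2) powr r - v z powr r * (2 + t\<^sup>2 * v z ^ 6 * (r * (r + 3) / 9))\<bar>
      \<le> K * t ^ 4 * (v z ^ 12 * v z powr r)" .
  qed (use K t in simp)
qed

lemma vscale_second_difference_bound:
  obtains K where "K \<ge> 0" "\<And>z. z \<ge> 1 \<Longrightarrow>
    \<bar>v (z + 1/2) powr r + v (z - 1/2) powr r - 2 * v z powr r\<bar> \<le> K * (v z ^ 6 * v z powr r)"
proof -
  obtain K where K: "K \<ge> 0" "\<And>z. z \<ge> 1 \<Longrightarrow>
    \<bar>v (z + 1/2) powr r + v (z - 1/2) powr r - v z powr r * (2 + t\<^sup>2 * v z ^ 6 * (r * (r + 3) / 9))\<bar>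
      \<le> K * (v z ^ 12 * v z powr r)"
    using vscale_central_bound by blast
  define C where "C = t\<^sup>2 * \<bar>r * (r + 3) / 9\<bar>"
  show ?thesis
  proof (rule that[of "K / t\<^sup>2 + C"])
    fix z :: real assume z: "z \<ge> 1"
    have vp: "v z ^ 6 * v z powr r \<ge> 0" using z vscale_pos[of z] by simp
    have "v z ^ 6 * t\<^sup>2 = (t * v z ^ 3)\<^sup>2" by (simp add: power_mult_distrib flip: power_mult)
    also have "\<dots> \<le> 1\<^sup>2" using vscale_cube_le[OF z] by (intro power2_le_iff_abs_le[THEN iffD2]) auto
    finally have "v z ^ 6 \<le> 1 / t\<^sup>2" using t by (simp add: field_simps)
    hence "v z ^ 6 * (v z ^ 6 * v z powr r) \<le> 1 / t\<^sup>2 * (v z ^ 6 * v z powr r)"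
      using vp by (intro mult_right_mono) auto
    hence "K * (v z ^ 6 * (v z ^ 6 * v z powr r)) \<le> K * (1 / t\<^sup>2 * (v z ^ 6 * v z powr r))"
      using K by (intro mult_left_mono) auto
    hence "K * (v z ^ 12 * v z powr r) \<le> K / t\<^sup>2 * (v z ^ 6 * v z powr r)"
      by (simp add: mult.assoc[symmetric] flip: power_add)
    moreover have "\<bar>v z powr r * (t\<^sup>2 * v z ^ 6 * (r * (r + 3) / 9))\<bar> = C * (v z ^ 6 * v z powr r)"
      using z vscale_pos[of z] by (simp add: C_def abs_mult)
    moreover have "v z powr r * (2 + t\<^sup>2 * v z ^ 6 * (r * (r + 3) / 9)) = 2 * v z powr r + v z powr r * (t\<^sup>2 * v z ^ 6 * (r * (r + 3) / 9))"
      by (simp add: algebra_simps)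
    moreover have "(K / t\<^sup>2 + C) * (v z ^ 6 * v z powr r) = K / t\<^sup>2 * (v z ^ 6 * v z powr r) + C * (v z ^ 6 * v z powr r)"
      by (simp add: algebra_simps)
    ultimately show "\<bar>v (z + 1/2) powr r + v (z - 1/2) powr r - 2 * v z powr r\<bar> \<le> (K / t\<^sup>2 + C) * (v z ^ 6 * v z powr r)"
      using K(2)[OF z] by linarith
  qed (use K t in \<open>simp add: C_def\<close>)
qed

abbreviation laurent :: "nat \<Rightarrow> real poly \<Rightarrow> real \<Rightarrow> real" where
  "laurent k p z \<equiv> poly p (v z / 9) / v z ^ k"

lemma laurent_powr:
  assumes "z > 0"
  shows "laurent k p z = (\<Sum>i\<le>degree p. coeff p i / 9 ^ i * v z powr (real i - real k))"
proof -
  have "v z powr (real i - real k) = v z ^ i / v z ^ k" for i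
    using vscale_pos[OF assms] by (simp add: powr_diff powr_realpow)
  thus ?thesis by (simp add: poly_altdef sum_divide_distrib power_divide field_simps)
qed

lemma central_sum_poly_powr:
  assumes "z > 0"
  shows "laurent k (central_sum_poly t (real k) p) z =
    (\<Sum>i\<le>degree p. coeff p i / 9 ^ i * (v z powr (real i - real k) *
        (2 + t\<^sup>2 * v z ^ 6 * ((real i - real k) * ((real i - real k) + 3) / 9))))"
proof -
  have v: "v z powr (real i - real k) = v z ^ i / v z ^ k" for i
    using vscale_pos[OF assms] by (simp add: powr_diff powr_realpow)
  have "poly (central_sum_poly t (real k) p) (v z / 9) = 2 * poly p (v z / 9)
     + t\<^sup>2 * v z ^ 6 / 9 * (\<Sum>i\<le>degree p. coeff p i * ((real i - real k) * (real i - real k + 3)) * (v z / 9) ^ i)"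
    by (simp add: central_sum_poly_def poly_monom poly_sum power_divide)
  also have "\<dots> = (\<Sum>i\<le>degree p. coeff p i * (v z / 9) ^ i *
        (2 + t\<^sup>2 * v z ^ 6 * ((real i - real k) * ((real i - real k) + 3) / 9)))"
  proof -
    have "2 * (a * b) + T / 9 * (a * c * b) = a * b * (2 + T * (c / 9))" for a b c T :: real
      by (simp add: algebra_simps)
    thus ?thesis unfolding poly_altdef sum_distrib_left sum.distrib[symmetric] by (simp only:)
  qed
  finally show ?thesis
    by (simp add: v sum_divide_distrib power_divide mult_ac)
qed

lemma vscale_eventually_pos: "eventually (\<lambda>z. v z > 0) at_top"
  using eventually_gt_at_top[of 0] by eventually_elim (rule vscale_pos)

lemma vscale_bigo_1: "(\<lambda>z. v z ^ i) \<in> O[at_top](\<lambda>_. 1)"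
proof (rule bigoI_tendsto)
  show "((\<lambda>z. v z ^ i / 1) \<longlongrightarrow> 0 ^ i) at_top"
    using vscale_tendsto_0 by (auto intro!: tendsto_intros)
qed auto

lemma poly_vscale_tendsto: "((\<lambda>z. poly p (v z / 9)) \<longlongrightarrow> poly p 0) at_top"
proof -
  have "((\<lambda>z. v z / 9) \<longlongrightarrow> 0 / 9) at_top" by (intro tendsto_intros vscale_tendsto_0) simp
  thus ?thesis using isCont_tendsto_compose[OF poly_isCont] by fastforce
qed

lemma poly_vscale_bigo_1: "(\<lambda>z. poly p (v z / 9)) \<in> O[at_top](\<lambda>_. 1)"
  by (rule bigoI_tendsto[of _ _ "poly p 0"]) (use poly_vscale_tendsto in auto)

lemma laurent_difference:
  "(\<lambda>z. laurent k p (z + 1/2) - laurent k p (z - 1/2)) \<in> O[at_top](\<lambda>z. v z ^ 3 / v z ^ k)"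
proof -
  have "(\<lambda>z. \<Sum>i\<le>degree p. coeff p i / 9 ^ i * (v (z + 1/2) powr (real i - real k) - v (z - 1/2) powr (real i - real k)))
     \<in> O[at_top](\<lambda>z. v z ^ 3 / v z ^ k)"
  proof (intro big_sum_in_bigo)
    fix i
    let ?r = "real i - real k"
    obtain K where K: "K \<ge> 0" "\<And>z h. z \<ge> 1 \<Longrightarrow> \<bar>h\<bar> = 1/2 \<Longrightarrow>
      \<bar>v (z + h) powr ?r - v z powr ?r\<bar> \<le> K * (v z ^ 3 * v z powr ?r)"
      using vscale_shift_bound by blast
    have "(\<lambda>z. v (z + 1/2) powr ?r - v (z - 1/2) powr ?r) \<in> O[at_top](\<lambda>z. v z ^ 3 * v z powr ?r)"
    proof (rule bigoI[of _ "2 * K"])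
      show "\<forall>\<^sub>F z in at_top. norm (v (z + 1/2) powr ?r - v (z - 1/2) powr ?r) \<le> 2 * K * norm (v z ^ 3 * v z powr ?r)"
        using eventually_ge_at_top[of 1]
      proof eventually_elim
        case (elim z)
        show ?case using K(2)[OF elim, of "1/2"] K(2)[OF elim, of "-1/2"] vscale_pos[of z] elim by simp
      qed
    qed
    also have "(\<lambda>z. v z ^ 3 * v z powr ?r) \<in> O[at_top](\<lambda>z. v z ^ i * (v z ^ 3 / v z ^ k))"
      using vscale_eventually_pos
      by (intro bigoI[of _ 1]) (auto elim!: eventually_mono simp: powr_diff powr_realpow mult_ac)
    also have "(\<lambda>z. v z ^ i * (v z ^ 3 / v z ^ k)) \<in> O[at_top](\<lambda>z. 1 * (v z ^ 3 / v z ^ k))"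
      by (intro landau_o.big.mult vscale_bigo_1) auto
    finally show "(\<lambda>z. coeff p i / 9 ^ i * (v (z + 1/2) powr ?r - v (z - 1/2) powr ?r)) \<in> O[at_top](\<lambda>z. v z ^ 3 / v z ^ k)"
      by (cases "coeff p i = 0") simp_all
  qed
  also have "?this \<longleftrightarrow> ?thesis"
  proof (intro landau_o.big.in_cong)
    show "\<forall>\<^sub>F z in at_top. (\<Sum>i\<le>degree p. coeff p i / 9 ^ i * (v (z + 1/2) powr (real i - real k) - v (z - 1/2) powr (real i - real k)))
       = laurent k p (z + 1/2) - laurent k p (z - 1/2)"
      using eventually_ge_at_top[of 1]
      by eventually_elim (simp add: laurent_powr right_diff_distrib sum_subtractf)
  qed
  finally show ?thesis .
qed

lemma laurent_central_sum:
  "(\<lambda>z. laurent k p (z + 1/2) + laurent k p (z - 1/2) - laurent k (central_sum_poly t (real k) p) z)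
     \<in> O[at_top](\<lambda>z. v z ^ 12 / v z ^ k)"
proof -
  let ?d = "\<lambda>i z. v (z + 1/2) powr (real i - real k) + v (z - 1/2) powr (real i - real k)
     - v z powr (real i - real k) * (2 + t\<^sup>2 * v z ^ 6 * ((real i - real k) * ((real i - real k) + 3) / 9))"
  have "(\<lambda>z. \<Sum>i\<le>degree p. coeff p i / 9 ^ i * ?d i z) \<in> O[at_top](\<lambda>z. v z ^ 12 / v z ^ k)"
  proof (intro big_sum_in_bigo)
    fix i
    let ?r = "real i - real k"
    obtain K where K: "K \<ge> 0" "\<And>z. z \<ge> 1 \<Longrightarrow> \<bar>?d i z\<bar> \<le> K * (v z ^ 12 * v z powr ?r)"
      using vscale_central_bound[of ?r] by blast
    have "?d i \<in> O[at_top](\<lambda>z. v z ^ 12 * v z powr ?r)"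
    proof (rule bigoI[of _ K])
      show "\<forall>\<^sub>F z in at_top. norm (?d i z) \<le> K * norm (v z ^ 12 * v z powr ?r)"
        using eventually_ge_at_top[of 1]
      proof eventually_elim
        case (elim z)
        show ?case using K(2)[OF elim] vscale_pos[of z] elim by simp
      qed
    qed
    also have "(\<lambda>z. v z ^ 12 * v z powr ?r) \<in> O[at_top](\<lambda>z. v z ^ i * (v z ^ 12 / v z ^ k))"
      using vscale_eventually_pos
      by (intro bigoI[of _ 1]) (auto elim!: eventually_mono simp: powr_diff powr_realpow mult_ac)
    also have "(\<lambda>z. v z ^ i * (v z ^ 12 / v z ^ k)) \<in> O[at_top](\<lambda>z. 1 * (v z ^ 12 / v z ^ k))"
      by (intro landau_o.big.mult vscale_bigo_1) auto
    finally show "(\<lambda>z. coeff p i / 9 ^ i * ?d i z) \<in> O[at_top](\<lambda>z. v z ^ 12 / v z ^ k)"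
      by (cases "coeff p i = 0") simp_all
  qed
  also have "?this \<longleftrightarrow> ?thesis"
  proof (intro landau_o.big.in_cong)
    show "\<forall>\<^sub>F z in at_top. (\<Sum>i\<le>degree p. coeff p i / 9 ^ i * ?d i z)
       = laurent k p (z + 1/2) + laurent k p (z - 1/2) - laurent k (central_sum_poly t (real k) p) z"
      using eventually_ge_at_top[of 1]
    proof eventually_elim
      case (elim z)
      have "(\<Sum>i\<le>n. f i * (A i + B i - C i)) = (\<Sum>i\<le>n. f i * A i) + (\<Sum>i\<le>n. f i * B i) - (\<Sum>i\<le>n. f i * C i)"
        for f A B C :: "nat \<Rightarrow> real" and n
        by (simp add: algebra_simps sum.distrib sum_subtractf)
      moreover have pos: "z > 0" "z + 1/2 > 0" "z - 1/2 > 0" using elim by auto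
      ultimately show ?case
        by (simp only: laurent_powr[OF pos(2), where p=p] laurent_powr[OF pos(3), where p=p]
              central_sum_poly_powr[OF pos(1)])
    qed
  qed
  finally show ?thesis .
qed

end

lemma bigo_cmult: "f \<in> O[F](g) \<Longrightarrow> (\<lambda>x. c * f x) \<in> O[F](g)" for c :: real
  by (cases "c = 0") auto

lemma poly_x_poly_0: "poly (x_poly t \<alpha>) 0 = 1"
  by (simp add: x_poly_def)

lemma poly_s_poly_0: "poly (s_poly t \<alpha>) 0 = 1"
  by (simp add: s_poly_def)

section \<open>The approximants and their residuals\<close>

locale approximants = scaling + fixes \<alpha> :: real
begin

abbreviation "X \<equiv> x_approx t \<alpha>"
abbreviation "S \<equiv> s_approx t \<alpha>"

lemma x_approx_laurent: "X z = laurent 1 (x_poly t \<alpha>) z / t"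
  by (simp add: x_approx_def)

lemma s_approx_laurent: "S z = laurent 2 (s_poly t \<alpha>) z / 2"
  by (simp add: s_approx_def)

lemma x_approx_tendsto: "((\<lambda>z. X z * (t * v z)) \<longlongrightarrow> 1) at_top"
proof (rule Lim_transform_eventually)
  show "((\<lambda>z. poly (x_poly t \<alpha>) (v z / 9)) \<longlongrightarrow> 1) at_top"
    using poly_vscale_tendsto[of "x_poly t \<alpha>"] by (simp only: poly_x_poly_0)
  show "\<forall>\<^sub>F z in at_top. poly (x_poly t \<alpha>) (v z / 9) = X z * (t * v z)"
    using vscale_eventually_pos by eventually_elim (use t in \<open>simp add: x_approx_def\<close>)
qed

lemma s_approx_tendsto: "((\<lambda>z. S z * (2 * v z ^ 2)) \<longlongrightarrow> 1) at_top"
proof (rule Lim_transform_eventually)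
  show "((\<lambda>z. poly (s_poly t \<alpha>) (v z / 9)) \<longlongrightarrow> 1) at_top"
    using poly_vscale_tendsto[of "s_poly t \<alpha>"] by (simp only: poly_s_poly_0)
  show "\<forall>\<^sub>F z in at_top. poly (s_poly t \<alpha>) (v z / 9) = S z * (2 * v z ^ 2)"
    using vscale_eventually_pos by eventually_elim (simp add: s_approx_def)
qed

lemma x_approx_bounds:
  "\<forall>\<^sub>F z in at_top. 1 / (2 * t * v z) \<le> X z \<and> X z \<le> 2 / (t * v z)"
proof -
  have "\<forall>\<^sub>F z in at_top. 1/2 < X z * (t * v z)" "\<forall>\<^sub>F z in at_top. X z * (t * v z) < 2"
    using order_tendstoD(1)[OF x_approx_tendsto, of "1/2"] order_tendstoD(2)[OF x_approx_tendsto, of 2] by auto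
  with vscale_eventually_pos show ?thesis
    by eventually_elim (use t in \<open>simp add: field_simps\<close>)
qed

lemma s_approx_bounds:
  "\<forall>\<^sub>F z in at_top. 1 / (4 * v z ^ 2) \<le> S z \<and> S z \<le> 1 / v z ^ 2"
proof -
  have "\<forall>\<^sub>F z in at_top. 1/2 < S z * (2 * v z ^ 2)" "\<forall>\<^sub>F z in at_top. S z * (2 * v z ^ 2) < 2"
    using order_tendstoD(1)[OF s_approx_tendsto, of "1/2"] order_tendstoD(2)[OF s_approx_tendsto, of 2] by auto
  with vscale_eventually_pos show ?thesis
    by eventually_elim (simp add: field_simps)
qed

lemma x_approx_variation: "(\<lambda>z. X (z + 1/2) - X (z - 1/2)) \<in> O[at_top](\<lambda>z. v z ^ 2)"
proof -
  have "(\<lambda>z. laurent 1 (x_poly t \<alpha>) (z + 1/2) - laurent 1 (x_poly t \<alpha>) (z - 1/2)) \<in> O[at_top](\<lambda>z. v z ^ 3 / v z ^ 1)"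
    by (rule laurent_difference)
  also have "(\<lambda>z. v z ^ 3 / v z ^ 1) \<in> \<Theta>[at_top](\<lambda>z. v z ^ 2)"
    using vscale_eventually_pos
    by (intro bigthetaI_cong) (auto elim!: eventually_mono simp: eval_nat_numeral)
  finally have "(\<lambda>z. 1 / t * (laurent 1 (x_poly t \<alpha>) (z + 1/2) - laurent 1 (x_poly t \<alpha>) (z - 1/2))) \<in> O[at_top](\<lambda>z. v z ^ 2)"
    by (rule bigo_cmult)
  thus ?thesis by (simp only: x_approx_laurent right_diff_distrib times_divide_eq_left mult_1_left)
qed

lemma s_approx_variation: "(\<lambda>z. S (z + 1/2) - S (z - 1/2)) \<in> O[at_top](\<lambda>z. v z)"
proof -
  have "(\<lambda>z. laurent 2 (s_poly t \<alpha>) (z + 1/2) - laurent 2 (s_poly t \<alpha>) (z - 1/2)) \<in> O[at_top](\<lambda>z. v z ^ 3 / v z ^ 2)"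
    by (rule laurent_difference)
  also have "(\<lambda>z. v z ^ 3 / v z ^ 2) \<in> \<Theta>[at_top](\<lambda>z. v z)"
    using vscale_eventually_pos
    by (intro bigthetaI_cong) (auto elim!: eventually_mono simp: eval_nat_numeral)
  finally have "(\<lambda>z. 1 / 2 * (laurent 2 (s_poly t \<alpha>) (z + 1/2) - laurent 2 (s_poly t \<alpha>) (z - 1/2))) \<in> O[at_top](\<lambda>z. v z)"
    by (rule bigo_cmult)
  thus ?thesis by (simp only: s_approx_laurent right_diff_distrib times_divide_eq_left mult_1_left)
qed

text \<open>Truncating the neighbour sum costs v^11, which times s^2 of size v^-4 gives v^7. The
  polynomial residual starts at v^11 and is divided by v^5, so it decides the order v^6.\<close>

lemma x_residual:
  "(\<lambda>z. (X (z + 1/2) + X (z - 1/2)) * ((S z)\<^sup>2 - (t/2)\<^sup>2) - (2 * z * S z - \<alpha> * (t/2))) \<in> O[at_top](\<lambda>z. v z ^ 6)"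
proof -
  define e where "e z = laurent 1 (x_poly t \<alpha>) (z + 1/2) + laurent 1 (x_poly t \<alpha>) (z - 1/2)
     - laurent 1 (central_sum_poly t (real 1) (x_poly t \<alpha>)) z" for z
  obtain G where G: "residual_x_poly t \<alpha> = monom 1 11 * G"
    using residual_x_poly_dvd by blast
  have "e \<in> O[at_top](\<lambda>z. v z ^ 12 / v z ^ 1)"
    unfolding e_def by (rule laurent_central_sum)
  moreover have "(\<lambda>z. ((S z)\<^sup>2 - (t/2)\<^sup>2) / t) \<in> O[at_top](\<lambda>z. 1 / v z ^ 4)"
  proof (rule bigoI_tendsto[of _ _ "1 / (4 * t)"])
    have "((\<lambda>z. ((S z * (2 * v z ^ 2))\<^sup>2 / 4 - (t/2)\<^sup>2 * v z ^ 4) / t) \<longlongrightarrow> (1\<^sup>2 / 4 - (t/2)\<^sup>2 * 0 ^ 4) / t) at_top"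
      using t by (intro tendsto_intros s_approx_tendsto vscale_tendsto_0) auto
    hence "((\<lambda>z. ((S z * (2 * v z ^ 2))\<^sup>2 / 4 - (t/2)\<^sup>2 * v z ^ 4) / t) \<longlongrightarrow> 1 / (4 * t)) at_top"
      by simp
    thus "((\<lambda>z. ((S z)\<^sup>2 - (t/2)\<^sup>2) / t / (1 / v z ^ 4)) \<longlongrightarrow> 1 / (4 * t)) at_top"
      by (rule Lim_transform_eventually)
         (use vscale_eventually_pos in \<open>auto elim!: eventually_mono simp: power_mult_distrib algebra_simps diff_divide_distrib simp flip: power_mult\<close>)
  qed (use vscale_eventually_pos in \<open>auto elim!: eventually_mono\<close>)
  ultimately have "(\<lambda>z. e z * (((S z)\<^sup>2 - (t/2)\<^sup>2) / t)) \<in> O[at_top](\<lambda>z. v z ^ 12 / v z ^ 1 * (1 / v z ^ 4))"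
    by (rule landau_o.big.mult)
  also have "(\<lambda>z. v z ^ 12 / v z ^ 1 * (1 / v z ^ 4)) \<in> O[at_top](\<lambda>z. v z ^ 6 * v z ^ 1)"
    using vscale_eventually_pos
    by (intro bigoI[of _ 1]) (auto elim!: eventually_mono simp: eval_nat_numeral)
  also have "(\<lambda>z. v z ^ 6 * v z ^ 1) \<in> O[at_top](\<lambda>z. v z ^ 6 * 1)"
    by (intro landau_o.big.mult vscale_bigo_1) auto
  finally have 1: "(\<lambda>z. e z * (((S z)\<^sup>2 - (t/2)\<^sup>2) / t)) \<in> O[at_top](\<lambda>z. v z ^ 6)" by simp
  have "(\<lambda>z. v z ^ 6 * poly G (v z / 9)) \<in> O[at_top](\<lambda>z. v z ^ 6 * 1)"
    by (intro landau_o.big.mult poly_vscale_bigo_1) auto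
  hence 2: "(\<lambda>z. 1 / (4 * t * 9 ^ 11) * (v z ^ 6 * poly G (v z / 9))) \<in> O[at_top](\<lambda>z. v z ^ 6)"
    unfolding mult_1_right by (rule bigo_cmult)
  have "(\<lambda>z. 1 / (4 * t * 9 ^ 11) * (v z ^ 6 * poly G (v z / 9)) + e z * (((S z)\<^sup>2 - (t/2)\<^sup>2) / t)) \<in> O[at_top](\<lambda>z. v z ^ 6)"
    by (intro sum_in_bigo 1 2)
  also have "?this \<longleftrightarrow> ?thesis"
  proof (intro landau_o.big.in_cong)
    show "\<forall>\<^sub>F z in at_top. 1 / (4 * t * 9 ^ 11) * (v z ^ 6 * poly G (v z / 9)) + e z * (((S z)\<^sup>2 - (t/2)\<^sup>2) / t)
       = (X (z + 1/2) + X (z - 1/2)) * ((S z)\<^sup>2 - (t/2)\<^sup>2) - (2 * z * S z - \<alpha> * (t/2))"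
      using vscale_eventually_pos eventually_gt_at_top[of 0]
    proof eventually_elim
      case (elim z)
      define w where "w = v z / 9"
      have w: "v z = 9 * w" "w > 0" using elim by (auto simp: w_def)
      define C q where "C = poly (central_sum_poly t (real 1) (x_poly t \<alpha>)) w" and "q = poly (s_poly t \<alpha>) w"
      have "2 * z = 1 / (t * v z ^ 3)" unfolding vscale_cube[OF elim(2)] by simp
      hence z: "2 * z = 1 / (729 * t * w ^ 3)" by (simp add: w power_mult_distrib)
      have Sz: "S z = q / (162 * w ^ 2)" by (simp add: s_approx_def q_def w power_mult_distrib)
      have "w ^ 11 * poly G w = poly (residual_x_poly t \<alpha>) w" by (simp add: G poly_monom)
      also have "\<dots> = C * (q * q - 6561 * t\<^sup>2 * w ^ 4) - 2 * q + 118098 * \<alpha> * t\<^sup>2 * w ^ 5"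
        by (simp add: residual_x_poly_def poly_monom C_def q_def)
      finally have R: "w ^ 11 * poly G w = C * (q * q - 6561 * t\<^sup>2 * w ^ 4) - 2 * q + 118098 * \<alpha> * t\<^sup>2 * w ^ 5" .
      have "(X (z + 1/2) + X (z - 1/2)) = (C / v z + e z) / t"
        by (simp add: x_approx_laurent e_def C_def w add_divide_distrib)
      hence "(X (z + 1/2) + X (z - 1/2)) * ((S z)\<^sup>2 - (t/2)\<^sup>2) = C / (9 * w) / t * ((S z)\<^sup>2 - (t/2)\<^sup>2) + e z * (((S z)\<^sup>2 - (t/2)\<^sup>2) / t)"
        by (simp add: w add_divide_distrib distrib_right)
      moreover have "1 / (4 * t * 9 ^ 11) * (v z ^ 6 * poly G (v z / 9)) = 1 / (4 * t * 9 ^ 5) * (w ^ 11 * poly G w) / w ^ 5"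
        using w by (simp add: w(1) power_mult_distrib field_simps eval_nat_numeral)
      moreover have "1 / (4 * t * 9 ^ 5) * (w ^ 11 * poly G w) / w ^ 5 = C / (9 * w) / t * ((S z)\<^sup>2 - (t/2)\<^sup>2) - (2 * z * S z - \<alpha> * (t/2))"
        unfolding R z Sz using w t by (simp add: field_simps eval_nat_numeral)
      ultimately show ?case by simp
    qed
  qed
  finally show ?thesis .
qed

text \<open>Here truncating the neighbour sum costs v^10, and the polynomial residual of order v^11
  is divided by v^2, whence v^9.\<close>

lemma s_residual:
  "(\<lambda>z. S (z + 1/2) + S (z - 1/2) - (2 * z / X z + 1 / (X z)\<^sup>2)) \<in> O[at_top](\<lambda>z. v z ^ 9)"
proof -
  define e where "e z = laurent 2 (s_poly t \<alpha>) (z + 1/2) + laurent 2 (s_poly t \<alpha>) (z - 1/2)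
     - laurent 2 (central_sum_poly t (real 2) (s_poly t \<alpha>)) z" for z
  define p where "p z = poly (x_poly t \<alpha>) (v z / 9)" for z
  obtain G where G: "residual_s_poly t \<alpha> = monom 1 11 * G"
    using residual_s_poly_dvd by blast
  have "e \<in> O[at_top](\<lambda>z. v z ^ 12 / v z ^ 2)"
    unfolding e_def by (rule laurent_central_sum)
  also have "(\<lambda>z. v z ^ 12 / v z ^ 2) \<in> O[at_top](\<lambda>z. v z ^ 9 * v z ^ 1)"
    using vscale_eventually_pos
    by (intro bigoI[of _ 1]) (auto elim!: eventually_mono simp: eval_nat_numeral)
  also have "(\<lambda>z. v z ^ 9 * v z ^ 1) \<in> O[at_top](\<lambda>z. v z ^ 9 * 1)"
    by (intro landau_o.big.mult vscale_bigo_1) auto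
  finally have 1: "(\<lambda>z. 1 / 2 * e z) \<in> O[at_top](\<lambda>z. v z ^ 9)" by simp
  have p: "(p \<longlongrightarrow> 1) at_top"
    unfolding p_def using poly_vscale_tendsto[of "x_poly t \<alpha>"] by (simp only: poly_x_poly_0)
  have p0: "\<forall>\<^sub>F z in at_top. p z > 0" using order_tendstoD(1)[OF p, of 0] by simp
  have "(\<lambda>z. poly G (v z / 9) / (p z)\<^sup>2) \<in> O[at_top](\<lambda>_. 1)"
  proof (rule bigoI_tendsto)
    show "((\<lambda>z. poly G (v z / 9) / (p z)\<^sup>2 / 1) \<longlongrightarrow> poly G 0 / 1\<^sup>2 / 1) at_top"
      by (intro tendsto_intros poly_vscale_tendsto p) auto
  qed auto
  hence "(\<lambda>z. v z ^ 9 * (poly G (v z / 9) / (p z)\<^sup>2)) \<in> O[at_top](\<lambda>z. v z ^ 9 * 1)"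
    by (intro landau_o.big.mult) auto
  hence 2: "(\<lambda>z. 1 / (2 * 9 ^ 11) * (v z ^ 9 * (poly G (v z / 9) / (p z)\<^sup>2))) \<in> O[at_top](\<lambda>z. v z ^ 9)"
    unfolding mult_1_right by (rule bigo_cmult)
  have "(\<lambda>z. 1 / (2 * 9 ^ 11) * (v z ^ 9 * (poly G (v z / 9) / (p z)\<^sup>2)) + 1 / 2 * e z) \<in> O[at_top](\<lambda>z. v z ^ 9)"
    by (intro sum_in_bigo 1 2)
  also have "?this \<longleftrightarrow> ?thesis"
  proof (intro landau_o.big.in_cong)
    show "\<forall>\<^sub>F z in at_top. 1 / (2 * 9 ^ 11) * (v z ^ 9 * (poly G (v z / 9) / (p z)\<^sup>2)) + 1 / 2 * e z
       = S (z + 1/2) + S (z - 1/2) - (2 * z / X z + 1 / (X z)\<^sup>2)"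
      using vscale_eventually_pos eventually_gt_at_top[of 0] p0
    proof eventually_elim
      case (elim z)
      define w where "w = v z / 9"
      have w: "v z = 9 * w" "w > 0" using elim by (auto simp: w_def)
      define C where "C = poly (central_sum_poly t (real 2) (s_poly t \<alpha>)) w"
      have "2 * z = 1 / (t * v z ^ 3)" unfolding vscale_cube[OF elim(2)] by simp
      hence z: "2 * z = 1 / (729 * t * w ^ 3)" by (simp add: w power_mult_distrib)
      have Xz: "X z = p z / (9 * t * w)" by (simp add: x_approx_def p_def w)
      have "w ^ 11 * poly G w = poly (residual_s_poly t \<alpha>) w" by (simp add: G poly_monom)
      also have "\<dots> = C * (p z * p z) - 2 * p z - 13122 * t\<^sup>2 * w ^ 4"
        by (simp add: residual_s_poly_def poly_monom C_def p_def w_def)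
      finally have R: "w ^ 11 * poly G w = C * (p z * p z) - 2 * p z - 13122 * t\<^sup>2 * w ^ 4" .
      have "S (z + 1/2) + S (z - 1/2) = C / v z ^ 2 / 2 + 1 / 2 * e z"
        by (simp add: s_approx_laurent e_def C_def w field_simps)
      moreover have "1 / (2 * 9 ^ 11) * (v z ^ 9 * (poly G (v z / 9) / (p z)\<^sup>2)) = 1 / 162 * (w ^ 11 * poly G w) / (w ^ 2 * (p z)\<^sup>2)"
        using w elim(3) by (simp add: w(1) power_mult_distrib field_simps eval_nat_numeral)
      moreover have "1 / 162 * (w ^ 11 * poly G w) / (w ^ 2 * (p z)\<^sup>2) = C / v z ^ 2 / 2 - (2 * z / X z + 1 / (X z)\<^sup>2)"
        unfolding R z Xz w(1) using w t elim(3) by (simp add: field_simps eval_nat_numeral)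
      ultimately show ?case by simp
    qed
  qed
  finally show ?thesis .
qed

end

lemma eventually_shift:
  fixes P :: "real \<Rightarrow> bool"
  assumes "eventually P at_top"
  shows "\<forall>\<^sub>F z in at_top. P (z + h)"
proof -
  have "filterlim (\<lambda>z. z + h) at_top at_top" by real_asymp
  thus ?thesis using assms by (rule eventually_compose_filterlim[rotated])
qed

section \<open>Uniform constants for large z\<close>

context approximants
begin

lemma vscale_shift_eventually:
  "\<forall>\<^sub>F z in at_top. v (z + 1/2) \<le> 2 * v z \<and> v z / 2 \<le> v (z + 1/2) \<and> v (z - 1/2) \<le> 2 * v z \<and> v z / 2 \<le> v (z - 1/2)"
proof -
  obtain K where K: "K \<ge> 0" "\<And>z h. z \<ge> 1 \<Longrightarrow> \<bar>h\<bar> = 1/2 \<Longrightarrow> \<bar>v (z + h) powr 1 - v z powr 1\<bar> \<le> K * (v z ^ 3 * v z powr 1)"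
    using vscale_shift_bound[of 1] by blast
  have "((\<lambda>z. K * v z ^ 3) \<longlongrightarrow> K * 0 ^ 3) at_top" by (intro tendsto_intros vscale_tendsto_0)
  hence "\<forall>\<^sub>F z in at_top. K * v z ^ 3 < 1/2" by (rule order_tendstoD) auto
  thus ?thesis using eventually_gt_at_top[of 1]
  proof eventually_elim
    case (elim z)
    have dv: "\<bar>v (z + h) - v z\<bar> \<le> 1/2 * v z" if h: "\<bar>h\<bar> = 1/2" for h
    proof -
      have "z > 0" "z + h > 0" using elim h by linarith+
      hence vp: "v z > 0" "v (z + h) > 0" by (intro vscale_pos; simp)+
      hence "\<bar>v (z + h) - v z\<bar> \<le> K * v z ^ 3 * v z" using K(2)[of z h] elim h by (simp add: mult_ac)
      also have "\<dots> \<le> 1/2 * v z" using elim vp by (intro mult_right_mono) auto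
      finally show ?thesis .
    qed
    have "\<bar>v (z + 1/2) - v z\<bar> \<le> 1/2 * v z" "\<bar>v (z - 1/2) - v z\<bar> \<le> 1/2 * v z"
      using dv[of "1/2"] dv[of "-1/2"] by simp_all
    moreover have "v z > 0" using elim by (intro vscale_pos) simp
    ultimately show ?case by (intro conjI; linarith)
  qed
qed

lemma eventually_bigo_bound:
  fixes f g :: "real \<Rightarrow> real"
  assumes "f \<in> O[at_top](g)"
  obtains K where "K > 0" "\<forall>\<^sub>F z in at_top. \<bar>f z\<bar> \<le> K * \<bar>g z\<bar>"
  using assms by (elim landau_o.bigE) auto

lemma x_approx_relative_variation:
  obtains K where "K > 0" "\<forall>\<^sub>F z in at_top. \<bar>X (z + 1/2) - X (z - 1/2)\<bar> \<le> K * v z ^ 3 * X (z - 1/2)"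
proof -
  obtain K where K: "K > 0" "\<forall>\<^sub>F z in at_top. \<bar>X (z + 1/2) - X (z - 1/2)\<bar> \<le> K * \<bar>v z ^ 2\<bar>"
    using eventually_bigo_bound[OF x_approx_variation] .
  have "\<forall>\<^sub>F z in at_top. \<bar>X (z + 1/2) - X (z - 1/2)\<bar> \<le> (4 * t * K) * v z ^ 3 * X (z - 1/2)"
    using K(2) eventually_shift[OF x_approx_bounds, of "-1/2"] vscale_shift_eventually eventually_gt_at_top[of 1]
  proof eventually_elim
    case (elim z)
    have vp: "v z > 0" "v (z - 1/2) > 0" using elim(4) by (intro vscale_pos; simp)+
    have "1 / (4 * t * v z) \<le> 1 / (2 * t * v (z - 1/2))"
      using vp t elim(3) by (intro divide_left_mono) auto
    also have "\<dots> \<le> X (z - 1/2)" using elim(2) by simp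
    finally have "4 * t * K * v z ^ 3 * (1 / (4 * t * v z)) \<le> 4 * t * K * v z ^ 3 * X (z - 1/2)"
      using t K vp by (intro mult_left_mono) auto
    moreover have "4 * t * K * v z ^ 3 * (1 / (4 * t * v z)) = K * \<bar>v z ^ 2\<bar>"
      using vp t by (simp add: eval_nat_numeral)
    ultimately show ?case using elim(1) by simp
  qed
  moreover have "4 * t * K > 0" using K t by simp
  ultimately show ?thesis using that by blast
qed

lemma s_approx_relative_variation:
  obtains K where "K > 0" "\<forall>\<^sub>F z in at_top. \<bar>S (z + 1/2) - S (z - 1/2)\<bar> \<le> K * v z ^ 3 * S (z - 1/2)"
proof -
  obtain K where K: "K > 0" "\<forall>\<^sub>F z in at_top. \<bar>S (z + 1/2) - S (z - 1/2)\<bar> \<le> K * \<bar>v z\<bar>"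
    using eventually_bigo_bound[OF s_approx_variation] .
  have "\<forall>\<^sub>F z in at_top. \<bar>S (z + 1/2) - S (z - 1/2)\<bar> \<le> (16 * K) * v z ^ 3 * S (z - 1/2)"
    using K(2) eventually_shift[OF s_approx_bounds, of "-1/2"] vscale_shift_eventually eventually_gt_at_top[of 1]
  proof eventually_elim
    case (elim z)
    have vp: "v z > 0" "v (z - 1/2) > 0" using elim(4) by (intro vscale_pos; simp)+
    have "v (z - 1/2) ^ 2 \<le> (2 * v z) ^ 2" using elim(3) vp by (intro power_mono) auto
    hence "1 / (16 * v z ^ 2) \<le> 1 / (4 * v (z - 1/2) ^ 2)"
      using vp by (intro divide_left_mono) (auto simp: power_mult_distrib)
    also have "\<dots> \<le> S (z - 1/2)" using elim(2) by simp
    finally have "16 * K * v z ^ 3 * (1 / (16 * v z ^ 2)) \<le> 16 * K * v z ^ 3 * S (z - 1/2)"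
      using K vp by (intro mult_left_mono) auto
    moreover have "16 * K * v z ^ 3 * (1 / (16 * v z ^ 2)) = K * \<bar>v z\<bar>"
      using vp by (simp add: eval_nat_numeral)
    ultimately show ?case using elim(1) by simp
  qed
  moreover have "16 * K > 0" using K by simp
  ultimately show ?thesis using that by blast
qed

text \<open>The exponents 7 and -6 are those of the two terms of \<delta>, and 11 and -2 those of
  v^4 \<delta>; second differences occur only for \<delta>. One constant K serves all estimates, as
  \<open>barrier_point\<close> requires.\<close>

definition regular_at :: "real \<Rightarrow> real \<Rightarrow> bool" where
  "regular_at K z \<longleftrightarrow> z \<ge> 1 \<and>
     (\<forall>r \<in> {7, -6, 11, -2}. \<forall>h \<in> {1/2, -1/2}. \<bar>v (z + h) powr r - v z powr r\<bar> \<le> K * (v z ^ 3 * v z powr r)) \<and>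
     (\<forall>r \<in> {7, -6}. \<bar>v (z + 1/2) powr r + v (z - 1/2) powr r - 2 * v z powr r\<bar> \<le> K * (v z ^ 6 * v z powr r)) \<and>
     \<bar>X (z + 1/2) - X (z - 1/2)\<bar> \<le> K * v z ^ 3 * X (z - 1/2) \<and>
     \<bar>S (z + 1/2) - S (z - 1/2)\<bar> \<le> K * v z ^ 3 * S (z - 1/2) \<and>
     \<bar>(X (z + 1/2) + X (z - 1/2)) * ((S z)\<^sup>2 - (t/2)\<^sup>2) - (2 * z * S z - \<alpha> * (t/2))\<bar> \<le> K * v z ^ 6 \<and>
     \<bar>S (z + 1/2) + S (z - 1/2) - (2 * z / X z + 1 / (X z)\<^sup>2)\<bar> \<le> K * v z ^ 9"

lemma regular_atD:
  assumes "regular_at K z"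
  shows "z \<ge> 1"
    "(\<forall>r \<in> {7, -6, 11, -2}. \<forall>h \<in> {1/2, -1/2}. \<bar>v (z + h) powr r - v z powr r\<bar> \<le> K * (v z ^ 3 * v z powr r))"
    "(\<forall>r \<in> {7, -6}. \<bar>v (z + 1/2) powr r + v (z - 1/2) powr r - 2 * v z powr r\<bar> \<le> K * (v z ^ 6 * v z powr r))"
    "\<bar>X (z + 1/2) - X (z - 1/2)\<bar> \<le> K * v z ^ 3 * X (z - 1/2)"
    "\<bar>S (z + 1/2) - S (z - 1/2)\<bar> \<le> K * v z ^ 3 * S (z - 1/2)"
    "\<bar>(X (z + 1/2) + X (z - 1/2)) * ((S z)\<^sup>2 - (t/2)\<^sup>2) - (2 * z * S z - \<alpha> * (t/2))\<bar> \<le> K * v z ^ 6"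
    "\<bar>S (z + 1/2) + S (z - 1/2) - (2 * z / X z + 1 / (X z)\<^sup>2)\<bar> \<le> K * v z ^ 9"
  using assms unfolding regular_at_def by - (elim conjE, assumption)+

lemma regular_eventually:
  obtains K where "K \<ge> 1" "\<forall>\<^sub>F z in at_top. regular_at K z"
proof -
  have "\<exists>K. \<forall>z\<ge>1. \<forall>h\<in>{1/2,-1/2}. \<bar>v (z + h) powr r - v z powr r\<bar> \<le> K * (v z ^ 3 * v z powr r)" for r
  proof -
    obtain K where "\<And>z h. z \<ge> 1 \<Longrightarrow> \<bar>h\<bar> = 1/2 \<Longrightarrow> \<bar>v (z + h) powr r - v z powr r\<bar> \<le> K * (v z ^ 3 * v z powr r)"
      using vscale_shift_bound[of r] by blast
    moreover have "\<bar>h\<bar> = 1/2" if "h \<in> {1/2, -1/2}" for h :: real using that by auto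
    ultimately show ?thesis by blast
  qed
  then obtain K1 where K1: "\<And>r z h. z \<ge> 1 \<Longrightarrow> h \<in> {1/2,-1/2} \<Longrightarrow> \<bar>v (z + h) powr r - v z powr r\<bar> \<le> K1 r * (v z ^ 3 * v z powr r)"
    by metis
  have "\<exists>K. \<forall>z\<ge>1. \<bar>v (z + 1/2) powr r + v (z - 1/2) powr r - 2 * v z powr r\<bar> \<le> K * (v z ^ 6 * v z powr r)" for r
    using vscale_second_difference_bound[of r] by metis
  then obtain K2 where K2: "\<And>r z. z \<ge> 1 \<Longrightarrow> \<bar>v (z + 1/2) powr r + v (z - 1/2) powr r - 2 * v z powr r\<bar> \<le> K2 r * (v z ^ 6 * v z powr r)"
    by metis
  obtain K3 where K3: "K3 > 0" "\<forall>\<^sub>F z in at_top. \<bar>X (z + 1/2) - X (z - 1/2)\<bar> \<le> K3 * v z ^ 3 * X (z - 1/2)"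
    using x_approx_relative_variation .
  obtain K4 where K4: "K4 > 0" "\<forall>\<^sub>F z in at_top. \<bar>S (z + 1/2) - S (z - 1/2)\<bar> \<le> K4 * v z ^ 3 * S (z - 1/2)"
    using s_approx_relative_variation .
  obtain K5 where K5: "K5 > 0" "\<forall>\<^sub>F z in at_top. \<bar>(X (z + 1/2) + X (z - 1/2)) * ((S z)\<^sup>2 - (t/2)\<^sup>2) - (2 * z * S z - \<alpha> * (t/2))\<bar> \<le> K5 * \<bar>v z ^ 6\<bar>"
    using eventually_bigo_bound[OF x_residual] .
  obtain K6 where K6: "K6 > 0" "\<forall>\<^sub>F z in at_top. \<bar>S (z + 1/2) + S (z - 1/2) - (2 * z / X z + 1 / (X z)\<^sup>2)\<bar> \<le> K6 * \<bar>v z ^ 9\<bar>"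
    using eventually_bigo_bound[OF s_residual] .
  define K where "K = Max {1, K1 7, K1 (-6), K1 11, K1 (-2), K2 7, K2 (-6), K3, K4, K5, K6}"
  have K: "1 \<le> K" "K1 7 \<le> K" "K1 (-6) \<le> K" "K1 11 \<le> K" "K1 (-2) \<le> K" "K2 7 \<le> K" "K2 (-6) \<le> K" "K3 \<le> K" "K4 \<le> K" "K5 \<le> K" "K6 \<le> K"
    unfolding K_def by (rule Max_ge; simp)+
  have "\<forall>\<^sub>F z in at_top. regular_at K z"
    using K3(2) K4(2) K5(2) K6(2) eventually_ge_at_top[of 1]
      eventually_shift[OF x_approx_bounds, of "-1/2"] eventually_shift[OF s_approx_bounds, of "-1/2"]
  proof eventually_elim
    case (elim z)
    have vp: "v z > 0" "v (z - 1/2) > 0" using elim(5) by (intro vscale_pos; simp)+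
    have "1 / (2 * t * v (z - 1/2)) > 0" "1 / (4 * v (z - 1/2) ^ 2) > 0" using vp t by simp_all
    moreover have "1 / (2 * t * v (z - 1/2)) \<le> X (z - 1/2)" "1 / (4 * v (z - 1/2) ^ 2) \<le> S (z - 1/2)"
      using elim(6,7) by simp_all
    ultimately have p: "X (z - 1/2) > 0" "S (z - 1/2) > 0" by linarith+
    have mono: "y \<le> K * g" if "y \<le> k * g" "k \<le> K" "g \<ge> 0" for y k g
      using that by (meson mult_right_mono order_trans)
    have "\<bar>v (z + h) powr r - v z powr r\<bar> \<le> K * (v z ^ 3 * v z powr r)" if "r \<in> {7, -6, 11, -2}" "h \<in> {1/2, -1/2}" for r h
      by (rule mono[OF K1[OF elim(5) that(2)]]) (use that K vp in auto)
    moreover have "\<bar>v (z + 1/2) powr r + v (z - 1/2) powr r - 2 * v z powr r\<bar> \<le> K * (v z ^ 6 * v z powr r)" if "r \<in> {7, -6}" for r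
      by (rule mono[OF K2[OF elim(5)]]) (use that K vp in auto)
    moreover have "\<bar>X (z + 1/2) - X (z - 1/2)\<bar> \<le> K * (v z ^ 3 * X (z - 1/2))"
      by (rule mono[of _ K3]) (use elim(1) K vp p in \<open>auto simp: mult.assoc\<close>)
    moreover have "\<bar>S (z + 1/2) - S (z - 1/2)\<bar> \<le> K * (v z ^ 3 * S (z - 1/2))"
      by (rule mono[of _ K4]) (use elim(2) K vp p in \<open>auto simp: mult.assoc\<close>)
    moreover have "\<bar>(X (z + 1/2) + X (z - 1/2)) * ((S z)\<^sup>2 - (t/2)\<^sup>2) - (2 * z * S z - \<alpha> * (t/2))\<bar> \<le> K * v z ^ 6"
      by (rule mono[of _ K5]) (use elim(3) K vp in auto)
    moreover have "\<bar>S (z + 1/2) + S (z - 1/2) - (2 * z / X z + 1 / (X z)\<^sup>2)\<bar> \<le> K * v z ^ 9"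
      by (rule mono[of _ K6]) (use elim(4) K vp in auto)
    ultimately show ?case using elim(5) unfolding regular_at_def by (simp add: mult.assoc)
  qed
  thus ?thesis using that K(1) by blast
qed

text \<open>Collects what follows from v tending to 0 once the constants are fixed. Comparing v at z
  + 1/2 and z - 1/2 with v z up to a factor 2 lets the bounds at the neighbours be stated through v
  z.\<close>

definition small_at :: "real \<Rightarrow> real \<Rightarrow> real \<Rightarrow> real \<Rightarrow> bool" where
  "small_at c K B z \<longleftrightarrow>
     K * v z ^ 3 \<le> 1/16 \<and> 100 * K\<^sup>2 * v z ^ 2 \<le> c \<and> c * v z ^ 4 \<le> 1 \<and> 4 * B * v z ^ 7 \<le> 1 \<and>
     v (z + 1/2) \<le> 2 * v z \<and> v z / 2 \<le> v (z + 1/2) \<and> v (z - 1/2) \<le> 2 * v z \<and> v z / 2 \<le> v (z - 1/2) \<and>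
     (\<forall>h \<in> {0, 1/2, -1/2}. 1 / (2 * t * v (z + h)) \<le> X (z + h) \<and> X (z + h) \<le> 2 / (t * v (z + h)) \<and>
        1 / (4 * v (z + h) ^ 2) \<le> S (z + h) \<and> S (z + h) \<le> 1 / v (z + h) ^ 2) \<and>
     (t/2)\<^sup>2 \<le> 1 / (32 * v z ^ 4) \<and> 4 * \<bar>\<alpha>\<bar> * v z \<le> 1"

lemma small_eventually:
  assumes "c > 0"
  shows "\<forall>\<^sub>F z in at_top. small_at c K B z"
proof -
  have lim: "\<forall>\<^sub>F z in at_top. k * v z ^ n < e" if "e > 0" "n > 0" for k e :: real and n
  proof -
    have "((\<lambda>z. k * v z ^ n) \<longlongrightarrow> k * 0 ^ n) at_top" by (intro tendsto_intros vscale_tendsto_0)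
    hence "((\<lambda>z. k * v z ^ n) \<longlongrightarrow> 0) at_top" using that by (simp add: power_0_left)
    thus ?thesis using that(1) by (rule order_tendstoD(2))
  qed
  note 1 = lim[of "1/16" 3 K] lim[of c 2 "100 * K\<^sup>2"] lim[of 1 4 c] lim[of 1 7 "4 * B"] lim[of 1 1 "4 * \<bar>\<alpha>\<bar>"] lim[of 1 4 "(t/2)\<^sup>2 * 32"]
  note 2 = eventually_conj[OF x_approx_bounds s_approx_bounds]
  note 3 = eventually_shift[OF 2, of "1/2"] eventually_shift[OF 2, of "-1/2"]
  have "\<forall>\<^sub>F z in at_top. K * v z ^ 3 < 1/16" "\<forall>\<^sub>F z in at_top. 100 * K\<^sup>2 * v z ^ 2 < c" "\<forall>\<^sub>F z in at_top. c * v z ^ 4 < 1"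
    "\<forall>\<^sub>F z in at_top. 4 * B * v z ^ 7 < 1" "\<forall>\<^sub>F z in at_top. 4 * \<bar>\<alpha>\<bar> * v z ^ 1 < 1" "\<forall>\<^sub>F z in at_top. (t/2)\<^sup>2 * 32 * v z ^ 4 < 1"
    using assms by (intro lim; simp)+
  with 2 3 vscale_shift_eventually vscale_eventually_pos show ?thesis
  proof eventually_elim
    case (elim z)
    have "(t/2)\<^sup>2 \<le> 1 / (32 * v z ^ 4)" using elim by (simp add: pos_le_divide_eq mult_ac)
    thus ?case unfolding small_at_def using elim by auto
  qed
qed

end

section \<open>Sandwiching the true solution\<close>

context positive_solution
begin

interpretation approximants t \<alpha> by unfold_locales (rule t)

text \<open>The sequence x is sampled at \<open>node\<close>, s at \<open>mid\<close>. Then 2 n + 2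
  + \<alpha> is twice \<open>mid n\<close> and 2 n + 3 + \<alpha> twice \<open>node (Suc n)\<close>,
  so both equations become symmetric about their own point and odd-order differences drop
  out.\<close>

abbreviation node :: "nat \<Rightarrow> real" where "node n \<equiv> real n + (1 + \<alpha>) / 2"
abbreviation mid :: "nat \<Rightarrow> real" where "mid n \<equiv> real n + 1 + \<alpha> / 2"

lemma mid_node: "mid n - 1/2 = node n" "mid n + 1/2 = node (Suc n)"
  "node (Suc n) - 1/2 = mid n" "node (Suc n) + 1/2 = mid (Suc n)"
  by (simp_all add: field_simps)

lemma approximation:
  obtains A n0 where "A > 0" "\<And>n. n \<ge> n0 \<Longrightarrow> X (node n) > 0 \<and> S (mid n) > 0 \<and>
     x n \<le> X (node n) * (1 + A * v (node n) ^ 7) \<and> X (node n) \<le> x n * (1 + A * v (node n) ^ 7) \<and>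
     s n \<le> S (mid n) * (1 + 2 * A * v (mid n) ^ 7) \<and> S (mid n) \<le> s n * (1 + 2 * A * v (mid n) ^ 7)"
proof -
  obtain K where K: "K \<ge> 1" "\<forall>\<^sub>F z in at_top. regular_at K z"
    using regular_eventually .
  define c where "c = t\<^sup>2 / 1024"
  define B where "B = max (128 * t * K / c) (8 * K / t\<^sup>2)"
  have c: "c > 0" using t by (simp add: c_def)
  have B: "B \<ge> 128 * t * K / c" "B \<ge> 8 * K / t\<^sup>2" by (simp_all add: B_def)
  have "128 * t * K / c > 0" using t K c by simp
  hence B0: "B > 0" using B by linarith
  obtain z0 where z0: "\<And>z. z \<ge> z0 \<Longrightarrow> regular_at K z" "\<And>z. z \<ge> z0 \<Longrightarrow> small_at c K B z"
    using eventually_conj[OF K(2) small_eventually[OF c, of K B]]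
    by (auto simp: eventually_at_top_linorder)
  obtain n0 :: nat where n0: "real n0 \<ge> z0 + \<bar>\<alpha>\<bar> + 1" using real_arch_simple by blast
  have node_ge: "node n \<ge> z0" "mid n \<ge> z0" if "n \<ge> n0" for n
    using that n0 \<alpha> by (auto simp: abs_if field_simps split: if_splits)
  have z_pos: "z > 0" if "z \<ge> z0" for z using regular_atD(1)[OF z0(1)[OF that]] by simp
  have v_pos: "v z > 0" if "z \<ge> z0" for z using z_pos[OF that] by (rule vscale_pos)
  have X_bounds: "1 / (2 * t * v z) \<le> X z" "X z \<le> 2 / (t * v z)" "X z > 0"
    and S_bounds: "1 / (4 * v z ^ 2) \<le> S z" "S z \<le> 1 / v z ^ 2" "S z > 0" if "z \<ge> z0" for z
  proof -
    show 1: "1 / (2 * t * v z) \<le> X z" "X z \<le> 2 / (t * v z)" "1 / (4 * v z ^ 2) \<le> S z" "S z \<le> 1 / v z ^ 2"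
      using z0(2)[OF that] by (auto simp: small_at_def)
    have "1 / (2 * t * v z) > 0" "1 / (4 * v z ^ 2) > 0" using v_pos[OF that] t by simp_all
    thus "X z > 0" "S z > 0" using 1 by linarith+
  qed
  have S_gt: "S z > t/2" "2 * \<bar>\<alpha>\<bar> * S z \<le> z * t" "(S z)\<^sup>2 - (t/2)\<^sup>2 \<ge> 1 / (32 * v z ^ 4)" if "z \<ge> z0" for z
  proof -
    have vp: "v z > 0" using v_pos[OF that] .
    have "(1 / (4 * v z ^ 2))\<^sup>2 \<le> (S z)\<^sup>2" using S_bounds[OF that] by (intro power_mono) auto
    hence *: "1 / (16 * v z ^ 4) \<le> (S z)\<^sup>2" by (simp add: power_divide power_mult_distrib flip: power_mult)
    have h: "(t/2)\<^sup>2 \<le> 1 / (32 * v z ^ 4)" "4 * \<bar>\<alpha>\<bar> * v z \<le> 1"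
      using z0(2)[OF that] by (auto simp: small_at_def)
    have e: "1 / (16 * v z ^ 4) = 1 / (32 * v z ^ 4) + 1 / (32 * v z ^ 4)" by simp
    show "(S z)\<^sup>2 - (t/2)\<^sup>2 \<ge> 1 / (32 * v z ^ 4)" using * h e by linarith
    moreover have "1 / (32 * v z ^ 4) > 0" using vp by simp
    ultimately have "(t/2)\<^sup>2 < (S z)\<^sup>2" by linarith
    thus "S z > t/2" using S_bounds(3)[OF that] by (intro power2_less_imp_less[of "t/2"]) auto
    have "2 * \<bar>\<alpha>\<bar> * S z \<le> 2 * \<bar>\<alpha>\<bar> * (1 / v z ^ 2)"
      using S_bounds[OF that] by (intro mult_left_mono) auto
    also have "\<dots> = (4 * \<bar>\<alpha>\<bar> * v z) / (2 * v z ^ 3)" using vp by (simp add: field_simps eval_nat_numeral)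
    also have "\<dots> \<le> 1 / (2 * v z ^ 3)" using h vp by (intro divide_right_mono) auto
    also have "\<dots> = z * t"
    proof -
      have "t * v z ^ 3 * (2 * z) = 1" unfolding vscale_cube[OF z_pos[OF that]] using z_pos[OF that] by simp
      thus ?thesis using vp by (simp add: field_simps)
    qed
    finally show "2 * \<bar>\<alpha>\<bar> * S z \<le> z * t" .
  qed
  \<comment> \<open>The first entry makes \<delta> large against the residuals. The other two place
    the barriers above and below the solution at n0 for every \<epsilon> > 0, which is the starting
    condition of the comparison.\<close>
  define A where "A = max (4 * B) (max (x n0 / (X (node n0) * v (node n0) powr 7)) (X (node n0) / (x n0 * v (node n0) powr 7)))"
  have A: "A \<ge> 4 * B" "A \<ge> x n0 / (X (node n0) * v (node n0) powr 7)" "A \<ge> X (node n0) / (x n0 * v (node n0) powr 7)"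
    unfolding A_def by auto
  have A0: "A > 0" using A(1) B0 by linarith
  define \<delta> \<eta> where "\<delta> \<epsilon> z = A * v z powr 7 + \<epsilon> * v z powr (-6)"
    and "\<eta> \<epsilon> z = A * v z powr 11 + \<epsilon> * v z powr (-2)" for \<epsilon> z
  define D E where "D \<epsilon> z = 1 + \<delta> \<epsilon> z" and "E \<epsilon> z = 1 + \<delta> \<epsilon> z + c * \<eta> \<epsilon> z" for \<epsilon> z
  have \<delta>_pos: "\<delta> \<epsilon> z > 0" "\<eta> \<epsilon> z > 0" if "\<epsilon> > 0" "z \<ge> z0" for \<epsilon> z
    using that A0 v_pos[of z] by (simp_all add: \<delta>_def \<eta>_def add_pos_pos)
  have \<eta>_\<delta>: "\<eta> \<epsilon> z = v z ^ 4 * \<delta> \<epsilon> z" if "z \<ge> z0" for \<epsilon> z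
  proof -
    have "v z ^ 4 = v z powr 4" using v_pos[OF that] by (simp add: powr_numeral)
    hence "v z ^ 4 * v z powr r = v z powr (4 + r)" for r by (simp add: powr_add)
    from this[of 7] this[of "-6"] show ?thesis
      unfolding \<eta>_def \<delta>_def distrib_left by (simp add: mult.left_commute)
  qed
  have bp: "barrier_point t c K B (v z) (\<delta> \<epsilon> z) (\<delta> \<epsilon> (z + 1/2)) (\<delta> \<epsilon> (z - 1/2)) (\<eta> \<epsilon> (z + 1/2)) (\<eta> \<epsilon> (z - 1/2))"
    if z: "z \<ge> z0" and \<epsilon>: "\<epsilon> > 0" for z \<epsilon>
  proof
    have reg: "regular_at K z" and sm: "small_at c K B z" using z0 z by auto
    have lin: "\<bar>A * p + \<epsilon> * q - (A * p' + \<epsilon> * q')\<bar> \<le> k * (A * p' + \<epsilon> * q')"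
      if "\<bar>p - p'\<bar> \<le> k * p'" "\<bar>q - q'\<bar> \<le> k * q'" for p q p' q' k
    proof -
      have "A * p + \<epsilon> * q - (A * p' + \<epsilon> * q') = A * (p - p') + \<epsilon> * (q - q')" by (simp add: algebra_simps)
      also have "\<bar>\<dots>\<bar> \<le> A * \<bar>p - p'\<bar> + \<epsilon> * \<bar>q - q'\<bar>"
        using abs_triangle_ineq[of "A * (p - p')" "\<epsilon> * (q - q')"] A0 \<epsilon> by (simp add: abs_mult)
      also have "\<dots> \<le> A * (k * p') + \<epsilon> * (k * q')" using that A0 \<epsilon> by (intro add_mono mult_left_mono) auto
      also have "\<dots> = k * (A * p' + \<epsilon> * q')" by (simp add: algebra_simps)
      finally show ?thesis .
    qed
    have sh: "\<bar>v (z + h) powr r - v z powr r\<bar> \<le> K * v z ^ 3 * v z powr r" if "r \<in> {7, -6, 11, -2}" "h \<in> {1/2, -1/2}" for r h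
      unfolding mult.assoc using regular_atD(2,3)[OF reg] that by blast
    have sd: "\<bar>v (z + 1/2) powr r + v (z - 1/2) powr r - 2 * v z powr r\<bar> \<le> K * v z ^ 6 * v z powr r" if "r \<in> {7, -6}" for r
      unfolding mult.assoc using regular_atD(2,3)[OF reg] that by blast
    show "\<bar>\<delta> \<epsilon> (z + 1/2) - \<delta> \<epsilon> z\<bar> \<le> K * v z ^ 3 * \<delta> \<epsilon> z"
      unfolding \<delta>_def by (intro lin sh) auto
    show "\<bar>\<delta> \<epsilon> (z - 1/2) - \<delta> \<epsilon> z\<bar> \<le> K * v z ^ 3 * \<delta> \<epsilon> z"
      unfolding \<delta>_def using sh[of _ "-1/2"] by (intro lin) auto
    show "\<bar>\<eta> \<epsilon> (z + 1/2) - v z ^ 4 * \<delta> \<epsilon> z\<bar> \<le> K * v z ^ 3 * (v z ^ 4 * \<delta> \<epsilon> z)"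
      unfolding \<eta>_\<delta>[OF z, symmetric] \<eta>_def by (intro lin sh) auto
    show "\<bar>\<eta> \<epsilon> (z - 1/2) - v z ^ 4 * \<delta> \<epsilon> z\<bar> \<le> K * v z ^ 3 * (v z ^ 4 * \<delta> \<epsilon> z)"
      unfolding \<eta>_\<delta>[OF z, symmetric] \<eta>_def using sh[of _ "-1/2"] by (intro lin) auto
    \<comment> \<open>Taking the mean of the two neighbouring values brings the second difference
      into the form handled by \<open>lin\<close>.\<close>
    have "\<bar>A * ((v (z + 1/2) powr 7 + v (z - 1/2) powr 7) / 2) + \<epsilon> * ((v (z + 1/2) powr (-6) + v (z - 1/2) powr (-6)) / 2)
       - (A * v z powr 7 + \<epsilon> * v z powr (-6))\<bar> \<le> (K * v z ^ 6 / 2) * (A * v z powr 7 + \<epsilon> * v z powr (-6))"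
      using sd[of 7] sd[of "-6"] by (intro lin) (simp_all add: abs_le_iff field_simps)
    thus "\<bar>\<delta> \<epsilon> (z + 1/2) + \<delta> \<epsilon> (z - 1/2) - 2 * \<delta> \<epsilon> z\<bar> \<le> K * v z ^ 6 * \<delta> \<epsilon> z"
      unfolding \<delta>_def by (simp add: abs_le_iff field_simps)
    show "\<delta> \<epsilon> z > 0" using \<delta>_pos \<epsilon> z by auto
    show "v z > 0" by (rule v_pos[OF z])
    show "K * v z ^ 3 \<le> 1/16" "100 * K\<^sup>2 * (v z)\<^sup>2 \<le> c" "c * v z ^ 4 \<le> 1"
      using sm by (auto simp: small_at_def)
    \<comment> \<open>As 4 B v^7 is at most \<delta> and also at most 1, the left side is at most
      \<delta> / 4 + \<delta> / 2.\<close>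
    show "B * v z ^ 7 * (1 + 2 * \<delta> \<epsilon> z) < \<delta> \<epsilon> z"
    proof -
      have "4 * B * v z ^ 7 \<le> A * v z ^ 7" using A(1) v_pos[OF z] by (intro mult_right_mono) auto
      also have "\<dots> \<le> \<delta> \<epsilon> z" using v_pos[OF z] \<epsilon> by (simp add: \<delta>_def powr_numeral)
      finally have 1: "4 * B * v z ^ 7 \<le> \<delta> \<epsilon> z" .
      have "4 * B * v z ^ 7 * \<delta> \<epsilon> z \<le> 1 * \<delta> \<epsilon> z"
        using sm \<delta>_pos[OF \<epsilon> z] by (intro mult_right_mono) (auto simp: small_at_def)
      moreover have "B * v z ^ 7 * (1 + 2 * \<delta> \<epsilon> z) = (4 * B * v z ^ 7) / 4 + (4 * B * v z ^ 7 * \<delta> \<epsilon> z) / 2"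
        by (simp add: algebra_simps)
      ultimately show ?thesis using 1 \<delta>_pos[OF \<epsilon> z] by linarith
    qed
  qed (use t K c B in \<open>auto simp: c_def\<close>)
  have D_pos: "D \<epsilon> z > 1" "E \<epsilon> z > 1" if "\<epsilon> > 0" "z \<ge> z0" for \<epsilon> z
    using \<delta>_pos[OF that] c by (simp_all add: D_def E_def add_pos_pos)
  have ineqs: "(X (z - 1/2) * D \<epsilon> (z - 1/2) + X (z + 1/2) * D \<epsilon> (z + 1/2)) * ((S z)\<^sup>2 - (t/2)\<^sup>2)
        < E \<epsilon> z * (2 * z * S z - \<alpha> * (t/2))"
     "2 * z * S z - \<alpha> * (t/2) < E \<epsilon> z * ((X (z - 1/2) / D \<epsilon> (z - 1/2) + X (z + 1/2) / D \<epsilon> (z + 1/2)) * ((S z)\<^sup>2 - (t/2)\<^sup>2))"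
     "2 * z / (X z * D \<epsilon> z) + 1 / (X z * D \<epsilon> z)\<^sup>2 < S (z - 1/2) / E \<epsilon> (z - 1/2) + S (z + 1/2) / E \<epsilon> (z + 1/2)"
     "S (z - 1/2) * E \<epsilon> (z - 1/2) + S (z + 1/2) * E \<epsilon> (z + 1/2) < 2 * z / (X z / D \<epsilon> z) + 1 / (X z / D \<epsilon> z)\<^sup>2"
    if z: "z \<ge> z0" and \<epsilon>: "\<epsilon> > 0" for z \<epsilon>
  proof -
    interpret bp: barrier_point t c K B "v z" "\<delta> \<epsilon> z" "\<delta> \<epsilon> (z + 1/2)" "\<delta> \<epsilon> (z - 1/2)" "\<eta> \<epsilon> (z + 1/2)" "\<eta> \<epsilon> (z - 1/2)"
      by (rule bp[OF z \<epsilon>])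
    have reg: "regular_at K z" and sm: "small_at c K B z" using z0 z by auto
    have vp: "v z > 0" "v (z + 1/2) > 0" "v (z - 1/2) > 0"
      using regular_atD(1)[OF reg] by (intro vscale_pos; simp)+
    have near: "1 / (4 * t * v z) \<le> X y" "S y > 0" "S y \<le> 4 / (v z)\<^sup>2" if "y = z + 1/2 \<or> y = z - 1/2" for y
    proof -
      have v: "v y > 0" "v y \<le> 2 * v z" "v z / 2 \<le> v y" using that vp sm by (auto simp: small_at_def)
      have b: "1 / (2 * t * v y) \<le> X y" "1 / (4 * v y ^ 2) \<le> S y" "S y \<le> 1 / v y ^ 2"
        using that sm by (auto simp: small_at_def)
      have "1 / (4 * t * v z) \<le> 1 / (2 * t * v y)" using v vp t by (intro divide_left_mono) auto
      thus "1 / (4 * t * v z) \<le> X y" using b by linarith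
      have "1 / (4 * v y ^ 2) > 0" using v by simp
      thus "S y > 0" using b by linarith
      have "(v z / 2)\<^sup>2 \<le> v y ^ 2" using v vp by (intro power_mono) auto
      hence "1 / v y ^ 2 \<le> 1 / (v z / 2)\<^sup>2" using v vp by (intro divide_left_mono) auto
      thus "S y \<le> 4 / (v z)\<^sup>2" using b by (simp add: power_divide)
    qed
    have E: "E \<epsilon> z = 1 + \<delta> \<epsilon> z + c * (v z ^ 4 * \<delta> \<epsilon> z)" by (simp add: E_def \<eta>_\<delta>[OF z])
    note XS = near[of "z + 1/2"] near[of "z - 1/2"] S_gt[OF z] X_bounds[OF z]
    have r: "\<bar>X (z + 1/2) - X (z - 1/2)\<bar> \<le> K * v z ^ 3 * X (z - 1/2)"
      "\<bar>S (z + 1/2) - S (z - 1/2)\<bar> \<le> K * v z ^ 3 * S (z - 1/2)"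
      "\<bar>(X (z + 1/2) + X (z - 1/2)) * ((S z)\<^sup>2 - (t/2)\<^sup>2) - (2 * z * S z - \<alpha> * (t/2))\<bar> \<le> K * v z ^ 6"
      "\<bar>S (z + 1/2) + S (z - 1/2) - (2 * z / X z + 1 / (X z)\<^sup>2)\<bar> \<le> K * v z ^ 9"
      using regular_atD(4-7)[OF reg] by simp_all
    show "(X (z - 1/2) * D \<epsilon> (z - 1/2) + X (z + 1/2) * D \<epsilon> (z + 1/2)) * ((S z)\<^sup>2 - (t/2)\<^sup>2)
        < E \<epsilon> z * (2 * z * S z - \<alpha> * (t/2))"
      unfolding E D_def add.commute[of "X (z - 1/2) * _"] by (rule bp.super_x) (use XS r in auto)
    show "2 * z * S z - \<alpha> * (t/2) < E \<epsilon> z * ((X (z - 1/2) / D \<epsilon> (z - 1/2) + X (z + 1/2) / D \<epsilon> (z + 1/2)) * ((S z)\<^sup>2 - (t/2)\<^sup>2))"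
      unfolding E D_def add.commute[of "X (z - 1/2) / _"] by (rule bp.sub_x) (use XS r in auto)
    show "2 * z / (X z * D \<epsilon> z) + 1 / (X z * D \<epsilon> z)\<^sup>2 < S (z - 1/2) / E \<epsilon> (z - 1/2) + S (z + 1/2) / E \<epsilon> (z + 1/2)"
      unfolding E_def D_def by (rule bp.super_s) (use XS r in auto)
    show "S (z - 1/2) * E \<epsilon> (z - 1/2) + S (z + 1/2) * E \<epsilon> (z + 1/2) < 2 * z / (X z / D \<epsilon> z) + 1 / (X z / D \<epsilon> z)\<^sup>2"
      unfolding E_def D_def by (rule bp.sub_s) (use XS r in auto)
  qed
  have low: "D \<epsilon> z \<ge> \<epsilon> / v z ^ 6" "E \<epsilon> z \<ge> \<epsilon> / v z ^ 6" if "\<epsilon> > 0" "z \<ge> z0" for \<epsilon> z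
  proof -
    have "\<epsilon> * v z powr (-6) = \<epsilon> / v z ^ 6"
      using v_pos[OF that(2)] by (simp add: powr_minus_divide powr_numeral)
    moreover have "A * v z powr 7 \<ge> 0" using A0 by simp
    ultimately show 1: "D \<epsilon> z \<ge> \<epsilon> / v z ^ 6" by (simp add: D_def \<delta>_def)
    have "c * \<eta> \<epsilon> z \<ge> 0" using \<delta>_pos[OF that] c by simp
    thus "E \<epsilon> z \<ge> \<epsilon> / v z ^ 6" using 1 by (simp add: D_def E_def)
  qed
  have squeeze: "f \<longlonglongrightarrow> 0" if "g \<longlonglongrightarrow> 0" "\<And>n. n \<ge> n0 \<Longrightarrow> 0 \<le> f n \<and> f n \<le> g n" for f g :: "nat \<Rightarrow> real"
  proof (rule tendsto_sandwich[OF _ _ tendsto_const that(1)])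
    show "\<forall>\<^sub>F n in sequentially. 0 \<le> f n" "\<forall>\<^sub>F n in sequentially. f n \<le> g n"
      using that(2) by (auto intro!: eventually_sequentiallyI[of n0])
  qed
  have pw: "v z ^ k = (2 * t * z) powr (- real k / 3)" if "z \<ge> z0" for z k
    using vscale_powr[OF z_pos[OF that], of "real k"] v_pos[OF that] by (simp add: powr_realpow)
  have div_le: "a / b \<le> a' / b'" if "0 \<le> a" "a \<le> a'" "0 < b'" "b' \<le> b" for a b a' b' :: real
    using that by (intro frac_le) auto
  have m2: "2 * mid n = 2 * real n + 2 + \<alpha>" "2 * node (Suc n) = 2 * real n + 3 + \<alpha>" for n
    by (simp_all add: field_simps)
  have upper: "x n \<le> X (node n) * D \<epsilon> (node n) \<and> S (mid n) / E \<epsilon> (mid n) \<le> s n" if n: "n \<ge> n0" and \<epsilon>: "\<epsilon> > 0" for n \<epsilon>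
  proof (rule upper_comparison[where Y = "\<lambda>n. X (node n) * D \<epsilon> (node n)" and E = "\<lambda>n. E \<epsilon> (mid n)" and S = "\<lambda>n. S (mid n)"])
    fix k assume k: "k \<ge> n0"
    note g = node_ge[OF k] node_ge(1)[of "Suc k"] node_ge(2)[of "Suc k"]
    show "t / 2 < S (mid k)" by (rule S_gt[OF node_ge(2)[OF k]])
    show "2 * \<bar>\<alpha>\<bar> * S (mid k) \<le> mid k * t" by (rule S_gt[OF node_ge(2)[OF k]])
    show "1 \<le> E \<epsilon> (mid k)" using D_pos[OF \<epsilon> node_ge(2)[OF k]] by simp
    show "0 < X (node k) * D \<epsilon> (node k)" using D_pos[OF \<epsilon> node_ge(1)[OF k]] X_bounds[OF node_ge(1)[OF k]] by simp
    show "(X (node k) * D \<epsilon> (node k) + X (node (Suc k)) * D \<epsilon> (node (Suc k))) * ((S (mid k))\<^sup>2 - (t / 2)\<^sup>2)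
       < E \<epsilon> (mid k) * ((2 * real k + 2 + \<alpha>) * S (mid k) - \<alpha> * (t / 2))"
      using ineqs(1)[OF node_ge(2)[OF k] \<epsilon>] unfolding mid_node m2 .
    show "(2 * real k + 3 + \<alpha>) / (X (node (Suc k)) * D \<epsilon> (node (Suc k))) + 1 / (X (node (Suc k)) * D \<epsilon> (node (Suc k)))\<^sup>2
       < S (mid k) / E \<epsilon> (mid k) + S (mid (Suc k)) / E \<epsilon> (mid (Suc k))"
      using ineqs(3)[OF node_ge(1)[of "Suc k"] \<epsilon>] k unfolding mid_node m2 by simp
  next
    have "x n0 / (X (node n0) * v (node n0) powr 7) * (X (node n0) * v (node n0) powr 7) \<le> A * (X (node n0) * v (node n0) powr 7)"
      using A(2) X_bounds[OF node_ge(1)[of n0]] by (intro mult_right_mono) auto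
    hence "x n0 \<le> X (node n0) * (A * v (node n0) powr 7)"
      using X_bounds(3)[OF node_ge(1)[of n0]] v_pos[OF node_ge(1)[of n0]] by (simp add: mult_ac)
    also have "\<dots> \<le> X (node n0) * D \<epsilon> (node n0)"
      using X_bounds(3)[OF node_ge(1)[of n0]] \<epsilon> by (intro mult_left_mono) (auto simp: D_def \<delta>_def)
    finally show "x n0 \<le> X (node n0) * D \<epsilon> (node n0)" .
  next
    \<comment> \<open>The a priori bound on x holds from index 1 on, hence the shift. It is O(n),
      while the barrier is at least of order n^(7/3).\<close>
    show "(\<lambda>n. x n / (X (node n) * D \<epsilon> (node n))) \<longlonglongrightarrow> 0"
    proof (rule LIMSEQ_imp_Suc, rule squeeze)
      show "(\<lambda>n. (1 + (2 * real n + 4 + \<alpha>) / t) * (2 * t / \<epsilon> * (2 * t * node (Suc n)) powr (- real 7 / 3))) \<longlonglongrightarrow> 0"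
        using t \<epsilon> by real_asymp
      fix n assume n: "n \<ge> n0"
      have z: "node (Suc n) \<ge> z0" using node_ge(1)[of "Suc n"] n by simp
      have vp: "v (node (Suc n)) > 0" using v_pos[OF z] .
      have "1 / (2 * t * v (node (Suc n))) * (\<epsilon> / v (node (Suc n)) ^ 6) \<le> X (node (Suc n)) * D \<epsilon> (node (Suc n))"
        using X_bounds[OF z] low[OF \<epsilon> z] vp \<epsilon> t by (intro mult_mono) auto
      hence "x (Suc n) / (X (node (Suc n)) * D \<epsilon> (node (Suc n)))
         \<le> (1 + (2 * real n + 4 + \<alpha>) / t) / (1 / (2 * t * v (node (Suc n))) * (\<epsilon> / v (node (Suc n)) ^ 6))"
        using x_upper[of n] x_pos[of "Suc n"] vp \<epsilon> t by (intro div_le) auto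
      also have "\<dots> = (1 + (2 * real n + 4 + \<alpha>) / t) * (2 * t / \<epsilon> * v (node (Suc n)) ^ 7)"
        using vp \<epsilon> t by (simp add: eval_nat_numeral)
      finally show "0 \<le> x (Suc n) / (X (node (Suc n)) * D \<epsilon> (node (Suc n))) \<and> x (Suc n) / (X (node (Suc n)) * D \<epsilon> (node (Suc n)))
         \<le> (1 + (2 * real n + 4 + \<alpha>) / t) * (2 * t / \<epsilon> * (2 * t * node (Suc n)) powr (- real 7 / 3))"
        unfolding pw[OF z] using x_pos[of "Suc n"] X_bounds[OF z] D_pos[OF \<epsilon> z] by simp
    qed
    \<comment> \<open>For s the bound s n > t / 2 is enough here: S is of order n^(2/3) and E at
      least of order n^2.\<close>
    show "(\<lambda>n. S (mid n) / (E \<epsilon> (mid n) * s n)) \<longlonglongrightarrow> 0"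
    proof (rule squeeze)
      show "(\<lambda>n. 2 / (\<epsilon> * t) * (2 * t * mid n) powr (- real 4 / 3)) \<longlonglongrightarrow> 0"
        using t \<epsilon> by real_asymp
      fix n assume n: "n \<ge> n0"
      note z = node_ge(2)[OF n]
      have vp: "v (mid n) > 0" using v_pos[OF z] .
      have "\<epsilon> / v (mid n) ^ 6 * (t / 2) \<le> E \<epsilon> (mid n) * s n"
        using s_gt[of n] low[OF \<epsilon> z] vp \<epsilon> t D_pos[OF \<epsilon> z] by (intro mult_mono) auto
      hence "S (mid n) / (E \<epsilon> (mid n) * s n) \<le> (1 / v (mid n) ^ 2) / (\<epsilon> / v (mid n) ^ 6 * (t / 2))"
        using S_bounds[OF z] vp \<epsilon> t by (intro div_le) auto
      also have "\<dots> = 2 / (\<epsilon> * t) * v (mid n) ^ 4"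
        using vp \<epsilon> t by (simp add: eval_nat_numeral)
      finally show "0 \<le> S (mid n) / (E \<epsilon> (mid n) * s n) \<and> S (mid n) / (E \<epsilon> (mid n) * s n) \<le> 2 / (\<epsilon> * t) * (2 * t * mid n) powr (- real 4 / 3)"
        unfolding pw[OF z] using S_bounds[OF z] D_pos[OF \<epsilon> z] s_pos[of n] by simp
    qed
  qed (rule n)
  have lower: "X (node n) / D \<epsilon> (node n) \<le> x n \<and> s n \<le> S (mid n) * E \<epsilon> (mid n)" if n: "n \<ge> n0" and \<epsilon>: "\<epsilon> > 0" for n \<epsilon>
  proof (rule lower_comparison[where Y = "\<lambda>n. X (node n) / D \<epsilon> (node n)" and E = "\<lambda>n. E \<epsilon> (mid n)" and S = "\<lambda>n. S (mid n)"])
    fix k assume k: "k \<ge> n0"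
    show "t / 2 < S (mid k)" by (rule S_gt[OF node_ge(2)[OF k]])
    show "2 * \<bar>\<alpha>\<bar> * S (mid k) \<le> mid k * t" by (rule S_gt[OF node_ge(2)[OF k]])
    show "1 \<le> E \<epsilon> (mid k)" using D_pos[OF \<epsilon> node_ge(2)[OF k]] by simp
    show "0 < X (node k) / D \<epsilon> (node k)" using D_pos[OF \<epsilon> node_ge(1)[OF k]] X_bounds[OF node_ge(1)[OF k]] by simp
    show "(2 * real k + 2 + \<alpha>) * S (mid k) - \<alpha> * (t / 2)
       < E \<epsilon> (mid k) * ((X (node k) / D \<epsilon> (node k) + X (node (Suc k)) / D \<epsilon> (node (Suc k))) * ((S (mid k))\<^sup>2 - (t / 2)\<^sup>2))"
      using ineqs(2)[OF node_ge(2)[OF k] \<epsilon>] unfolding mid_node m2 .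
    show "S (mid k) * E \<epsilon> (mid k) + S (mid (Suc k)) * E \<epsilon> (mid (Suc k))
       < (2 * real k + 3 + \<alpha>) / (X (node (Suc k)) / D \<epsilon> (node (Suc k))) + 1 / (X (node (Suc k)) / D \<epsilon> (node (Suc k)))\<^sup>2"
      using ineqs(4)[OF node_ge(1)[of "Suc k"] \<epsilon>] k unfolding mid_node m2 by simp
  next
    note z = node_ge(1)[of n0, OF order_refl]
    have "X (node n0) / (x n0 * v (node n0) powr 7) * (x n0 * v (node n0) powr 7) \<le> A * (x n0 * v (node n0) powr 7)"
      using A(3) x_pos[of n0] by (intro mult_right_mono) auto
    hence "X (node n0) \<le> x n0 * (A * v (node n0) powr 7)"
      using x_pos[of n0] v_pos[OF z] by (simp add: mult_ac)
    also have "\<dots> \<le> x n0 * D \<epsilon> (node n0)"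
      using x_pos[of n0] \<epsilon> by (intro mult_left_mono) (auto simp: D_def \<delta>_def)
    finally show "X (node n0) / D \<epsilon> (node n0) \<le> x n0"
      using D_pos[OF \<epsilon> z] by (simp add: pos_divide_le_eq)
  next
    show "(\<lambda>n. X (node n) / D \<epsilon> (node n) / x n) \<longlonglongrightarrow> 0"
    proof (rule LIMSEQ_imp_Suc, rule squeeze)
      show "(\<lambda>n. 2 / (t * \<epsilon>) * (2 * t * node (Suc n)) powr (- real 5 / 3) * (1 + t + 2 * real n + 3 + \<alpha>)) \<longlonglongrightarrow> 0"
        using t \<epsilon> by real_asymp
      fix n assume n: "n \<ge> n0"
      have z: "node (Suc n) \<ge> z0" using node_ge(1)[of "Suc n"] n by simp
      have vp: "v (node (Suc n)) > 0" using v_pos[OF z] .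
      have "X (node (Suc n)) / D \<epsilon> (node (Suc n)) \<le> (2 / (t * v (node (Suc n)))) / (\<epsilon> / v (node (Suc n)) ^ 6)"
        using X_bounds[OF z] low[OF \<epsilon> z] vp \<epsilon> t by (intro div_le) auto
      also have "\<dots> = 2 / (t * \<epsilon>) * v (node (Suc n)) ^ 5"
        using vp \<epsilon> t by (simp add: eval_nat_numeral)
      finally have "X (node (Suc n)) / D \<epsilon> (node (Suc n)) * (1 / x (Suc n))
          \<le> 2 / (t * \<epsilon>) * v (node (Suc n)) ^ 5 * (1 + t + 2 * real n + 3 + \<alpha>)"
        using inverse_x_upper[of n] x_pos[of "Suc n"] vp \<epsilon> t by (intro mult_mono) auto
      thus "0 \<le> X (node (Suc n)) / D \<epsilon> (node (Suc n)) / x (Suc n) \<and> X (node (Suc n)) / D \<epsilon> (node (Suc n)) / x (Suc n)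
         \<le> 2 / (t * \<epsilon>) * (2 * t * node (Suc n)) powr (- real 5 / 3) * (1 + t + 2 * real n + 3 + \<alpha>)"
        unfolding pw[OF z] using x_pos[of "Suc n"] X_bounds[OF z] D_pos[OF \<epsilon> z] by simp
    qed
    \<comment> \<open>The s-equation and the bound on 1 / x give s = O(n^2), while the barrier is at
      least of order n^(8/3).\<close>
    show "(\<lambda>n. s n / (S (mid n) * E \<epsilon> (mid n))) \<longlonglongrightarrow> 0"
    proof (rule squeeze)
      let ?C = "\<lambda>n. 1 + t + 2 * real n + 3 + \<alpha>"
      show "(\<lambda>n. ((2 * real n + 3 + \<alpha>) * ?C n + (?C n)\<^sup>2) * (4 / \<epsilon> * (2 * t * mid n) powr (- real 8 / 3))) \<longlonglongrightarrow> 0"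
        using t \<epsilon> by real_asymp
      fix n assume n: "n \<ge> n0"
      note z = node_ge(2)[OF n]
      have vp: "v (mid n) > 0" using v_pos[OF z] .
      have "s n \<le> s n + s (Suc n)" using s_pos[of "Suc n"] by simp
      also have "\<dots> = (2 * real n + 3 + \<alpha>) * (1 / x (Suc n)) + (1 / x (Suc n))\<^sup>2"
        unfolding s_eq by (simp add: power_divide)
      also have "\<dots> \<le> (2 * real n + 3 + \<alpha>) * ?C n + (?C n)\<^sup>2"
        using inverse_x_upper[of n] x_pos[of "Suc n"] \<alpha> by (intro add_mono mult_left_mono power_mono) auto
      finally have sn: "s n \<le> (2 * real n + 3 + \<alpha>) * ?C n + (?C n)\<^sup>2" .
      have "1 / (4 * v (mid n) ^ 2) * (\<epsilon> / v (mid n) ^ 6) \<le> S (mid n) * E \<epsilon> (mid n)"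
        using S_bounds[OF z] low[OF \<epsilon> z] vp \<epsilon> by (intro mult_mono) auto
      hence "s n / (S (mid n) * E \<epsilon> (mid n)) \<le> ((2 * real n + 3 + \<alpha>) * ?C n + (?C n)\<^sup>2) / (1 / (4 * v (mid n) ^ 2) * (\<epsilon> / v (mid n) ^ 6))"
        using sn s_pos[of n] vp \<epsilon> by (intro div_le) auto
      also have "\<dots> = ((2 * real n + 3 + \<alpha>) * ?C n + (?C n)\<^sup>2) * (4 / \<epsilon> * v (mid n) ^ 8)"
      proof -
        have "a / (1 / (4 * w ^ 2) * (\<epsilon> / w ^ 6)) = a * (4 / \<epsilon> * w ^ 8)" if "w > 0" for a w :: real
          using that \<epsilon> by (simp add: eval_nat_numeral)
        thus ?thesis using vp .
      qed
      finally show "0 \<le> s n / (S (mid n) * E \<epsilon> (mid n)) \<and> s n / (S (mid n) * E \<epsilon> (mid n))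
         \<le> ((2 * real n + 3 + \<alpha>) * ?C n + (?C n)\<^sup>2) * (4 / \<epsilon> * (2 * t * mid n) powr (- real 8 / 3))"
        unfolding pw[OF z] using S_bounds[OF z] D_pos[OF \<epsilon> z] s_pos[of n] by simp
    qed
  qed (rule n)
  \<comment> \<open>Since A and n0 were fixed before \<epsilon>, the limit can be taken separately
    for each n, where the coefficient w of \<epsilon> is a constant.\<close>
  have eps: "y \<le> y'" if "\<And>\<epsilon>. \<epsilon> > 0 \<Longrightarrow> y \<le> y' + \<epsilon> * w" for y y' w :: real
  proof (rule field_le_epsilon)
    fix e :: real assume e: "e > 0"
    have "e / (\<bar>w\<bar> + 1) * w \<le> e / (\<bar>w\<bar> + 1) * (\<bar>w\<bar> + 1)"
      using e by (intro mult_left_mono) auto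
    also have "\<dots> = e" using abs_ge_zero[of w] by simp
    finally show "y \<le> y' + e" using that[of "e / (\<bar>w\<bar> + 1)"] e by (smt (verit) abs_ge_zero divide_pos_pos)
  qed
  show ?thesis
  proof (rule that[OF A0, of n0])
    fix n assume n: "n \<ge> n0"
    note z = node_ge[OF n]
    let ?z = "node n" and ?y = "mid n"
    have D: "p * D \<epsilon> ?z = p * (1 + A * v ?z ^ 7) + \<epsilon> * (p * v ?z powr (-6))" for p \<epsilon>
      using v_pos[OF z(1)] by (simp add: D_def \<delta>_def powr_numeral algebra_simps)
    have E: "p * E \<epsilon> ?y = p * (1 + A * v ?y ^ 7 + c * (A * v ?y ^ 11)) + \<epsilon> * (p * (v ?y powr (-6) + c * v ?y powr (-2)))" for p \<epsilon>
      using v_pos[OF z(2)] by (simp add: E_def \<delta>_def \<eta>_def powr_numeral algebra_simps)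
    \<comment> \<open>The correction c A v^11 in the factor of s is at most A v^7, which accounts
      for 2 A in the bound for s.\<close>
    have E2: "p * (1 + A * v ?y ^ 7 + c * (A * v ?y ^ 11)) \<le> p * (1 + 2 * A * v ?y ^ 7)" if "p > 0" for p
    proof -
      have "c * (A * v ?y ^ 11) = (c * v ?y ^ 4) * (A * v ?y ^ 7)" by (simp add: eval_nat_numeral)
      also have "\<dots> \<le> 1 * (A * v ?y ^ 7)"
        using z0(2)[OF z(2)] A0 v_pos[OF z(2)] by (intro mult_right_mono) (auto simp: small_at_def)
      finally show ?thesis using that by (intro mult_left_mono) auto
    qed
    have "x n \<le> X ?z * (1 + A * v ?z ^ 7)"
      by (rule eps[of _ _ "X ?z * v ?z powr (-6)"]) (use upper[OF n] D in simp)
    moreover have "X ?z \<le> x n * (1 + A * v ?z ^ 7)"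
    proof (rule eps[of _ _ "x n * v ?z powr (-6)"])
      fix \<epsilon> :: real assume \<epsilon>: "\<epsilon> > 0"
      show "X ?z \<le> x n * (1 + A * v ?z ^ 7) + \<epsilon> * (x n * v ?z powr (-6))"
        unfolding D[symmetric] using lower[OF n \<epsilon>] D_pos[OF \<epsilon> z(1)] by (simp add: pos_divide_le_eq)
    qed
    moreover have "s n \<le> S ?y * (1 + A * v ?y ^ 7 + c * (A * v ?y ^ 11))"
      by (rule eps[of _ _ "S ?y * (v ?y powr (-6) + c * v ?y powr (-2))"]) (use lower[OF n] E in simp)
    moreover have "S ?y \<le> s n * (1 + A * v ?y ^ 7 + c * (A * v ?y ^ 11))"
    proof (rule eps[of _ _ "s n * (v ?y powr (-6) + c * v ?y powr (-2))"])
      fix \<epsilon> :: real assume \<epsilon>: "\<epsilon> > 0"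
      show "S ?y \<le> s n * (1 + A * v ?y ^ 7 + c * (A * v ?y ^ 11)) + \<epsilon> * (s n * (v ?y powr (-6) + c * v ?y powr (-2)))"
        unfolding E[symmetric] using upper[OF n \<epsilon>] D_pos[OF \<epsilon> z(2)] by (simp add: pos_divide_le_eq)
    qed
    ultimately show "X ?z > 0 \<and> S ?y > 0 \<and> x n \<le> X ?z * (1 + A * v ?z ^ 7) \<and> X ?z \<le> x n * (1 + A * v ?z ^ 7) \<and>
       s n \<le> S ?y * (1 + 2 * A * v ?y ^ 7) \<and> S ?y \<le> s n * (1 + 2 * A * v ?y ^ 7)"
      using E2[OF s_pos[of n]] E2[OF S_bounds(3)[OF z(2)]] X_bounds(3)[OF z(1)] S_bounds(3)[OF z(2)] by linarith
  qed
qed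

end

subsection \<open>Expansions of the recurrence coefficients\<close>

text \<open>The reciprocal of \<open>x_poly\<close> modulo degree 6, so that t v times its value at
  v / 9 expands 1 / x.\<close>

definition a_poly :: "real \<Rightarrow> real \<Rightarrow> real poly" where
  "a_poly t \<alpha> = [:1, - 3 * \<alpha>, 0, 9 * \<alpha>^3 - 9 * \<alpha>, 27 * \<alpha>^4 - 27 * \<alpha>^2 - 2187 * t^2,
     243 * \<alpha>^3 + 19683 * \<alpha> * t^2 - 243 * \<alpha>:]"

text \<open>With q the value of \<open>s_poly\<close> at w = v / 9, this is the expansion of (q -
  \<alpha> t^2 v^5)^2 / (q^2 - t^2 v^4) in w below degree 10. Divided by 4 t^2 v^6 it gives the main
  part of b.\<close>

definition b_poly :: "real \<Rightarrow> real \<Rightarrow> real poly" where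
  "b_poly t \<alpha> = [:1, 0, 0, 0, 6561 * t^2, - 78732 * \<alpha> * t^2, - 177147 * \<alpha>^2 * t^2,
     - 472392 * \<alpha>^3 * t^2 + 118098 * \<alpha> * t^2,
     - 885735 * \<alpha>^4 * t^2 + 354294 * \<alpha>^2 * t^2 - 14348907 * t^4,
     - 3188646 * \<alpha>^3 * t^2 + 3188646 * \<alpha> * t^2:]"

text \<open>\<open>s_poly\<close> times the square of the Euler derivative of \<open>x_poly\<close>,
  divided by \<open>x_poly\<close>, modulo degree 4. It carries the effect on b of the difference
  between two consecutive x.\<close>

definition variation_poly :: "real \<Rightarrow> real poly" where
  "variation_poly \<alpha> = [:1, - 6 * \<alpha>, - 9 * \<alpha>^2, 54 * \<alpha>^3 - 54 * \<alpha>:]"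

text \<open>Up to the factor \<open>1/3\<close> this is the action of \<open>z d/dz\<close> on \<open>poly p (v/9) / v\<^sup>k\<close>, since \<open>v\<close> is homogeneous of degree
  \<open>- 1/3\<close> in \<open>z\<close>.\<close>

definition euler_poly :: "nat \<Rightarrow> real poly \<Rightarrow> real poly" where
  "euler_poly k p = (\<Sum>i\<le>degree p. monom (coeff p i * (real k - real i)) i)"

lemma coeff_euler_poly: "coeff (euler_poly k p) i = coeff p i * (real k - real i)"
proof -
  have "coeff (euler_poly k p) i = (\<Sum>j\<le>degree p. if j = i then coeff p i * (real k - real i) else 0)"
    unfolding euler_poly_def coeff_sum by (intro sum.cong) auto
  thus ?thesis by (simp add: coeff_eq_0)
qed

lemma less_numeral_cases:
  "(k::nat) < 10 \<longleftrightarrow> k \<in> {0, 1, 2, 3, 4, 5, 6, 7, 8, 9}"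
  "(k::nat) < 6 \<longleftrightarrow> k \<in> {0, 1, 2, 3, 4, 5}"
  "(k::nat) < 4 \<longleftrightarrow> k \<in> {0, 1, 2, 3}"
  by (auto simp: eval_nat_numeral less_Suc_eq)

lemma a_poly_dvd: "monom 1 6 dvd x_poly t \<alpha> * a_poly t \<alpha> - 1"
proof -
  have c: "coeff (x_poly t \<alpha> * a_poly t \<alpha> - 1) k = (\<Sum>i\<le>k. coeff (x_poly t \<alpha>) i * coeff (a_poly t \<alpha>) (k - i)) - (if k = 0 then 1 else 0)" for k
    by (simp add: coeff_mult)
  have "\<And>k. k < 6 \<Longrightarrow> coeff (x_poly t \<alpha> * a_poly t \<alpha> - 1) k = 0"
    unfolding less_numeral_cases c
    apply (elim insertE emptyE; hypsubst)
    apply (simp add: sum_atMost_numeral x_poly_def a_poly_def coeff_pCons_numeral; (algebra)?)+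
    done
  thus ?thesis by (simp only: monom_1_dvd_iff') simp
qed

lemma b_poly_dvd:
  "monom 1 10 dvd (s_poly t \<alpha> * s_poly t \<alpha> - monom (118098 * \<alpha> * t\<^sup>2) 5 * s_poly t \<alpha> + monom ((59049 * \<alpha> * t\<^sup>2)\<^sup>2) 10)
     - b_poly t \<alpha> * (s_poly t \<alpha> * s_poly t \<alpha> - monom (6561 * t\<^sup>2) 4)" (is "_ dvd ?P")
proof -
  have c: "coeff ?P k = coeff (s_poly t \<alpha> * s_poly t \<alpha>) k - (if k < 5 then 0 else 118098 * \<alpha> * t\<^sup>2 * coeff (s_poly t \<alpha>) (k - 5))
      + (if 10 = k then (59049 * \<alpha> * t\<^sup>2)\<^sup>2 else 0)
      - (\<Sum>i\<le>k. coeff (b_poly t \<alpha>) i * (coeff (s_poly t \<alpha> * s_poly t \<alpha>) (k - i) - (if 4 = k - i then 6561 * t\<^sup>2 else 0)))" for k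
    by (simp only: coeff_add coeff_diff coeff_monom coeff_monom_mult coeff_mult[of "b_poly t \<alpha>"])
  have "\<And>k. k < 10 \<Longrightarrow> coeff ?P k = 0"
    unfolding less_numeral_cases c
    apply (elim insertE emptyE; hypsubst)
    apply (simp_all add: sum_atMost_numeral coeff_s_poly_square[unfolded One_nat_def])
    apply (simp add: s_poly_def b_poly_def coeff_pCons_numeral; (algebra)?)+
    done
  thus ?thesis by (simp only: monom_1_dvd_iff') simp
qed

lemma variation_poly_dvd:
  "monom 1 4 dvd s_poly t \<alpha> * (euler_poly 1 (x_poly t \<alpha>) * euler_poly 1 (x_poly t \<alpha>)) - variation_poly \<alpha> * x_poly t \<alpha>" (is "_ dvd ?P")
proof -
  have c: "coeff ?P k = (\<Sum>i\<le>k. coeff (s_poly t \<alpha>) i *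
        (\<Sum>j\<le>k - i. coeff (x_poly t \<alpha>) j * (real 1 - real j) * (coeff (x_poly t \<alpha>) (k - i - j) * (real 1 - real (k - i - j)))))
      - (\<Sum>i\<le>k. coeff (variation_poly \<alpha>) i * coeff (x_poly t \<alpha>) (k - i))" for k
    by (simp only: coeff_diff coeff_mult coeff_euler_poly)
  have "\<And>k. k < 4 \<Longrightarrow> coeff ?P k = 0"
    unfolding less_numeral_cases c
    apply (elim insertE emptyE; hypsubst)
    apply (simp add: sum_atMost_numeral s_poly_def x_poly_def variation_poly_def coeff_pCons_numeral; (algebra)?)+
    done
  thus ?thesis by (simp only: monom_1_dvd_iff') simp
qed

lemma powr_odd_difference_bound:
  fixes r :: real
  obtains K where "K \<ge> 0" "\<And>u. \<bar>u\<bar> \<le> 1/2 \<Longrightarrow>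
    \<bar>(1 + u) powr r - (1 - u) powr r - 2 * r * u\<bar> \<le> K * \<bar>u\<bar> ^ 3"
proof -
  obtain K where K: "K \<ge> 0" "\<And>u. \<bar>u\<bar> \<le> 1/2 \<Longrightarrow>
    \<bar>(1 + u) powr r - (\<Sum>m<3. (r gchoose m) * u ^ m)\<bar> \<le> K * \<bar>u\<bar> ^ 3"
    using powr_taylor_bound by blast
  have "\<bar>(1 + u) powr r - (1 - u) powr r - 2 * r * u\<bar> \<le> 2 * K * \<bar>u\<bar> ^ 3"
    if u: "\<bar>u\<bar> \<le> 1/2" for u
  proof -
    have "(\<Sum>m<3. (r gchoose m) * u ^ m) - (\<Sum>m<3. (r gchoose m) * (-u) ^ m) = 2 * r * u"
      by (simp add: eval_nat_numeral)
    moreover have "\<bar>(1 + u) powr r - (\<Sum>m<3. (r gchoose m) * u ^ m)\<bar> \<le> K * \<bar>u\<bar> ^ 3"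
      "\<bar>(1 - u) powr r - (\<Sum>m<3. (r gchoose m) * (-u) ^ m)\<bar> \<le> K * \<bar>u\<bar> ^ 3"
      using K(2)[of u] K(2)[of "-u"] u by auto
    ultimately show ?thesis by linarith
  qed
  thus ?thesis using that[of "2 * K"] K(1) by auto
qed

context scaling
begin

lemma vscale_odd_bound:
  obtains K where "K \<ge> 0" "\<And>z. z \<ge> 1 \<Longrightarrow>
    \<bar>v (z + 1/2) powr r - v (z - 1/2) powr r - v z powr r * (2 / 3 * (- r) * t * v z ^ 3)\<bar> \<le> K * (v z ^ 9 * v z powr r)"
proof -
  obtain K where K: "K \<ge> 0" "\<And>u. \<bar>u\<bar> \<le> 1/2 \<Longrightarrow>
    \<bar>(1 + u) powr (- r / 3) - (1 - u) powr (- r / 3) - 2 * (- r / 3) * u\<bar> \<le> K * \<bar>u\<bar> ^ 3"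
    using powr_odd_difference_bound by blast
  show ?thesis
  proof (rule that[of "K * t ^ 3"])
    fix z :: real assume z: "z \<ge> 1"
    define u where "u = t * v z ^ 3"
    have u: "\<bar>u\<bar> \<le> 1/2" "\<bar>u\<bar> = u" using vscale_cube_le[OF z] t vscale_pos[of z] z by (simp_all add: u_def)
    have "v (z + 1/2) powr r = v z powr r * (1 + u) powr (- r / 3)"
      "v (z - 1/2) powr r = v z powr r * (1 - u) powr (- r / 3)"
      using vscale_shift[OF z, of "1/2" r] vscale_shift[OF z, of "-1/2" r] by (simp_all add: u_def)
    moreover have "2 / 3 * (- r) * t * v z ^ 3 = 2 * (- r / 3) * u" by (simp add: u_def)
    ultimately have "v (z + 1/2) powr r - v (z - 1/2) powr r - v z powr r * (2 / 3 * (- r) * t * v z ^ 3)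
       = v z powr r * ((1 + u) powr (- r / 3) - (1 - u) powr (- r / 3) - 2 * (- r / 3) * u)"
      by (simp only:) (simp add: algebra_simps)
    also have "\<bar>\<dots>\<bar> = v z powr r * \<bar>(1 + u) powr (- r / 3) - (1 - u) powr (- r / 3) - 2 * (- r / 3) * u\<bar>"
      by (simp add: abs_mult)
    also have "\<dots> \<le> v z powr r * (K * \<bar>u\<bar> ^ 3)"
      using K(2)[OF u(1)] by (intro mult_left_mono) auto
    also have "\<dots> = K * t ^ 3 * (v z ^ 9 * v z powr r)"
      unfolding u(2) by (simp add: u_def power_mult_distrib flip: power_mult)
    finally show "\<bar>v (z + 1/2) powr r - v (z - 1/2) powr r - v z powr r * (2 / 3 * (- r) * t * v z ^ 3)\<bar>
      \<le> K * t ^ 3 * (v z ^ 9 * v z powr r)" .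
  qed (use K t in simp)
qed

lemma euler_poly_powr:
  assumes "z > 0"
  shows "2 / 3 * t * v z ^ 3 * laurent k (euler_poly k p) z =
    (\<Sum>i\<le>degree p. coeff p i / 9 ^ i * (v z powr (real i - real k) * (2 / 3 * (- (real i - real k)) * t * v z ^ 3)))"
proof -
  have v: "v z powr (real i - real k) = v z ^ i / v z ^ k" for i
    using vscale_pos[OF assms] by (simp add: powr_diff powr_realpow)
  have e: "poly (euler_poly k p) (v z / 9) = (\<Sum>i\<le>degree p. coeff p i * (real k - real i) * (v z / 9) ^ i)"
    by (simp add: euler_poly_def poly_monom poly_sum)
  show ?thesis
    unfolding v e sum_divide_distrib sum_distrib_left
    by (intro sum.cong refl) (simp add: power_divide algebra_simps diff_divide_distrib)
qed

lemma laurent_odd_difference: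
  "(\<lambda>z. laurent k p (z + 1/2) - laurent k p (z - 1/2) - 2 / 3 * t * v z ^ 3 * laurent k (euler_poly k p) z)
     \<in> O[at_top](\<lambda>z. v z ^ 9 / v z ^ k)"
proof -
  let ?d = "\<lambda>i z. v (z + 1/2) powr (real i - real k) - v (z - 1/2) powr (real i - real k)
     - v z powr (real i - real k) * (2 / 3 * (- (real i - real k)) * t * v z ^ 3)"
  have "(\<lambda>z. \<Sum>i\<le>degree p. coeff p i / 9 ^ i * ?d i z) \<in> O[at_top](\<lambda>z. v z ^ 9 / v z ^ k)"
  proof (intro big_sum_in_bigo)
    fix i
    let ?r = "real i - real k"
    obtain K where K: "K \<ge> 0" "\<And>z. z \<ge> 1 \<Longrightarrow> \<bar>?d i z\<bar> \<le> K * (v z ^ 9 * v z powr ?r)"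
      using vscale_odd_bound[of ?r] by blast
    have "?d i \<in> O[at_top](\<lambda>z. v z ^ 9 * v z powr ?r)"
    proof (rule bigoI[of _ K])
      show "\<forall>\<^sub>F z in at_top. norm (?d i z) \<le> K * norm (v z ^ 9 * v z powr ?r)"
        using eventually_ge_at_top[of 1]
      proof eventually_elim
        case (elim z)
        show ?case using K(2)[OF elim] vscale_pos[of z] elim by simp
      qed
    qed
    also have "(\<lambda>z. v z ^ 9 * v z powr ?r) \<in> O[at_top](\<lambda>z. v z ^ i * (v z ^ 9 / v z ^ k))"
      using vscale_eventually_pos
      by (intro bigoI[of _ 1]) (auto elim!: eventually_mono simp: powr_diff powr_realpow mult_ac)
    also have "(\<lambda>z. v z ^ i * (v z ^ 9 / v z ^ k)) \<in> O[at_top](\<lambda>z. 1 * (v z ^ 9 / v z ^ k))"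
      by (intro landau_o.big.mult vscale_bigo_1) auto
    finally show "(\<lambda>z. coeff p i / 9 ^ i * ?d i z) \<in> O[at_top](\<lambda>z. v z ^ 9 / v z ^ k)"
      by (cases "coeff p i = 0") simp_all
  qed
  also have "?this \<longleftrightarrow> ?thesis"
  proof (intro landau_o.big.in_cong)
    show "\<forall>\<^sub>F z in at_top. (\<Sum>i\<le>degree p. coeff p i / 9 ^ i * ?d i z)
       = laurent k p (z + 1/2) - laurent k p (z - 1/2) - 2 / 3 * t * v z ^ 3 * laurent k (euler_poly k p) z"
      using eventually_ge_at_top[of 1]
    proof eventually_elim
      case (elim z)
      have "(\<Sum>i\<le>n. f i * (A i - B i - C i)) = (\<Sum>i\<le>n. f i * A i) - (\<Sum>i\<le>n. f i * B i) - (\<Sum>i\<le>n. f i * C i)"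
        for f A B C :: "nat \<Rightarrow> real" and n
        by (simp add: algebra_simps sum.distrib sum_subtractf)
      moreover have pos: "z > 0" "z + 1/2 > 0" "z - 1/2 > 0" using elim by auto
      ultimately show ?case
        by (simp only: laurent_powr[OF pos(2), where p=p] laurent_powr[OF pos(3), where p=p]
              euler_poly_powr[OF pos(1)])
    qed
  qed
  finally show ?thesis .
qed

text \<open>Used to move the expansions from the symmetric points back to n + 1. The first-order
  Taylor term is kept; the next one already costs a relative v^6.\<close>

lemma vscale_shift_expansion:
  "(\<lambda>z. v (z + h) powr r - v z powr r * (1 - 2 / 3 * r * h * t * v z ^ 3)) \<in> O[at_top](\<lambda>z. v z ^ 6 * v z powr r)"
proof -
  obtain K where K: "K \<ge> 0" "\<And>u. \<bar>u\<bar> \<le> 1/2 \<Longrightarrow>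
    \<bar>(1 + u) powr (- r / 3) - (\<Sum>m<2. (- r / 3 gchoose m) * u ^ m)\<bar> \<le> K * \<bar>u\<bar> ^ 2"
    using powr_taylor_bound by blast
  show ?thesis
  proof (rule bigoI[of _ "K * (2 * h * t)\<^sup>2"])
    show "\<forall>\<^sub>F z in at_top. norm (v (z + h) powr r - v z powr r * (1 - 2 / 3 * r * h * t * v z ^ 3))
        \<le> K * (2 * h * t)\<^sup>2 * norm (v z ^ 6 * v z powr r)"
      using eventually_gt_at_top[of "2 * \<bar>h\<bar>"]
    proof eventually_elim
      case (elim z)
      hence z: "z > 0" "\<bar>h / z\<bar> \<le> 1/2" by (auto simp: abs_divide field_simps)
      have zh: "z + h > 0" using elim by (simp add: abs_if split: if_splits)
      have p: "1 + h / z > 0" using z(2) by (simp only: abs_le_iff) linarith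
      define u where "u = h / z"
      have u: "u = 2 * h * t * v z ^ 3" using vscale_cube[OF z(1)] z by (simp add: u_def field_simps)
      have "2 * t * z * (1 + h / z) = 2 * t * (z + h)" using z by (simp add: field_simps)
      hence "v (z + h) powr r = (2 * t * z * (1 + h / z)) powr (- r / 3)"
        unfolding vscale_powr[OF zh] by (simp only:)
      also have "\<dots> = v z powr r * (1 + u) powr (- r / 3)"
        using t z p by (simp add: powr_mult vscale_powr u_def)
      finally have "v (z + h) powr r - v z powr r * (1 - 2 / 3 * r * h * t * v z ^ 3)
        = v z powr r * ((1 + u) powr (- r / 3) - (\<Sum>m<2. (- r / 3 gchoose m) * u ^ m))"
        by (simp add: eval_nat_numeral u algebra_simps)
      also have "norm \<dots> = v z powr r * \<bar>(1 + u) powr (- r / 3) - (\<Sum>m<2. (- r / 3 gchoose m) * u ^ m)\<bar>"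
        by (simp add: abs_mult)
      also have "\<dots> \<le> v z powr r * (K * \<bar>u\<bar> ^ 2)"
        using K(2)[of u] z(2) by (intro mult_left_mono) (auto simp: u_def)
      also have "\<dots> = K * (2 * h * t)\<^sup>2 * norm (v z ^ 6 * v z powr r)"
        using vscale_pos[OF z(1)] by (simp add: u power_mult_distrib flip: power_mult)
      finally show ?case .
    qed
  qed
qed

end

context approximants
begin

lemma x_approx_difference:
  "(\<lambda>z. X (z + 1/2) - X (z - 1/2) - 2 / 3 * v z ^ 2 * poly (euler_poly 1 (x_poly t \<alpha>)) (v z / 9)) \<in> O[at_top](\<lambda>z. v z ^ 8)"
proof -
  have "(\<lambda>z. 1 / t * (laurent 1 (x_poly t \<alpha>) (z + 1/2) - laurent 1 (x_poly t \<alpha>) (z - 1/2)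
      - 2 / 3 * t * v z ^ 3 * laurent 1 (euler_poly 1 (x_poly t \<alpha>)) z)) \<in> O[at_top](\<lambda>z. v z ^ 9 / v z ^ 1)"
    by (intro bigo_cmult laurent_odd_difference)
  also have "(\<lambda>z. v z ^ 9 / v z ^ 1) \<in> \<Theta>[at_top](\<lambda>z. v z ^ 8)"
    using vscale_eventually_pos
    by (intro bigthetaI_cong) (auto elim!: eventually_mono simp: eval_nat_numeral)
  finally show ?thesis
  proof (rule landau_o.big.in_cong[THEN iffD1, rotated])
    show "\<forall>\<^sub>F z in at_top. 1 / t * (laurent 1 (x_poly t \<alpha>) (z + 1/2) - laurent 1 (x_poly t \<alpha>) (z - 1/2)
        - 2 / 3 * t * v z ^ 3 * laurent 1 (euler_poly 1 (x_poly t \<alpha>)) z)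
      = X (z + 1/2) - X (z - 1/2) - 2 / 3 * v z ^ 2 * poly (euler_poly 1 (x_poly t \<alpha>)) (v z / 9)"
      using vscale_eventually_pos
    proof eventually_elim
      case (elim z)
      have "1 / t * (2 / 3 * t * v z ^ 3 * (y / v z ^ 1)) = 2 / 3 * v z ^ 2 * y" for y
        using elim t by (simp add: eval_nat_numeral)
      thus ?case unfolding x_approx_laurent right_diff_distrib by (simp only:) (simp add: mult.commute)
    qed
  qed
qed

text \<open>The second-difference part of \<open>central_sum_poly\<close> has relative order v^6 and
  can be put into the error, since the sum itself is of order v^-1.\<close>

lemma x_approx_sum:
  "(\<lambda>z. X (z + 1/2) + X (z - 1/2) - 2 / (t * v z) * poly (x_poly t \<alpha>) (v z / 9)) \<in> O[at_top](\<lambda>z. v z ^ 5)"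
proof -
  let ?C = "central_sum_poly t (real 1) (x_poly t \<alpha>)"
  obtain Q where Q: "?C = smult 2 (x_poly t \<alpha>) + monom (59049 * t\<^sup>2) 6 * Q"
    unfolding central_sum_poly_def by blast
  have "(\<lambda>z. 1 / t * (laurent 1 (x_poly t \<alpha>) (z + 1/2) + laurent 1 (x_poly t \<alpha>) (z - 1/2) - laurent 1 ?C z)) \<in> O[at_top](\<lambda>z. v z ^ 12 / v z ^ 1)"
    by (intro bigo_cmult laurent_central_sum)
  also have "(\<lambda>z. v z ^ 12 / v z ^ 1) \<in> O[at_top](\<lambda>z. v z ^ 5 * v z ^ 6)"
    using vscale_eventually_pos
    by (intro bigoI[of _ 1]) (auto elim!: eventually_mono simp: eval_nat_numeral)
  also have "(\<lambda>z. v z ^ 5 * v z ^ 6) \<in> O[at_top](\<lambda>z. v z ^ 5 * 1)"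
    by (intro landau_o.big.mult vscale_bigo_1) auto
  finally have 1: "(\<lambda>z. 1 / t * (laurent 1 (x_poly t \<alpha>) (z + 1/2) + laurent 1 (x_poly t \<alpha>) (z - 1/2) - laurent 1 ?C z)) \<in> O[at_top](\<lambda>z. v z ^ 5 * 1)" .
  have 2: "(\<lambda>z. t / 9 * (v z ^ 5 * poly Q (v z / 9))) \<in> O[at_top](\<lambda>z. v z ^ 5 * 1)"
    by (intro bigo_cmult landau_o.big.mult poly_vscale_bigo_1) auto
  have "(\<lambda>z. 1 / t * (laurent 1 (x_poly t \<alpha>) (z + 1/2) + laurent 1 (x_poly t \<alpha>) (z - 1/2) - laurent 1 ?C z)
      + t / 9 * (v z ^ 5 * poly Q (v z / 9))) \<in> O[at_top](\<lambda>z. v z ^ 5 * 1)"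
    by (intro sum_in_bigo 1 2)
  hence "(\<lambda>z. 1 / t * (laurent 1 (x_poly t \<alpha>) (z + 1/2) + laurent 1 (x_poly t \<alpha>) (z - 1/2) - laurent 1 ?C z)
      + t / 9 * (v z ^ 5 * poly Q (v z / 9))) \<in> O[at_top](\<lambda>z. v z ^ 5)" by (simp only: mult_1_right)
  thus ?thesis
  proof (rule landau_o.big.in_cong[THEN iffD1, rotated])
    show "\<forall>\<^sub>F z in at_top. 1 / t * (laurent 1 (x_poly t \<alpha>) (z + 1/2) + laurent 1 (x_poly t \<alpha>) (z - 1/2) - laurent 1 ?C z)
      + t / 9 * (v z ^ 5 * poly Q (v z / 9)) = X (z + 1/2) + X (z - 1/2) - 2 / (t * v z) * poly (x_poly t \<alpha>) (v z / 9)"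
      using vscale_eventually_pos
    proof eventually_elim
      case (elim z)
      have "poly ?C (v z / 9) = 2 * poly (x_poly t \<alpha>) (v z / 9) + t\<^sup>2 * v z ^ 6 / 9 * poly Q (v z / 9)"
        unfolding Q by (simp add: poly_monom power_divide)
      moreover have "1 / t * (a + b - (2 * p + t\<^sup>2 * v z ^ 6 / 9 * q) / v z ^ 1) + t / 9 * (v z ^ 5 * q)
          = a / t + b / t - 2 / (t * v z) * p" for a b p q
        using elim t by (simp add: field_simps eval_nat_numeral)
      ultimately show ?case unfolding x_approx_laurent by (simp only:)
    qed
  qed
qed

end

section \<open>A calculus of orders along a null sequence\<close>

locale null_scale =
  fixes u :: "nat \<Rightarrow> real"
  assumes u_pos: "\<And>n. u n > 0" and u_lim: "u \<longlonglongrightarrow> 0"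
begin

text \<open>Integer exponents let growing and decaying sequences share one product rule, so errors
  can be tracked by adding orders.\<close>

definition ord :: "int \<Rightarrow> (nat \<Rightarrow> real) \<Rightarrow> bool" where
  "ord k f \<longleftrightarrow> f \<in> O(\<lambda>n. u n powi k)"

lemma u_nz: "u n \<noteq> 0"
  using u_pos[of n] by simp

lemma ord_add: "ord k f \<Longrightarrow> ord k g \<Longrightarrow> ord k (\<lambda>n. f n + g n)"
  unfolding ord_def by (rule sum_in_bigo)

lemma ord_diff: "ord k f \<Longrightarrow> ord k g \<Longrightarrow> ord k (\<lambda>n. f n - g n)"
  unfolding ord_def by (rule sum_in_bigo)

lemma ord_cong:
  assumes "ord k f" "\<And>n. f n = g n"
  shows "ord k g"
proof -
  have "f = g" using assms(2) by (rule ext)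
  thus ?thesis using assms(1) by simp
qed

lemma ord_cmult: "ord k f \<Longrightarrow> ord k (\<lambda>n. c * f n)"
  unfolding ord_def by (rule bigo_cmult)

lemma ord_mult: "ord j f \<Longrightarrow> ord k g \<Longrightarrow> ord (j + k) (\<lambda>n. f n * g n)"
  unfolding ord_def power_int_add[OF disjI1[OF u_nz]] by (rule landau_o.big.mult)

lemma ord_tendsto: "f \<longlonglongrightarrow> c \<Longrightarrow> ord 0 f"
  unfolding ord_def by (rule bigoI_tendsto[of _ _ c]) auto

lemma ord_const: "ord 0 (\<lambda>_. c)"
  by (rule ord_tendsto[OF tendsto_const])

lemma ord_power: "ord (int k) (\<lambda>n. u n ^ k)"
  unfolding ord_def by (simp add: power_int_of_nat)

lemma ord_inverse_power: "ord (- int k) (\<lambda>n. 1 / u n ^ k)"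
  unfolding ord_def by (simp add: power_int_minus power_int_of_nat divide_inverse)

lemma ord_mono:
  assumes "ord j f" "k \<le> j"
  shows "ord k f"
proof -
  have "(\<lambda>n. u n ^ nat (j - k)) \<longlonglongrightarrow> 0 ^ nat (j - k)" by (intro tendsto_intros u_lim)
  hence "ord 0 (\<lambda>n. u n ^ nat (j - k))" by (rule ord_tendsto)
  hence "ord (0 + k) (\<lambda>n. u n ^ nat (j - k) * u n powi k)"
    by (rule ord_mult) (simp add: ord_def)
  moreover have "u n ^ nat (j - k) * u n powi k = u n powi j" for n
    using assms(2) u_nz[of n] by (simp flip: power_int_of_nat power_int_add)
  ultimately have "(\<lambda>n. u n powi j) \<in> O(\<lambda>n. u n powi k)" by (simp add: ord_def)
  thus ?thesis using assms(1) unfolding ord_def by (rule landau_o.big_trans[rotated])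
qed

lemma ord_poly: "ord 0 (\<lambda>n. poly p (u n / 9))"
proof (rule ord_tendsto)
  have "(\<lambda>n. u n / 9) \<longlonglongrightarrow> 0 / 9" by (rule tendsto_divide[OF u_lim tendsto_const]) simp
  thus "(\<lambda>n. poly p (u n / 9)) \<longlonglongrightarrow> poly p (0 / 9)" by (rule isCont_tendsto_compose[OF poly_isCont])
qed

lemma ord_leading:
  assumes "(\<lambda>n. f n * u n powi k) \<longlonglongrightarrow> c" "c \<noteq> 0"
  shows "ord (- k) f" "ord k (\<lambda>n. 1 / f n)"
proof -
  show "ord (- k) f" unfolding ord_def
    by (rule bigoI_tendsto[of _ _ c]) (use assms u_nz in \<open>simp_all add: power_int_minus field_simps\<close>)
  have "(\<lambda>n. 1 / (f n * u n powi k)) \<longlonglongrightarrow> 1 / c" by (intro tendsto_intros assms)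
  thus "ord k (\<lambda>n. 1 / f n)" unfolding ord_def
    by (intro bigoI_tendsto[of _ _ "1 / c"]) (use u_nz in simp_all)
qed

text \<open>g - f is at most e f, and f in turn at most g (1 + e). Both signs of the error are thus
  bounded by e (1 + e) g, without a separate lower bound on f.\<close>

lemma ord_close:
  assumes "\<forall>\<^sub>F n in sequentially. g n > 0 \<and> f n \<le> g n * (1 + e n) \<and> g n \<le> f n * (1 + e n)"
    and "\<And>n. e n \<ge> 0" "ord j e" "j \<ge> 0" "ord k g"
  shows "ord (j + k) (\<lambda>n. f n - g n)"
proof -
  have "ord 0 (\<lambda>n. 1 + e n)" by (intro ord_add ord_const ord_mono[OF assms(3,4)])
  hence "ord (j + 0 + k) (\<lambda>n. e n * (1 + e n) * g n)" by (intro ord_mult assms)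
  moreover have "(\<lambda>n. f n - g n) \<in> O(\<lambda>n. e n * (1 + e n) * g n)"
  proof (rule bigoI[of _ 1])
    show "\<forall>\<^sub>F n in sequentially. norm (f n - g n) \<le> 1 * norm (e n * (1 + e n) * g n)"
      using assms(1)
    proof eventually_elim
      case (elim n)
      have "f n - g n \<le> e n * g n" using elim by (simp add: algebra_simps)
      also have "\<dots> \<le> e n * (1 + e n) * g n"
        using elim assms(2)[of n] by (intro mult_right_mono) (auto simp: distrib_left)
      finally have 1: "f n - g n \<le> e n * (1 + e n) * g n" .
      have "g n - f n \<le> e n * f n" using elim by (simp add: algebra_simps)
      also have "\<dots> \<le> e n * (g n * (1 + e n))" using elim assms(2)[of n] by (intro mult_left_mono) auto
      finally have 2: "g n - f n \<le> e n * (1 + e n) * g n" by (simp add: mult_ac)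
      have "e n * (1 + e n) * g n \<ge> 0" using elim assms(2)[of n] by simp
      thus ?case using 1 2 by simp
    qed
  qed
  ultimately show ?thesis unfolding ord_def by (auto intro: landau_o.big_trans)
qed

end

lemma (in scaling) null_scale_vscale:
  assumes "\<And>n. real n + c > 0"
  shows "null_scale (\<lambda>n. v (real n + c))"
proof
  show "v (real n + c) > 0" for n by (rule vscale_pos[OF assms])
  have "filterlim (\<lambda>n. real n + c) at_top sequentially" by real_asymp
  thus "(\<lambda>n. v (real n + c)) \<longlonglongrightarrow> 0"
    by (rule filterlim_compose[OF vscale_tendsto_0])
qed

lemma (in null_scale) ord_1_tendsto_0:
  assumes "ord 1 f"
  shows "f \<longlonglongrightarrow> 0"
proof -
  obtain c where c: "\<forall>\<^sub>F n in sequentially. norm (f n) \<le> c * norm (u n powi 1)"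
    using assms unfolding ord_def by (elim landau_o.bigE)
  have "(\<lambda>n. c * norm (u n powi 1)) \<longlonglongrightarrow> c * norm (0 :: real)"
    unfolding power_int_1_right by (intro tendsto_intros u_lim)
  thus ?thesis using Lim_null_comparison[OF c] by simp
qed

context approximants
begin

lemma ord_compose:
  assumes "\<And>n. real n + c > 0" "f \<in> O[at_top](\<lambda>z. v z powi k)"
  shows "null_scale.ord (\<lambda>n. v (real n + c)) k (\<lambda>n. f (real n + c))"
proof -
  interpret null_scale "\<lambda>n. v (real n + c)" by (rule null_scale_vscale[OF assms(1)])
  have "filterlim (\<lambda>n. real n + c) at_top sequentially" by real_asymp
  thus ?thesis unfolding ord_def by (rule landau_o.big.compose[OF assms(2)])
qed

lemma bigo_powi: "f \<in> O[at_top](\<lambda>z. v z ^ k) \<Longrightarrow> f \<in> O[at_top](\<lambda>z. v z powi int k)"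
  by (simp add: power_int_of_nat)

lemma reciprocal_x_approx_expansion:
  "(\<lambda>z. 1 / X z - t * v z * poly (a_poly t \<alpha>) (v z / 9)) \<in> O[at_top](\<lambda>z. v z ^ 7)"
proof -
  let ?p = "\<lambda>z. poly (x_poly t \<alpha>) (v z / 9)"
  obtain G where G: "x_poly t \<alpha> * a_poly t \<alpha> - 1 = monom 1 6 * G" using a_poly_dvd by blast
  have p: "(?p \<longlongrightarrow> 1) at_top" using poly_vscale_tendsto[of "x_poly t \<alpha>"] by (simp only: poly_x_poly_0)
  have p0: "\<forall>\<^sub>F z in at_top. ?p z > 0" using order_tendstoD(1)[OF p, of 0] by simp
  have "(\<lambda>z. poly G (v z / 9) / ?p z) \<in> O[at_top](\<lambda>_. 1)"
  proof (rule bigoI_tendsto)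
    show "((\<lambda>z. poly G (v z / 9) / ?p z / 1) \<longlongrightarrow> poly G 0 / 1 / 1) at_top"
      by (intro tendsto_intros poly_vscale_tendsto p) auto
  qed auto
  hence "(\<lambda>z. v z ^ 7 * (poly G (v z / 9) / ?p z)) \<in> O[at_top](\<lambda>z. v z ^ 7 * 1)"
    by (intro landau_o.big.mult) auto
  hence "(\<lambda>z. - t / 9 ^ 6 * (v z ^ 7 * (poly G (v z / 9) / ?p z))) \<in> O[at_top](\<lambda>z. v z ^ 7)"
    unfolding mult_1_right by (rule bigo_cmult)
  thus ?thesis
  proof (rule landau_o.big.in_cong[THEN iffD1, rotated])
    show "\<forall>\<^sub>F z in at_top. - t / 9 ^ 6 * (v z ^ 7 * (poly G (v z / 9) / ?p z)) = 1 / X z - t * v z * poly (a_poly t \<alpha>) (v z / 9)"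
      using vscale_eventually_pos p0
    proof eventually_elim
      case (elim z)
      have "poly (x_poly t \<alpha> * a_poly t \<alpha> - 1) (v z / 9) = (v z / 9) ^ 6 * poly G (v z / 9)"
        unfolding G by (simp add: poly_monom)
      hence "?p z * poly (a_poly t \<alpha>) (v z / 9) = 1 + (v z / 9) ^ 6 * poly G (v z / 9)" by simp
      hence "poly (a_poly t \<alpha>) (v z / 9) = (1 + (v z / 9) ^ 6 * poly G (v z / 9)) / ?p z"
        using elim by (simp add: field_simps)
      thus ?case using elim t by (simp add: x_approx_def field_simps power_divide eval_nat_numeral)
    qed
  qed
qed

end

lemma bigo_Suc_iff:
  fixes f g :: "nat \<Rightarrow> real"
  assumes "(\<lambda>n. f (Suc n)) \<in> O(\<lambda>n. g (Suc n))"
  shows "f \<in> O(g)"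
proof -
  obtain c where "\<forall>\<^sub>F n in sequentially. norm (f (Suc n)) \<le> c * norm (g (Suc n))"
    using assms by (elim landau_o.bigE)
  hence "\<forall>\<^sub>F n in sequentially. norm (f n) \<le> c * norm (g n)"
    by (rule eventually_sequentially_Suc[THEN iffD1])
  thus ?thesis by (rule bigoI)
qed

context approximants
begin

lemma vscale_shift_ord:
  assumes c: "\<And>n. real n + 1 + h > 0"
  shows "null_scale.ord (\<lambda>n. v (real n + 1)) (k + 6)
     (\<lambda>n. v (real n + 1 + h) powi k - v (real n + 1) powi k * (1 - 2 / 3 * of_int k * h * t * v (real n + 1) ^ 3))"
proof -
  have pw: "v z powr of_int k = v z powi k" if "z > 0" for z
    using vscale_pos[OF that] by (intro powr_real_of_int') auto
  have "(\<lambda>z. v (z + h) powi k - v z powi k * (1 - 2 / 3 * of_int k * h * t * v z ^ 3)) \<in> O[at_top](\<lambda>z. v z powi (k + 6))"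
    using vscale_shift_expansion[of h "of_int k"]
  proof (rule landau_o.big.cong_ex[THEN iffD1, rotated -1])
    show "\<forall>\<^sub>F z in at_top. v (z + h) powr of_int k - v z powr of_int k * (1 - 2 / 3 * of_int k * h * t * v z ^ 3)
      = v (z + h) powi k - v z powi k * (1 - 2 / 3 * of_int k * h * t * v z ^ 3)"
      using eventually_gt_at_top[of "\<bar>h\<bar>"]
    proof eventually_elim
      case (elim z)
      hence "z > 0" "z + h > 0" by linarith+
      thus ?case by (simp only: pw)
    qed
    show "\<forall>\<^sub>F z in at_top. v z ^ 6 * v z powr of_int k = v z powi (k + 6)"
      using eventually_gt_at_top[of 0]
    proof eventually_elim
      case (elim z)
      thus ?case using vscale_pos[OF elim] by (simp add: pw power_int_add)
    qed
  qed
  thus ?thesis by (intro ord_compose[where c = 1]) auto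
qed

section \<open>Recentring from n + 1 + h to n + 1\<close>

context
  fixes h :: real assumes h: "\<And>n. real n + (1 + h) > 0"
begin

interpretation U: null_scale "\<lambda>n. v (real n + 1)" by (rule null_scale_vscale) auto
interpretation W: null_scale "\<lambda>n. v (real n + (1 + h))" by (rule null_scale_vscale) (rule h)

abbreviation "U \<equiv> \<lambda>n. v (real n + 1)"
abbreviation "W \<equiv> \<lambda>n. v (real n + (1 + h))"

lemma shift_powi: "U.ord (k + 6) (\<lambda>n. W n powi k - U n powi k * (1 - 2 / 3 * of_int k * h * t * U n ^ 3))"
proof -
  have "real n + 1 + h > 0" for n using h[of n] by (simp only: add.assoc)
  from vscale_shift_ord[OF this, of k] show ?thesis by (simp only: add.assoc)
qed

lemma shift_power: "U.ord (int k + 6) (\<lambda>n. W n ^ k - U n ^ k * (1 - 2 / 3 * real k * h * t * U n ^ 3))"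
  using shift_powi[of "int k"] by (simp add: power_int_of_nat)

lemma shift_inverse_power: "U.ord (6 - int k) (\<lambda>n. 1 / W n ^ k - 1 / U n ^ k * (1 + 2 / 3 * real k * h * t * U n ^ 3))"
proof -
  have 1: "y powi (- int k) = 1 / y ^ k" for y :: real
    by (simp add: power_int_minus power_int_of_nat divide_inverse)
  have 2: "1 - 2 / 3 * of_int (- int k) * h * t * y = 1 + 2 / 3 * real k * h * t * y" for y by simp
  have 3: "- int k + 6 = 6 - int k" by simp
  show ?thesis using shift_powi[of "- int k"] unfolding 1 2 3 .
qed

lemma shift_power_leading: "U.ord (int k + 3) (\<lambda>n. W n ^ k - U n ^ k)"
proof -
  have "U.ord (int k + int 3) (\<lambda>n. - 2 / 3 * real k * h * t * (U n ^ k * U n ^ 3))"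
    by (rule U.ord_cmult[OF U.ord_mult[OF U.ord_power U.ord_power]])
  hence "U.ord (int k + 3) (\<lambda>n. (W n ^ k - U n ^ k * (1 - 2 / 3 * real k * h * t * U n ^ 3)) + - 2 / 3 * real k * h * t * (U n ^ k * U n ^ 3))"
    using U.ord_mono[OF shift_power[of k], of "int k + 3"] by (intro U.ord_add) auto
  thus ?thesis by (simp add: algebra_simps)
qed

text \<open>By \<open>shift_powi\<close> powers of the shifted scale are bounded by the same powers
  of the unshifted one, so orders carry over.\<close>

lemma ord_shift: "W.ord k f \<Longrightarrow> U.ord k f"
proof -
  have "U.ord 0 (\<lambda>n. 1 - 2 / 3 * of_int k * h * t * U n ^ 3)"
    by (rule U.ord_diff[OF U.ord_const U.ord_cmult[OF U.ord_mono[OF U.ord_power[of 3]]]]) simp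
  moreover have "U.ord k (\<lambda>n. U n powi k)" by (simp add: U.ord_def)
  ultimately have "U.ord (k + 0) (\<lambda>n. U n powi k * (1 - 2 / 3 * of_int k * h * t * U n ^ 3))"
    by (rule U.ord_mult[rotated])
  hence "U.ord k (\<lambda>n. (W n powi k - U n powi k * (1 - 2 / 3 * of_int k * h * t * U n ^ 3))
      + U n powi k * (1 - 2 / 3 * of_int k * h * t * U n ^ 3))"
    using U.ord_mono[OF shift_powi[of k], of k] by (intro U.ord_add) auto
  hence "(\<lambda>n. W n powi k) \<in> O(\<lambda>n. U n powi k)" by (simp add: U.ord_def)
  thus "W.ord k f \<Longrightarrow> U.ord k f" unfolding U.ord_def W.ord_def by (rule landau_o.big_trans[rotated])
qed

end

end

section \<open>Expansions of 1 / x and of the product that gives b\<close>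

context positive_solution
begin

interpretation approximants t \<alpha> by unfold_locales (rule t)

lemma node_pos: "real n + (1 + (1 + \<alpha>) / 2) > 0" and mid_pos: "real n + (1 + \<alpha> / 2) > 0"
  using \<alpha> by (auto simp: field_simps)

text \<open>The expansion is natural at \<open>node (Suc n)\<close>, which exceeds n + 1 by h = (1 +
  \<alpha>) / 2. Recentring raises the order by 3, so only the powers 1 and 2 of v produce
  corrections below order 7; these are the terms linear in t with a factor \<alpha> + 1.\<close>

lemma a_expansion:
  "null_scale.ord (\<lambda>n. v (real n + 1)) 7 (\<lambda>n. 1 / x (Suc n)
     - t * (v (real n + 1) - \<alpha> / 3 * v (real n + 1) ^ 2 + (\<alpha> + 1) * (\<alpha> * (\<alpha> - 1) - 27 * t) / 81 * v (real n + 1) ^ 4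
       + (\<alpha>^2 * (\<alpha>^2 - 1) + 54 * \<alpha> * (\<alpha> + 1) * t - 81 * t^2) / 243 * v (real n + 1) ^ 5
       + \<alpha> * (\<alpha>^2 + 81 * t^2 - 1) / 243 * v (real n + 1) ^ 6))"
proof -
  define h where "h = (1 + \<alpha>) / 2"
  have h: "real n + (1 + h) > 0" for n using node_pos by (simp add: h_def)
  interpret U: null_scale "\<lambda>n. v (real n + 1)" by (rule null_scale_vscale) auto
  interpret W: null_scale "\<lambda>n. v (real n + (1 + h))" by (rule null_scale_vscale) (rule h)
  define u w where "u n = v (real n + 1)" and "w n = v (real n + (1 + h))" for n
  define z where "z n = real n + (1 + h)" for n
  have node: "node (Suc n) = z n" for n by (simp add: z_def h_def)
  obtain A n0 where A: "A > 0" "\<And>n. n \<ge> n0 \<Longrightarrow> X (node n) > 0 \<and> S (mid n) > 0 \<and>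
     x n \<le> X (node n) * (1 + A * v (node n) ^ 7) \<and> X (node n) \<le> x n * (1 + A * v (node n) ^ 7) \<and>
     s n \<le> S (mid n) * (1 + 2 * A * v (mid n) ^ 7) \<and> S (mid n) \<le> s n * (1 + 2 * A * v (mid n) ^ 7)"
    using approximation by metis
  have zlim: "filterlim z at_top sequentially" unfolding z_def by real_asymp
  have "(\<lambda>n. X (z n) * (t * v (z n))) \<longlonglongrightarrow> 1"
    using filterlim_compose[OF x_approx_tendsto zlim] .
  hence "(\<lambda>n. X (z n) * (t * v (z n)) / t) \<longlonglongrightarrow> 1 / t" using t by (intro tendsto_divide tendsto_const) auto
  hence "(\<lambda>n. X (z n) * v (real n + (1 + h)) powi 1) \<longlonglongrightarrow> 1 / t" using t by (simp add: z_def)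
  hence X1: "W.ord 1 (\<lambda>n. 1 / X (z n))" by (rule W.ord_leading) (use t in simp)
  have 1: "W.ord (7 + 1) (\<lambda>n. 1 / x (Suc n) - 1 / X (z n))"
  proof (rule W.ord_close[OF _ _ _ _ X1])
    show "\<forall>\<^sub>F n in sequentially. 1 / X (z n) > 0 \<and> 1 / x (Suc n) \<le> 1 / X (z n) * (1 + A * w n ^ 7) \<and> 1 / X (z n) \<le> 1 / x (Suc n) * (1 + A * w n ^ 7)"
      using eventually_ge_at_top[of n0]
    proof eventually_elim
      case (elim n)
      thus ?case using A(2)[of "Suc n", unfolded node] x_pos[of "Suc n"]
        by (auto simp: w_def z_def field_simps)
    qed
    show "A * w n ^ 7 \<ge> 0" for n using A(1) W.u_pos[of n] by (simp add: w_def)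
    show "W.ord 7 (\<lambda>n. A * w n ^ 7)"
      using W.ord_cmult[OF W.ord_power[of 7]] by (simp add: w_def)
  qed simp
  have 2: "W.ord 7 (\<lambda>n. 1 / X (z n) - t * w n * poly (a_poly t \<alpha>) (w n / 9))"
    unfolding z_def w_def
    using ord_compose[OF h bigo_powi[OF reciprocal_x_approx_expansion]] by simp
  note sh = shift_power[OF h] and shl = shift_power_leading[OF h]
  have p: "U.ord 7 (\<lambda>n. w n ^ 1 - u n ^ 1 * (1 - 2 / 3 * real 1 * h * t * u n ^ 3))"
    "U.ord 7 (\<lambda>n. w n ^ 2 - u n ^ 2 * (1 - 2 / 3 * real 2 * h * t * u n ^ 3))"
    "U.ord 7 (\<lambda>n. w n ^ 4 - u n ^ 4)" "U.ord 7 (\<lambda>n. w n ^ 5 - u n ^ 5)" "U.ord 7 (\<lambda>n. w n ^ 6 - u n ^ 6)"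
    unfolding u_def w_def
    by (rule U.ord_mono[OF sh], simp, rule U.ord_mono[OF sh], simp,
        rule U.ord_mono[OF shl], simp, rule U.ord_mono[OF shl], simp, rule U.ord_mono[OF shl], simp)
  define c4 c5 c6 where "c4 = (\<alpha>^3 - \<alpha>) / 81" and "c5 = (\<alpha>^4 - \<alpha>^2 - 81 * t^2) / 243" and "c6 = (\<alpha>^3 + 81 * \<alpha> * t^2 - \<alpha>) / 243"
  have main: "U.ord 7 (\<lambda>n. (1 / x (Suc n) - 1 / X (z n)) + (1 / X (z n) - t * w n * poly (a_poly t \<alpha>) (w n / 9))
     + t * (((((w n ^ 1 - u n ^ 1 * (1 - 2 / 3 * real 1 * h * t * u n ^ 3))
        + - \<alpha> / 3 * (w n ^ 2 - u n ^ 2 * (1 - 2 / 3 * real 2 * h * t * u n ^ 3)))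
        + c4 * (w n ^ 4 - u n ^ 4)) + c5 * (w n ^ 5 - u n ^ 5)) + c6 * (w n ^ 6 - u n ^ 6)))"
  proof (rule U.ord_add[OF U.ord_add U.ord_cmult])
    show "U.ord 7 (\<lambda>n. 1 / x (Suc n) - 1 / X (z n))"
      using ord_shift[OF h W.ord_mono[OF 1, of 7]] by simp
    show "U.ord 7 (\<lambda>n. 1 / X (z n) - t * w n * poly (a_poly t \<alpha>) (w n / 9))"
      by (rule ord_shift[OF h 2])
  qed (rule U.ord_add U.ord_cmult p)+
  have *: "t * W * poly (a_poly t \<alpha>) (W / 9) = t * (W - \<alpha> / 3 * W ^ 2 + c4 * W ^ 4 + c5 * W ^ 5 + c6 * W ^ 6)" for W
    unfolding c4_def c5_def c6_def a_poly_def by (simp add: field_simps eval_nat_numeral)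
  show ?thesis
    by (rule U.ord_cong[OF main])
       (unfold u_def[symmetric] * h_def c4_def c5_def c6_def, simp add: field_simps eval_nat_numeral)
qed

end

context positive_solution
begin

interpretation approximants t \<alpha> by unfold_locales (rule t)

context
begin

private abbreviation (input) "z \<equiv> \<lambda>n::nat. real n + (1 + \<alpha> / 2)"
private abbreviation (input) "w \<equiv> \<lambda>n::nat. v (real n + (1 + \<alpha> / 2))"
private abbreviation (input) "T \<equiv> t / 2"

interpretation W: null_scale w by (rule null_scale_vscale) (rule mid_pos)

private lemma w_pos: "w n > 0"
  by (rule W.u_pos)

private lemma node_z: "node n = z n - 1/2" "node (Suc n) = z n + 1/2" "mid n = z n"
  by (simp_all add: field_simps)

private lemma z_lim: "filterlim z at_top sequentially"
  by real_asymp

private lemma z_w: "2 * z n = 1 / (t * w n ^ 3)"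
  unfolding vscale_cube[OF mid_pos] by simp

private lemma S_scale: "W.ord (-2) (\<lambda>n. S (z n))" "W.ord 2 (\<lambda>n. 1 / S (z n))"
proof -
  have "(\<lambda>n. S (z n) * (2 * w n ^ 2) / 2) \<longlonglongrightarrow> 1 / 2"
    using filterlim_compose[OF s_approx_tendsto z_lim] by (rule tendsto_divide[OF _ tendsto_const]) simp
  hence "(\<lambda>n. S (z n) * w n powi 2) \<longlonglongrightarrow> 1 / 2" by (simp add: power_int_numeral)
  from W.ord_leading[OF this] show "W.ord (-2) (\<lambda>n. S (z n))" "W.ord 2 (\<lambda>n. 1 / S (z n))" by auto
qed

text \<open>Expresses all error factors through the scale at the midpoint. At the neighbours v is at
  most twice as large, hence 128 = 2^7.\<close>

private lemma approx_eventually: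
  obtains A where "A > 0" "\<forall>\<^sub>F n in sequentially. X (z n - 1/2) > 0 \<and> X (z n + 1/2) > 0 \<and> S (z n) > 0 \<and>
     x n \<le> X (z n - 1/2) * (1 + A * w n ^ 7) \<and> X (z n - 1/2) \<le> x n * (1 + A * w n ^ 7) \<and>
     x (Suc n) \<le> X (z n + 1/2) * (1 + A * w n ^ 7) \<and> X (z n + 1/2) \<le> x (Suc n) * (1 + A * w n ^ 7) \<and>
     s n \<le> S (z n) * (1 + A * w n ^ 7) \<and> S (z n) \<le> s n * (1 + A * w n ^ 7)"
proof -
  obtain A n0 where A: "A > 0" "\<And>n. n \<ge> n0 \<Longrightarrow> X (node n) > 0 \<and> S (mid n) > 0 \<and>
     x n \<le> X (node n) * (1 + A * v (node n) ^ 7) \<and> X (node n) \<le> x n * (1 + A * v (node n) ^ 7) \<and>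
     s n \<le> S (mid n) * (1 + 2 * A * v (mid n) ^ 7) \<and> S (mid n) \<le> s n * (1 + 2 * A * v (mid n) ^ 7)"
    using approximation by metis
  have mono: "y \<le> c * (1 + 128 * A * w n ^ 7)" if "y \<le> c * (1 + k * r ^ 7)" "c > 0" "0 \<le> k" "k * r ^ 7 \<le> 128 * A * w n ^ 7" for y c k r n
  proof -
    have "c * (1 + k * r ^ 7) \<le> c * (1 + 128 * A * w n ^ 7)" using that by (intro mult_left_mono) auto
    thus ?thesis using that(1) by linarith
  qed
  have "\<forall>\<^sub>F n in sequentially. v (z n + 1/2) \<le> 2 * w n \<and> w n / 2 \<le> v (z n + 1/2) \<and> v (z n - 1/2) \<le> 2 * w n \<and> w n / 2 \<le> v (z n - 1/2)"
    using eventually_compose_filterlim[OF vscale_shift_eventually z_lim] by simp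
  hence "\<forall>\<^sub>F n in sequentially. X (z n - 1/2) > 0 \<and> X (z n + 1/2) > 0 \<and> S (z n) > 0 \<and>
     x n \<le> X (z n - 1/2) * (1 + 128 * A * w n ^ 7) \<and> X (z n - 1/2) \<le> x n * (1 + 128 * A * w n ^ 7) \<and>
     x (Suc n) \<le> X (z n + 1/2) * (1 + 128 * A * w n ^ 7) \<and> X (z n + 1/2) \<le> x (Suc n) * (1 + 128 * A * w n ^ 7) \<and>
     s n \<le> S (z n) * (1 + 128 * A * w n ^ 7) \<and> S (z n) \<le> s n * (1 + 128 * A * w n ^ 7)"
    using eventually_ge_at_top[of n0]
  proof eventually_elim
    case (elim n)
    have b: "A * y ^ 7 \<le> 128 * A * w n ^ 7" if "y \<le> 2 * w n" "w n / 2 \<le> y" for y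
    proof -
      have "y ^ 7 \<le> (2 * w n) ^ 7" using that w_pos[of n] by (intro power_mono) auto
      thus ?thesis using A(1) by (simp add: power_mult_distrib)
    qed
    have b1: "A * v (z n - 1/2) ^ 7 \<le> 128 * A * w n ^ 7" "A * v (z n + 1/2) ^ 7 \<le> 128 * A * w n ^ 7"
      using elim(1) by (intro b; simp)+
    have b2: "2 * A * w n ^ 7 \<le> 128 * A * w n ^ 7" using A(1) w_pos[of n] by simp
    have a1: "X (z n - 1/2) > 0" "S (z n) > 0" "x n \<le> X (z n - 1/2) * (1 + A * v (z n - 1/2) ^ 7)"
      "X (z n - 1/2) \<le> x n * (1 + A * v (z n - 1/2) ^ 7)"
      "s n \<le> S (z n) * (1 + 2 * A * w n ^ 7)" "S (z n) \<le> s n * (1 + 2 * A * w n ^ 7)"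
      using A(2)[OF elim(2), unfolded node_z(1,3)] by blast+
    have "Suc n \<ge> n0" using elim(2) by simp
    hence a2: "X (z n + 1/2) > 0" "x (Suc n) \<le> X (z n + 1/2) * (1 + A * v (z n + 1/2) ^ 7)"
      "X (z n + 1/2) \<le> x (Suc n) * (1 + A * v (z n + 1/2) ^ 7)"
      using A(2)[of "Suc n", unfolded node_z(2)] by blast+
    have A0: "0 \<le> A" "0 \<le> 2 * A" using A(1) by simp_all
    show ?case
      by (intro conjI a1(1,2) a2(1) mono[OF a1(3) a1(1) A0(1) b1(1)] mono[OF a1(4) x_pos A0(1) b1(1)]
          mono[OF a2(2) a2(1) A0(1) b1(2)] mono[OF a2(3) x_pos A0(1) b1(2)]
          mono[OF a1(5) a1(2) A0(2) b2] mono[OF a1(6) s_pos A0(2) b2])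
  qed
  thus ?thesis using that[of "128 * A"] A(1) by simp
qed

private lemma s_ord: "W.ord 5 (\<lambda>n. s n - S (z n))" "W.ord 9 (\<lambda>n. 1 / s n - 1 / S (z n))"
  and x_ord: "W.ord (-1) (\<lambda>n. X (z n - 1/2)) \<Longrightarrow> W.ord 6 (\<lambda>n. x n - X (z n - 1/2))"
    "W.ord (-1) (\<lambda>n. X (z n + 1/2)) \<Longrightarrow> W.ord 6 (\<lambda>n. x (Suc n) - X (z n + 1/2))"
proof -
  obtain A where A: "A > 0" "\<forall>\<^sub>F n in sequentially. X (z n - 1/2) > 0 \<and> X (z n + 1/2) > 0 \<and> S (z n) > 0 \<and>
     x n \<le> X (z n - 1/2) * (1 + A * w n ^ 7) \<and> X (z n - 1/2) \<le> x n * (1 + A * w n ^ 7) \<and>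
     x (Suc n) \<le> X (z n + 1/2) * (1 + A * w n ^ 7) \<and> X (z n + 1/2) \<le> x (Suc n) * (1 + A * w n ^ 7) \<and>
     s n \<le> S (z n) * (1 + A * w n ^ 7) \<and> S (z n) \<le> s n * (1 + A * w n ^ 7)"
    by (rule approx_eventually)
  have e: "A * w n ^ 7 \<ge> 0" for n using A(1) w_pos[of n] by simp
  have e7: "W.ord 7 (\<lambda>n. A * w n ^ 7)" using W.ord_cmult[OF W.ord_power[of 7]] by simp
  have "W.ord (7 + -2) (\<lambda>n. s n - S (z n))"
    by (rule W.ord_close[OF _ e e7 _ S_scale(1)]) (use A(2) in \<open>auto elim!: eventually_mono\<close>)
  thus "W.ord 5 (\<lambda>n. s n - S (z n))" by simp
  have "W.ord (7 + 2) (\<lambda>n. 1 / s n - 1 / S (z n))"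
  proof (rule W.ord_close[OF _ e e7 _ S_scale(2)])
    show "\<forall>\<^sub>F n in sequentially. 1 / S (z n) > 0 \<and> 1 / s n \<le> 1 / S (z n) * (1 + A * w n ^ 7) \<and> 1 / S (z n) \<le> 1 / s n * (1 + A * w n ^ 7)"
      using A(2)
    proof eventually_elim
      case (elim n)
      thus ?case using s_pos[of n] by (auto simp: field_simps)
    qed
  qed simp
  thus "W.ord 9 (\<lambda>n. 1 / s n - 1 / S (z n))" by simp
  show "W.ord 6 (\<lambda>n. x n - X (z n - 1/2))" if "W.ord (-1) (\<lambda>n. X (z n - 1/2))"
  proof -
    have "W.ord (7 + -1) (\<lambda>n. x n - X (z n - 1/2))"
      by (rule W.ord_close[OF _ e e7 _ that]) (use A(2) in \<open>auto elim!: eventually_mono\<close>)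
    thus ?thesis by simp
  qed
  show "W.ord 6 (\<lambda>n. x (Suc n) - X (z n + 1/2))" if "W.ord (-1) (\<lambda>n. X (z n + 1/2))"
  proof -
    have "W.ord (7 + -1) (\<lambda>n. x (Suc n) - X (z n + 1/2))"
      by (rule W.ord_close[OF _ e e7 _ that]) (use A(2) in \<open>auto elim!: eventually_mono\<close>)
    thus ?thesis by simp
  qed
qed

private abbreviation (input) "p \<equiv> \<lambda>n. poly (x_poly t \<alpha>) (w n / 9)"
private abbreviation (input) "q \<equiv> \<lambda>n. poly (s_poly t \<alpha>) (w n / 9)"
private abbreviation (input) "g \<equiv> \<lambda>n. poly (euler_poly 1 (x_poly t \<alpha>)) (w n / 9)"

private lemma w_poly_tendsto: "(\<lambda>n. poly f (w n / 9)) \<longlonglongrightarrow> poly f 0"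
  using filterlim_compose[OF poly_vscale_tendsto z_lim] .

private lemma sum_approx: "W.ord 5 (\<lambda>n. X (z n + 1/2) + X (z n - 1/2) - 2 / (t * w n) * p n)"
  using ord_compose[OF mid_pos bigo_powi[OF x_approx_sum]] by simp

private lemma difference_approx: "W.ord 6 (\<lambda>n. X (z n + 1/2) - X (z n - 1/2) - 2 / 3 * w n ^ 2 * g n)"
  using W.ord_mono[OF ord_compose[OF mid_pos bigo_powi[OF x_approx_difference]], of 6] by simp

private lemma main_scale: "W.ord (-1) (\<lambda>n. 2 / (t * w n) * p n)" "W.ord 2 (\<lambda>n. 2 / 3 * w n ^ 2 * g n)"
  "W.ord (-5) (\<lambda>n. S (z n) / (t * w n ^ 3))"
proof -
  have "W.ord (- int 1 + 0) (\<lambda>n. 2 / t * (1 / w n ^ 1 * p n))"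
    by (rule W.ord_cmult[OF W.ord_mult[OF W.ord_inverse_power W.ord_poly]])
  thus "W.ord (-1) (\<lambda>n. 2 / (t * w n) * p n)" by simp
  have "W.ord (int 2 + 0) (\<lambda>n. 2 / 3 * (w n ^ 2 * g n))"
    by (rule W.ord_cmult[OF W.ord_mult[OF W.ord_power W.ord_poly]])
  thus "W.ord 2 (\<lambda>n. 2 / 3 * w n ^ 2 * g n)" by (simp add: mult.assoc)
  have "W.ord (-2 + - int 3) (\<lambda>n. 1 / t * (S (z n) * (1 / w n ^ 3)))"
    by (rule W.ord_cmult[OF W.ord_mult[OF S_scale(1) W.ord_inverse_power]])
  thus "W.ord (-5) (\<lambda>n. S (z n) / (t * w n ^ 3))" by simp
qed

private lemma X_scale: "W.ord (-1) (\<lambda>n. X (z n + 1/2))" "W.ord (-1) (\<lambda>n. X (z n - 1/2))"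
proof -
  have 1: "W.ord (-1) (\<lambda>n. (X (z n + 1/2) + X (z n - 1/2) - 2 / (t * w n) * p n) + 2 / (t * w n) * p n)"
    by (rule W.ord_add[OF W.ord_mono[OF sum_approx] main_scale(1)]) simp
  have 2: "W.ord (-1) (\<lambda>n. (X (z n + 1/2) - X (z n - 1/2) - 2 / 3 * w n ^ 2 * g n) + 2 / 3 * w n ^ 2 * g n)"
    by (rule W.ord_add[OF W.ord_mono[OF difference_approx] W.ord_mono[OF main_scale(2)]]) simp_all
  show "W.ord (-1) (\<lambda>n. X (z n + 1/2))"
    using W.ord_cmult[OF W.ord_add[OF 1 2], of "1/2"] by simp
  show "W.ord (-1) (\<lambda>n. X (z n - 1/2))"
    using W.ord_cmult[OF W.ord_diff[OF 1 2], of "1/2"] by simp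
qed

private lemma x_sum: "W.ord 5 (\<lambda>n. x n + x (Suc n) - 2 / (t * w n) * p n)"
proof -
  have "W.ord 5 (\<lambda>n. (x n - X (z n - 1/2)) + (x (Suc n) - X (z n + 1/2)) + (X (z n + 1/2) + X (z n - 1/2) - 2 / (t * w n) * p n))"
    by (rule W.ord_add[OF W.ord_mono[OF W.ord_add[OF x_ord(1)[OF X_scale(2)] x_ord(2)[OF X_scale(1)]]] sum_approx]) simp
  thus ?thesis by (simp add: algebra_simps)
qed

private lemma x_difference: "W.ord 6 (\<lambda>n. x (Suc n) - x n - 2 / 3 * w n ^ 2 * g n)"
proof -
  have "W.ord 6 (\<lambda>n. (x (Suc n) - X (z n + 1/2)) - (x n - X (z n - 1/2)) + (X (z n + 1/2) - X (z n - 1/2) - 2 / 3 * w n ^ 2 * g n))"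
    by (rule W.ord_add[OF W.ord_diff[OF x_ord(2)[OF X_scale(1)] x_ord(1)[OF X_scale(2)]] difference_approx])
  thus ?thesis by (simp add: algebra_simps)
qed

private abbreviation (input) "G \<equiv> \<lambda>n. (2 * real n + 2 + \<alpha>) * s n - \<alpha> * T"

private lemma G_approx: "W.ord 0 (\<lambda>n. G n - S (z n) / (t * w n ^ 3))"
proof -
  have "W.ord (5 + - int 3) (\<lambda>n. 1 / t * ((s n - S (z n)) * (1 / w n ^ 3)))"
    by (rule W.ord_cmult[OF W.ord_mult[OF s_ord(1) W.ord_inverse_power]])
  hence "W.ord 0 (\<lambda>n. 1 / t * ((s n - S (z n)) * (1 / w n ^ 3)) - \<alpha> * T)"
    by (intro W.ord_diff W.ord_const) (rule W.ord_mono, auto)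
  also have "(\<lambda>n. 1 / t * ((s n - S (z n)) * (1 / w n ^ 3)) - \<alpha> * T) = (\<lambda>n. G n - S (z n) / (t * w n ^ 3))"
  proof (rule ext)
    fix n
    have "2 * real n + 2 + \<alpha> = 1 / (t * w n ^ 3)" unfolding z_w[symmetric] by (simp add: field_simps)
    thus "1 / t * ((s n - S (z n)) * (1 / w n ^ 3)) - \<alpha> * T = G n - S (z n) / (t * w n ^ 3)"
      by (simp add: diff_divide_distrib mult.commute)
  qed
  finally show ?thesis .
qed

text \<open>The orders of \<open>G\<close>, of the squared difference and of 1 over the sum are -5,
  4 and 1, so the term is of order 0. Among the errors the difference is decisive: known up to order
  6, it gives -5 + (6 + 2) + 1 = 4.\<close>

private lemma second_part:
  "W.ord 4 (\<lambda>n. G n * (x (Suc n) - x n)\<^sup>2 / (4 * (x n + x (Suc n))) - poly (variation_poly \<alpha>) (w n / 9) / 36)"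
proof -
  define d d' m m' G' where "d n = x (Suc n) - x n" and "d' n = 2 / 3 * w n ^ 2 * g n"
    and "m n = x n + x (Suc n)" and "m' n = 2 / (t * w n) * p n" and "G' n = S (z n) / (t * w n ^ 3)" for n
  have od: "W.ord 6 (\<lambda>n. d n - d' n)" "W.ord 2 d'" and om: "W.ord 5 (\<lambda>n. m n - m' n)"
    and oG: "W.ord 0 (\<lambda>n. G n - G' n)" "W.ord (-5) G'"
    unfolding d_def d'_def m_def m'_def G'_def using x_difference main_scale x_sum G_approx by simp_all
  have m'_lim: "(\<lambda>n. m' n * w n powi 1) \<longlonglongrightarrow> 2 / t"
  proof -
    have "(\<lambda>n. 2 / t * p n) \<longlonglongrightarrow> 2 / t * 1"
      using w_poly_tendsto[of "x_poly t \<alpha>"] unfolding poly_x_poly_0 by (rule tendsto_mult[OF tendsto_const])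
    thus ?thesis using w_pos by (simp add: m'_def less_imp_neq[THEN not_sym])
  qed
  have m_lim: "(\<lambda>n. m n * w n powi 1) \<longlonglongrightarrow> 2 / t"
  proof -
    have "W.ord (5 + int 1) (\<lambda>n. (m n - m' n) * w n ^ 1)" by (rule W.ord_mult[OF om W.ord_power])
    hence "W.ord 1 (\<lambda>n. (m n - m' n) * w n ^ 1)" by (rule W.ord_mono) simp
    hence "(\<lambda>n. (m n - m' n) * w n ^ 1) \<longlonglongrightarrow> 0" by (rule W.ord_1_tendsto_0)
    from tendsto_add[OF this m'_lim] show ?thesis by (simp add: algebra_simps)
  qed
  have tn: "2 / t \<noteq> 0" using t by simp
  have om': "W.ord 1 (\<lambda>n. 1 / m' n)" "W.ord 1 (\<lambda>n. 1 / m n)"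
    using W.ord_leading(2)[OF m'_lim tn] W.ord_leading(2)[OF m_lim tn] by auto
  have od2: "W.ord 2 d"
  proof -
    have "W.ord 2 (\<lambda>n. (d n - d' n) + d' n)" by (rule W.ord_add[OF W.ord_mono[OF od(1)] od(2)]) simp
    thus ?thesis by simp
  qed
  have m_pos: "m n > 0" for n using x_pos[of n] x_pos[of "Suc n"] by (simp add: m_def)
  have p0: "\<forall>\<^sub>F n in sequentially. p n > 0"
    using order_tendstoD(1)[OF w_poly_tendsto[of "x_poly t \<alpha>", unfolded poly_x_poly_0], of 0] by simp
  have inv: "W.ord 7 (\<lambda>n. 1 / m n - 1 / m' n)"
  proof -
    have "W.ord (5 + 1 + 1) (\<lambda>n. -1 * ((m n - m' n) * (1 / m' n) * (1 / m n)))"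
      by (rule W.ord_cmult[OF W.ord_mult[OF W.ord_mult[OF om om'(1)] om'(2)]])
    hence "W.ord 7 (\<lambda>n. -1 * ((m n - m' n) * (1 / m' n) * (1 / m n)))" by simp
    thus ?thesis unfolding W.ord_def
    proof (rule landau_o.big.in_cong[THEN iffD1, rotated])
      show "\<forall>\<^sub>F n in sequentially. -1 * ((m n - m' n) * (1 / m' n) * (1 / m n)) = 1 / m n - 1 / m' n"
        using p0
      proof eventually_elim
        case (elim n)
        hence "m' n > 0" using w_pos[of n] t by (simp add: m'_def)
        thus ?case using m_pos[of n] by (simp add: field_simps)
      qed
    qed
  qed
  have sq: "W.ord (6 + 2) (\<lambda>n. (d n - d' n) * (d n + d' n))"
    by (rule W.ord_mult[OF od(1) W.ord_add[OF od2 od(2)]])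
  have 1: "W.ord 4 (\<lambda>n. (G n - G' n) * (d n * d n) * (1 / m n))"
    by (rule W.ord_mono[OF W.ord_mult[OF W.ord_mult[OF oG(1) W.ord_mult[OF od2 od2]] om'(2)]]) simp
  have 2: "W.ord 4 (\<lambda>n. G' n * ((d n - d' n) * (d n + d' n)) * (1 / m n))"
    by (rule W.ord_mono[OF W.ord_mult[OF W.ord_mult[OF oG(2) sq] om'(2)]]) simp
  have 3: "W.ord 4 (\<lambda>n. G' n * (d' n * d' n) * (1 / m n - 1 / m' n))"
    by (rule W.ord_mono[OF W.ord_mult[OF W.ord_mult[OF oG(2) W.ord_mult[OF od(2) od(2)]] inv]]) simp
  have A: "W.ord 4 (\<lambda>n. 1 / 4 * ((G n - G' n) * (d n * d n) * (1 / m n) + G' n * ((d n - d' n) * (d n + d' n)) * (1 / m n)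
      + G' n * (d' n * d' n) * (1 / m n - 1 / m' n)))"
    by (rule W.ord_cmult[OF W.ord_add[OF W.ord_add[OF 1 2] 3]])
  obtain H where H: "s_poly t \<alpha> * (euler_poly 1 (x_poly t \<alpha>) * euler_poly 1 (x_poly t \<alpha>)) - variation_poly \<alpha> * x_poly t \<alpha> = monom 1 4 * H"
    using variation_poly_dvd by blast
  have B: "W.ord 4 (\<lambda>n. 1 / (36 * 9 ^ 4) * (w n ^ 4 * (poly H (w n / 9) / p n)))"
  proof -
    have "(\<lambda>n. poly H (w n / 9) / p n) \<longlonglongrightarrow> poly H 0 / poly (x_poly t \<alpha>) 0"
      by (intro tendsto_divide w_poly_tendsto) (simp add: poly_x_poly_0)
    hence "W.ord (int 4 + 0) (\<lambda>n. 1 / (36 * 9 ^ 4) * (w n ^ 4 * (poly H (w n / 9) / p n)))"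
      by (intro W.ord_cmult W.ord_mult[OF W.ord_power] W.ord_tendsto)
    thus ?thesis by simp
  qed
  show ?thesis
    using W.ord_add[OF A B] unfolding W.ord_def
  proof (rule landau_o.big.in_cong[THEN iffD1, rotated])
    show "\<forall>\<^sub>F n in sequentially. 1 / 4 * ((G n - G' n) * (d n * d n) * (1 / m n) + G' n * ((d n - d' n) * (d n + d' n)) * (1 / m n)
      + G' n * (d' n * d' n) * (1 / m n - 1 / m' n)) + 1 / (36 * 9 ^ 4) * (w n ^ 4 * (poly H (w n / 9) / p n))
      = G n * (x (Suc n) - x n)\<^sup>2 / (4 * (x n + x (Suc n))) - poly (variation_poly \<alpha>) (w n / 9) / 36"
      using p0
    proof eventually_elim
      case (elim n)
      have "1 / 4 * ((a - a') * (b * b) * c + a' * ((b - b') * (b + b')) * c + a' * (b' * b') * (c - c')) = a * b\<^sup>2 * c / 4 - a' * b'\<^sup>2 * c' / 4"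
        for a a' b b' c c' :: real by (simp add: algebra_simps power2_eq_square)
      from this have 1: "1 / 4 * ((G n - G' n) * (d n * d n) * (1 / m n) + G' n * ((d n - d' n) * (d n + d' n)) * (1 / m n)
         + G' n * (d' n * d' n) * (1 / m n - 1 / m' n)) = G n * (d n)\<^sup>2 * (1 / m n) / 4 - G' n * (d' n)\<^sup>2 * (1 / m' n) / 4" .
      have 1: "1 / 4 * ((G n - G' n) * (d n * d n) * (1 / m n) + G' n * ((d n - d' n) * (d n + d' n)) * (1 / m n)
         + G' n * (d' n * d' n) * (1 / m n - 1 / m' n)) = G n * (d n)\<^sup>2 / (4 * m n) - G' n * (d' n)\<^sup>2 / (4 * m' n)"
        unfolding 1 by simp
      have "poly (s_poly t \<alpha> * (euler_poly 1 (x_poly t \<alpha>) * euler_poly 1 (x_poly t \<alpha>)) - variation_poly \<alpha> * x_poly t \<alpha>) (w n / 9) = (w n / 9) ^ 4 * poly H (w n / 9)"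
        unfolding H by (simp add: poly_monom)
      hence 2: "q n * (g n * g n) = poly (variation_poly \<alpha>) (w n / 9) * p n + (w n / 9) ^ 4 * poly H (w n / 9)" by simp
      have "G' n * (d' n)\<^sup>2 / (4 * m' n) = q n * (g n * g n) / (36 * p n)"
        unfolding G'_def d'_def m'_def s_approx_def using w_pos[of n] t elim
        by (simp add: power2_eq_square field_simps eval_nat_numeral)
      also have "\<dots> = poly (variation_poly \<alpha>) (w n / 9) / 36 + 1 / (36 * 9 ^ 4) * (w n ^ 4 * (poly H (w n / 9) / p n))"
        unfolding 2 using elim by (simp add: field_simps power_divide)
      finally show ?case unfolding 1 unfolding d_def m_def by simp
    qed
  qed
qed

text \<open>Multiplying the approximations of s^2 and the two x directly would leave an error v^-6
  v^7, far too large. Here the factors s^2 of numerator and denominator cancel: with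
  \<open>N\<close> and \<open>M\<close> the quotient is N^2 / (4 M), which depends on s only through
  small terms in 1 / s. The leading part 1 / (4 t^2 w^6) is exactly the square of z.\<close>

private lemma first_part:
  "W.ord 4 (\<lambda>n. (G n)\<^sup>2 / (4 * ((s n)\<^sup>2 - T\<^sup>2)) - poly (b_poly t \<alpha>) (w n / 9) / (4 * t\<^sup>2 * w n ^ 6))"
proof -
  define y y' N N' M M' where "y n = 1 / s n" and "y' n = 1 / S (z n)"
    and "N n = 1 / t * (1 / w n ^ 3) - \<alpha> * T * y n" and "N' n = 1 / t * (1 / w n ^ 3) - \<alpha> * T * y' n"
    and "M n = 1 - T\<^sup>2 * (y n * y n)" and "M' n = 1 - T\<^sup>2 * (y' n * y' n)" for n
  have oy: "W.ord 9 (\<lambda>n. y n - y' n)" "W.ord 2 y'"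
    unfolding y_def y'_def using s_ord(2) S_scale(2) by simp_all
  have oy2: "W.ord 2 y"
  proof -
    have "W.ord 2 (\<lambda>n. (y n - y' n) + y' n)" by (rule W.ord_add[OF W.ord_mono[OF oy(1)] oy(2)]) simp
    thus ?thesis by simp
  qed
  have i3: "W.ord (-3) (\<lambda>n. 1 / t * (1 / w n ^ 3))" using W.ord_cmult[OF W.ord_inverse_power[of 3], of "1 / t"] by simp
  have oN: "W.ord (-3) N" "W.ord (-3) N'"
    unfolding N_def N'_def by (rule W.ord_diff[OF i3 W.ord_cmult[OF W.ord_mono[OF oy2]]], simp,
      rule W.ord_diff[OF i3 W.ord_cmult[OF W.ord_mono[OF oy(2)]]], simp)
  have dN: "W.ord 9 (\<lambda>n. N n - N' n)"
  proof -
    have "N n - N' n = - \<alpha> * T * (y n - y' n)" for n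
      unfolding N_def N'_def right_diff_distrib by simp
    thus ?thesis using W.ord_cmult[OF oy(1), of "- \<alpha> * T"] by (simp only:)
  qed
  have lim0: "f \<longlonglongrightarrow> 0" if "W.ord 2 f" for f
    by (rule W.ord_1_tendsto_0[OF W.ord_mono[OF that]]) simp
  have "M \<longlonglongrightarrow> 1 - T\<^sup>2 * (0 * 0)" "M' \<longlonglongrightarrow> 1 - T\<^sup>2 * (0 * 0)"
    unfolding M_def M'_def by (intro tendsto_intros lim0 oy2 oy(2))+
  hence M_lim: "M \<longlonglongrightarrow> 1" "M' \<longlonglongrightarrow> 1" by simp_all
  have iM: "W.ord 0 (\<lambda>n. 1 / M n)" "W.ord 0 (\<lambda>n. 1 / M' n)"
    using tendsto_divide[OF tendsto_const M_lim(1), of 1] tendsto_divide[OF tendsto_const M_lim(2), of 1]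
    by (auto intro: W.ord_tendsto)
  have M0: "\<forall>\<^sub>F n in sequentially. M n > 0 \<and> M' n > 0"
    using order_tendstoD(1)[OF M_lim(1), of 0] order_tendstoD(1)[OF M_lim(2), of 0] by (simp add: eventually_conj)
  have dM: "W.ord (9 + 2) (\<lambda>n. T\<^sup>2 * ((y n - y' n) * (y n + y' n)))"
    by (rule W.ord_cmult[OF W.ord_mult[OF oy(1) W.ord_add[OF oy2 oy(2)]]])
  have 1: "W.ord 4 (\<lambda>n. (N n - N' n) * (N n + N' n) * (1 / M n))"
    by (rule W.ord_mono[OF W.ord_mult[OF W.ord_mult[OF dN W.ord_add[OF oN]] iM(1)]]) simp
  have 2: "W.ord 4 (\<lambda>n. (N' n * N' n) * (T\<^sup>2 * ((y n - y' n) * (y n + y' n))) * ((1 / M n) * (1 / M' n)))"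
    by (rule W.ord_mono[OF W.ord_mult[OF W.ord_mult[OF W.ord_mult[OF oN(2) oN(2)] dM] W.ord_mult[OF iM]]]) simp
  have A: "W.ord 4 (\<lambda>n. 1 / 4 * ((N n - N' n) * (N n + N' n) * (1 / M n)
     + (N' n * N' n) * (T\<^sup>2 * ((y n - y' n) * (y n + y' n))) * ((1 / M n) * (1 / M' n))))"
    by (rule W.ord_cmult[OF W.ord_add[OF 1 2]])
  obtain H where H: "(s_poly t \<alpha> * s_poly t \<alpha> - monom (118098 * \<alpha> * t\<^sup>2) 5 * s_poly t \<alpha> + monom ((59049 * \<alpha> * t\<^sup>2)\<^sup>2) 10)
     - b_poly t \<alpha> * (s_poly t \<alpha> * s_poly t \<alpha> - monom (6561 * t\<^sup>2) 4) = monom 1 10 * H"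
    using b_poly_dvd by blast
  define Q where "Q n = q n * q n - t\<^sup>2 * w n ^ 4" for n
  have Q_lim: "Q \<longlonglongrightarrow> 1"
  proof -
    have "Q \<longlonglongrightarrow> 1 * 1 - t\<^sup>2 * 0 ^ 4" unfolding Q_def
      by (intro tendsto_intros w_poly_tendsto[of "s_poly t \<alpha>", unfolded poly_s_poly_0] W.u_lim)
    thus ?thesis by simp
  qed
  have pos: "\<forall>\<^sub>F n in sequentially. Q n > 0 \<and> q n > 0"
    using order_tendstoD(1)[OF Q_lim, of 0] order_tendstoD(1)[OF w_poly_tendsto[of "s_poly t \<alpha>", unfolded poly_s_poly_0], of 0]
    by (simp add: eventually_conj)
  have B: "W.ord 4 (\<lambda>n. 1 / (4 * t\<^sup>2 * 9 ^ 10) * (w n ^ 4 * (poly H (w n / 9) / Q n)))"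
  proof -
    have "(\<lambda>n. poly H (w n / 9) / Q n) \<longlonglongrightarrow> poly H 0 / 1"
      by (intro tendsto_divide w_poly_tendsto Q_lim) simp
    hence "W.ord (int 4 + 0) (\<lambda>n. 1 / (4 * t\<^sup>2 * 9 ^ 10) * (w n ^ 4 * (poly H (w n / 9) / Q n)))"
      by (intro W.ord_cmult W.ord_mult[OF W.ord_power] W.ord_tendsto)
    thus ?thesis by simp
  qed
  show ?thesis
    using W.ord_add[OF A B] unfolding W.ord_def
  proof (rule landau_o.big.in_cong[THEN iffD1, rotated])
    show "\<forall>\<^sub>F n in sequentially. 1 / 4 * ((N n - N' n) * (N n + N' n) * (1 / M n)
     + (N' n * N' n) * (T\<^sup>2 * ((y n - y' n) * (y n + y' n))) * ((1 / M n) * (1 / M' n)))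
     + 1 / (4 * t\<^sup>2 * 9 ^ 10) * (w n ^ 4 * (poly H (w n / 9) / Q n))
     = (G n)\<^sup>2 / (4 * ((s n)\<^sup>2 - T\<^sup>2)) - poly (b_poly t \<alpha>) (w n / 9) / (4 * t\<^sup>2 * w n ^ 6)"
      using pos M0
    proof eventually_elim
      case (elim n)
      have "T\<^sup>2 * ((y n - y' n) * (y n + y' n)) = M' n - M n" by (simp add: M_def M'_def algebra_simps)
      moreover have "1 / 4 * ((a - a') * (a + a') * (1 / b) + (a' * a') * (b' - b) * ((1 / b) * (1 / b'))) = a\<^sup>2 / (4 * b) - a'\<^sup>2 / (4 * b')"
        if "b > 0" "b' > 0" for a a' b b' :: real using that by (simp add: field_simps power2_eq_square)
      ultimately have 1: "1 / 4 * ((N n - N' n) * (N n + N' n) * (1 / M n)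
        + (N' n * N' n) * (T\<^sup>2 * ((y n - y' n) * (y n + y' n))) * ((1 / M n) * (1 / M' n))) = (N n)\<^sup>2 / (4 * M n) - (N' n)\<^sup>2 / (4 * M' n)"
        using elim by simp
      have "2 * real n + 2 + \<alpha> = 1 / t * (1 / w n ^ 3)" using z_w[of n] by (simp add: field_simps)
      hence "G n = s n * N n" using s_pos[of n] by (simp add: N_def y_def right_diff_distrib)
      moreover have "(s n)\<^sup>2 - T\<^sup>2 = (s n)\<^sup>2 * M n" using s_pos[of n] by (simp add: M_def y_def right_diff_distrib power2_eq_square)
      ultimately have 2: "(N n)\<^sup>2 / (4 * M n) = (G n)\<^sup>2 / (4 * ((s n)\<^sup>2 - T\<^sup>2))"
        using s_pos[of n] by (simp add: power_mult_distrib)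
      have y': "y' n = 2 * w n ^ 2 / q n" by (simp add: y'_def s_approx_def)
      have N': "N' n = (q n - \<alpha> * t\<^sup>2 * w n ^ 5) / (t * w n ^ 3 * q n)"
        unfolding N'_def y' using w_pos[of n] t elim by (simp add: field_simps eval_nat_numeral)
      have M': "M' n = Q n / (q n)\<^sup>2"
        unfolding M'_def y' Q_def using elim by (simp add: field_simps power2_eq_square eval_nat_numeral)
      have "(N' n)\<^sup>2 / (4 * M' n) = (q n - \<alpha> * t\<^sup>2 * w n ^ 5)\<^sup>2 / (4 * t\<^sup>2 * w n ^ 6 * Q n)"
        unfolding N' M' using elim w_pos[of n] t by (simp add: power_divide power_mult_distrib flip: power_mult)
      also have "(q n - \<alpha> * t\<^sup>2 * w n ^ 5)\<^sup>2 = poly (b_poly t \<alpha>) (w n / 9) * Q n + (w n / 9) ^ 10 * poly H (w n / 9)"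
      proof -
        have "poly ((s_poly t \<alpha> * s_poly t \<alpha> - monom (118098 * \<alpha> * t\<^sup>2) 5 * s_poly t \<alpha> + monom ((59049 * \<alpha> * t\<^sup>2)\<^sup>2) 10)
          - b_poly t \<alpha> * (s_poly t \<alpha> * s_poly t \<alpha> - monom (6561 * t\<^sup>2) 4)) (w n / 9) = (w n / 9) ^ 10 * poly H (w n / 9)"
          unfolding H by (simp add: poly_monom)
        hence "q n * q n - 2 * \<alpha> * t\<^sup>2 * w n ^ 5 * q n + (\<alpha> * t\<^sup>2)\<^sup>2 * w n ^ 10
           - poly (b_poly t \<alpha>) (w n / 9) * Q n = (w n / 9) ^ 10 * poly H (w n / 9)"
          by (simp add: poly_monom power_divide power_mult_distrib Q_def)
        thus ?thesis by (simp add: power2_eq_square algebra_simps eval_nat_numeral)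
      qed
      also have "(poly (b_poly t \<alpha>) (w n / 9) * Q n + (w n / 9) ^ 10 * poly H (w n / 9)) / (4 * t\<^sup>2 * w n ^ 6 * Q n)
         = poly (b_poly t \<alpha>) (w n / 9) / (4 * t\<^sup>2 * w n ^ 6) + 1 / (4 * t\<^sup>2 * 9 ^ 10) * (w n ^ 4 * (poly H (w n / 9) / Q n))"
        using elim w_pos[of n] t by (simp add: field_simps power_divide flip: power_add)
      finally show ?case unfolding 1 2 by simp
    qed
  qed
qed

text \<open>Since \<open>x n\<close> and \<open>x (Suc n)\<close> differ by little, the product is computed from their sum, which the
  recurrence gives exactly, and the square of their difference: with \<open>m = (s n)\<^sup>2 - T\<^sup>2\<close> and
  \<open>G n = m * (x n + x (Suc n))\<close> it is \<open>(G n)\<^sup>2 / (4 * m)\<close> minus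
  \<open>G n * (x (Suc n) - x n)\<^sup>2 / (4 * (x n + x (Suc n)))\<close>.\<close>

private lemma product_expansion_mid:
  "W.ord 4 (\<lambda>n. ((s n)\<^sup>2 - T\<^sup>2) * x n * x (Suc n) - ((z n)\<^sup>2 + 1 / 4 * (1 / w n ^ 2) - \<alpha> / 3 * (1 / w n ^ 1)
     - \<alpha>^2 / 12 - 1 / 36 + (8 * \<alpha> - 8 * \<alpha>^3) / 324 * w n ^ 1 + (5 * \<alpha>^2 - 5 * \<alpha>^4 - 81 * t^2) / 972 * w n ^ 2
     + (\<alpha> - \<alpha>^3) / 243 * w n ^ 3))"
proof -
  have 1: "(G n)\<^sup>2 / (4 * ((s n)\<^sup>2 - T\<^sup>2)) - G n * (x (Suc n) - x n)\<^sup>2 / (4 * (x n + x (Suc n)))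
     = ((s n)\<^sup>2 - T\<^sup>2) * x n * x (Suc n)" for n
  proof -
    have "T\<^sup>2 < (s n)\<^sup>2" using s_gt[of n] t by (intro power_strict_mono) auto
    moreover have "(m * (y + y'))\<^sup>2 / (4 * m) - m * (y + y') * (y' - y)\<^sup>2 / (4 * (y + y')) = m * y * y'"
      if "m > 0" "y > 0" "y' > 0" for m y y' :: real
    proof -
      have "(m * (y + y'))\<^sup>2 / (4 * m) = m * (y + y')\<^sup>2 / 4" using that by (simp add: power2_eq_square)
      moreover have "m * (y + y') * (y' - y)\<^sup>2 / (4 * (y + y')) = m * (y' - y)\<^sup>2 / 4"
        using that nonzero_mult_divide_mult_cancel_right[of "y + y'" "m * (y' - y)\<^sup>2" 4] by (simp add: mult_ac)
      moreover have "m * (y + y')\<^sup>2 / 4 - m * (y' - y)\<^sup>2 / 4 = m * y * y'"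
        by (simp add: power2_eq_square field_simps)
      ultimately show ?thesis by (simp only:)
    qed
    moreover have "G n = ((s n)\<^sup>2 - T\<^sup>2) * (x n + x (Suc n))" using x_eq[of n] by (simp add: mult.commute)
    ultimately show ?thesis
      using x_pos[of n] x_pos[of "Suc n"] by (simp only: diff_gt_0_iff_gt)
  qed
  have 2: "poly (b_poly t \<alpha>) (y / 9) / (4 * t\<^sup>2 * y ^ 6) - poly (variation_poly \<alpha>) (y / 9) / 36
      = (1 / (t * y ^ 3) / 2)\<^sup>2 + 1 / 4 * (1 / y ^ 2) - \<alpha> / 3 * (1 / y ^ 1)
     - \<alpha>^2 / 12 - 1 / 36 + (8 * \<alpha> - 8 * \<alpha>^3) / 324 * y ^ 1 + (5 * \<alpha>^2 - 5 * \<alpha>^4 - 81 * t^2) / 972 * y ^ 2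
     + (\<alpha> - \<alpha>^3) / 243 * y ^ 3" if "y > 0" for y
    using that t by (simp add: b_poly_def variation_poly_def field_simps eval_nat_numeral)
  have 3: "z n = 1 / (t * w n ^ 3) / 2" for n unfolding z_w[symmetric] by simp
  show ?thesis
    apply (rule W.ord_cong[OF W.ord_diff[OF first_part second_part]])
    subgoal for n using 1[of n] 2[OF w_pos, of n, folded 3] by linarith
    done
qed

text \<open>The midpoint exceeds n + 1 by \<alpha> / 2. Its square contributes \<alpha>^2 / 4 to the
  constant term, and the inverse powers of v are the only other ones whose recentring is visible
  below order 4; they supply the terms with \<alpha> t and \<alpha>^2 t.\<close>

lemma product_expansion:
  "null_scale.ord (\<lambda>n. v (real n + 1)) 4 (\<lambda>n. ((s n)\<^sup>2 - (t / 2)\<^sup>2) * x n * x (Suc n)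
     - ((real n + 1)\<^sup>2 + \<alpha> * (real n + 1) + 1 / (4 * v (real n + 1) ^ 2) - \<alpha> / (3 * v (real n + 1)) + (6 * \<alpha>^2 - 1) / 36
       - \<alpha> * (4 * \<alpha>^2 - 27 * t - 4) / 162 * v (real n + 1)
       - (5 * \<alpha>^4 + \<alpha>^2 * (108 * t - 5) + 81 * t^2) / 972 * v (real n + 1) ^ 2
       - \<alpha> * (\<alpha>^2 - 1) / 243 * v (real n + 1) ^ 3))"
proof -
  interpret U: null_scale "\<lambda>n. v (real n + 1)" by (rule null_scale_vscale) auto
  define u B c1 c2 c3 where "u n = v (real n + 1)" and "B n = ((s n)\<^sup>2 - T\<^sup>2) * x n * x (Suc n)"
    and "c1 = (8 * \<alpha> - 8 * \<alpha>^3) / 324" and "c2 = (5 * \<alpha>^2 - 5 * \<alpha>^4 - 81 * t^2) / 972" and "c3 = (\<alpha> - \<alpha>^3) / 243" for n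
  note inv = shift_inverse_power[OF mid_pos] and shl = shift_power_leading[OF mid_pos]
  have p: "U.ord 4 (\<lambda>n. B n - ((z n)\<^sup>2 + 1 / 4 * (1 / w n ^ 2) - \<alpha> / 3 * (1 / w n ^ 1) - \<alpha>^2 / 12 - 1 / 36
       + c1 * w n ^ 1 + c2 * w n ^ 2 + c3 * w n ^ 3))"
    "U.ord 4 (\<lambda>n. 1 / w n ^ 2 - 1 / u n ^ 2 * (1 + 2 / 3 * real 2 * (\<alpha> / 2) * t * u n ^ 3))"
    "U.ord 4 (\<lambda>n. 1 / w n ^ 1 - 1 / u n ^ 1 * (1 + 2 / 3 * real 1 * (\<alpha> / 2) * t * u n ^ 3))"
    "U.ord 4 (\<lambda>n. w n ^ 1 - u n ^ 1)" "U.ord 4 (\<lambda>n. w n ^ 2 - u n ^ 2)" "U.ord 4 (\<lambda>n. w n ^ 3 - u n ^ 3)"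
    unfolding u_def B_def c1_def c2_def c3_def
    by (rule ord_shift[OF mid_pos product_expansion_mid], rule U.ord_mono[OF inv], simp, rule U.ord_mono[OF inv], simp,
        rule U.ord_mono[OF shl], simp, rule U.ord_mono[OF shl], simp, rule U.ord_mono[OF shl], simp)
  have main: "U.ord 4 (\<lambda>n. (B n - ((z n)\<^sup>2 + 1 / 4 * (1 / w n ^ 2) - \<alpha> / 3 * (1 / w n ^ 1) - \<alpha>^2 / 12 - 1 / 36
       + c1 * w n ^ 1 + c2 * w n ^ 2 + c3 * w n ^ 3))
     + 1 / 4 * (1 / w n ^ 2 - 1 / u n ^ 2 * (1 + 2 / 3 * real 2 * (\<alpha> / 2) * t * u n ^ 3))
     + - \<alpha> / 3 * (1 / w n ^ 1 - 1 / u n ^ 1 * (1 + 2 / 3 * real 1 * (\<alpha> / 2) * t * u n ^ 3))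
     + c1 * (w n ^ 1 - u n ^ 1) + c2 * (w n ^ 2 - u n ^ 2) + c3 * (w n ^ 3 - u n ^ 3))"
    by (rule U.ord_add[OF U.ord_add[OF U.ord_add[OF U.ord_add[OF U.ord_add[OF p(1) U.ord_cmult[OF p(2)]] U.ord_cmult[OF p(3)]]
      U.ord_cmult[OF p(4)]] U.ord_cmult[OF p(5)]] U.ord_cmult[OF p(6)]])
  have u: "u n > 0" for n unfolding u_def by (rule U.u_pos)
  have 1: "1 / 4 * (1 / u n ^ 2 * (1 + 2 / 3 * real 2 * (\<alpha> / 2) * t * u n ^ 3)) = 1 / (4 * u n ^ 2) + \<alpha> * t / 6 * u n"
    "- \<alpha> / 3 * (1 / u n ^ 1 * (1 + 2 / 3 * real 1 * (\<alpha> / 2) * t * u n ^ 3)) = - \<alpha> / (3 * u n) - \<alpha>\<^sup>2 * t / 9 * u n ^ 2" for n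
    using u[of n] by (simp_all add: field_simps eval_nat_numeral)
  have 2: "(z n)\<^sup>2 = (real n + 1)\<^sup>2 + \<alpha> * (real n + 1) + \<alpha>\<^sup>2 / 4" for n
    by (simp add: field_simps power2_eq_square)
  have 3: "\<alpha> * (4 * \<alpha>^2 - 27 * t - 4) / 162 * u n = - c1 * u n - \<alpha> * t / 6 * u n"
    "(5 * \<alpha>^4 + \<alpha>^2 * (108 * t - 5) + 81 * t^2) / 972 * u n ^ 2 = - c2 * u n ^ 2 + \<alpha>\<^sup>2 * t / 9 * u n ^ 2"
    "\<alpha> * (\<alpha>^2 - 1) / 243 * u n ^ 3 = - c3 * u n ^ 3" for n
    unfolding c1_def c2_def c3_def by (simp_all add: field_simps eval_nat_numeral)
  show ?thesis
    by (rule U.ord_cong[OF main])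
       (unfold u_def[symmetric] B_def[symmetric] 2 3 right_diff_distrib[of "1 / 4"] right_diff_distrib[of "- \<alpha> / 3"]
          right_diff_distrib[of c1] right_diff_distrib[of c2] right_diff_distrib[of c3] 1, simp add: field_simps)
qed

end

end

section \<open>From powers of v back to powers of n\<close>

text \<open>Writing t and m as cubes makes every real power an integer power, so the two conversions
  below become rational identities modulo kappa^3 = 2.\<close>

lemma vscale_root:
  assumes "t > 0" "m > 0"
  defines "\<tau> \<equiv> t powr (1/3)" and "\<nu> \<equiv> m powr (1/3)"
  shows "\<tau> > 0" "\<nu> > 0" "kappa > 0" "kappa ^ 3 = 2" "t = \<tau> ^ 3" "m = \<nu> ^ 3"
    "t powr (2/3) = \<tau> ^ 2" "m powr (2/3) = \<nu> ^ 2" "m powr (4/3) = \<nu> ^ 4" "m powr (5/3) = \<nu> ^ 5"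
    "vscale t m = 1 / (kappa * \<tau> * \<nu>)"
proof -
  show "\<tau> > 0" "\<nu> > 0" using assms by simp_all
  show k: "kappa > 0" "kappa ^ 3 = 2" by (simp_all add: kappa_def)
  show "t = \<tau> ^ 3" "m = \<nu> ^ 3" "t powr (2/3) = \<tau> ^ 2" "m powr (2/3) = \<nu> ^ 2" "m powr (4/3) = \<nu> ^ 4" "m powr (5/3) = \<nu> ^ 5"
    using assms by (simp_all add: powr_powr flip: powr_numeral)
  have "kappa = 2 powr (1/3)" by (simp add: kappa_def root_powr_inverse)
  thus "vscale t m = 1 / (kappa * \<tau> * \<nu>)"
    using assms by (simp add: vscale_def powr_mult powr_minus divide_simps)
qed

lemma powr_to_vscale_a:
  assumes "t > 0" "m > 0"
  shows "t powr (2/3) / (kappa * m powr (1/3)) - \<alpha> * t powr (1/3) / (3 * kappa^2 * m powr (2/3))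
         + c4 / (162 * kappa * t powr (1/3) * m powr (4/3)) + c5 / (486 * kappa^2 * t powr (2/3) * m powr (5/3)) + c6 / (972 * t * m^2)
     = t * (vscale t m - \<alpha> / 3 * vscale t m ^ 2 + c4 / 81 * vscale t m ^ 4 + c5 / 243 * vscale t m ^ 5 + c6 / 243 * vscale t m ^ 6)"
proof -
  define \<tau> \<nu> where "\<tau> = t powr (1/3)" and "\<nu> = m powr (1/3)"
  note r = vscale_root[OF assms, folded \<tau>_def \<nu>_def]
  have k: "kappa ^ 4 = 2 * kappa" "kappa ^ 5 = 2 * kappa ^ 2" "kappa ^ 6 = 4"
    using r(4) by (simp_all add: eval_nat_numeral)
  have 1: "\<tau> ^ 3 * (1 / (kappa * \<tau> * \<nu>)) = \<tau> ^ 2 / (kappa * \<nu>)"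
    "\<tau> ^ 3 * (\<alpha> / 3 * (1 / (kappa * \<tau> * \<nu>)) ^ 2) = \<alpha> * \<tau> / (3 * kappa ^ 2 * \<nu> ^ 2)"
    using r(1-3) by (simp_all add: field_simps eval_nat_numeral)
  have 2: "\<tau> ^ 3 * (c4 / 81 * (1 / (kappa * \<tau> * \<nu>)) ^ 4) = c4 / (162 * kappa * \<tau> * \<nu> ^ 4)"
    "\<tau> ^ 3 * (c5 / 243 * (1 / (kappa * \<tau> * \<nu>)) ^ 5) = c5 / (486 * kappa ^ 2 * \<tau> ^ 2 * \<nu> ^ 5)"
    "\<tau> ^ 3 * (c6 / 243 * (1 / (kappa * \<tau> * \<nu>)) ^ 6) = c6 / (972 * \<tau> ^ 3 * (\<nu> ^ 3) ^ 2)"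
    unfolding power_divide power_mult_distrib k power_one
    using r(1-3) by (simp_all add: field_simps eval_nat_numeral)
  show ?thesis
    unfolding r(7-11) \<tau>_def[symmetric] \<nu>_def[symmetric]
    by (subst (1 2) r(5), subst (1) r(6)) (simp only: distrib_left right_diff_distrib 1 2)
qed

lemma powr_to_vscale_b:
  assumes "t > 0" "m > 0"
  shows "t powr (2/3) * m powr (2/3) / (2 * kappa) - kappa * \<alpha> * t powr (1/3) * m powr (1/3) / 3 + c0
         - c1 / (162 * kappa * t powr (1/3) * m powr (1/3)) - c2 / (972 * kappa^2 * t powr (2/3) * m powr (2/3)) - c3 / (486 * t * m)
     = 1 / (4 * vscale t m ^ 2) - \<alpha> / (3 * vscale t m) + c0 - c1 / 162 * vscale t m - c2 / 972 * vscale t m ^ 2 - c3 / 243 * vscale t m ^ 3"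
proof -
  define \<tau> \<nu> where "\<tau> = t powr (1/3)" and "\<nu> = m powr (1/3)"
  note r = vscale_root[OF assms, folded \<tau>_def \<nu>_def]
  have "kappa ^ 2 = 2 / kappa" using r(3,4) by (simp add: field_simps eval_nat_numeral)
  hence "1 / (4 * (1 / (kappa * \<tau> * \<nu>)) ^ 2) = \<tau> ^ 2 * \<nu> ^ 2 / (2 * kappa)"
    by (simp add: power_divide power_mult_distrib)
  moreover have "\<alpha> / (3 * (1 / (kappa * \<tau> * \<nu>))) = kappa * \<alpha> * \<tau> * \<nu> / 3" by simp
  moreover have "c1 / 162 * (1 / (kappa * \<tau> * \<nu>)) = c1 / (162 * kappa * \<tau> * \<nu>)"
    "c2 / 972 * (1 / (kappa * \<tau> * \<nu>)) ^ 2 = c2 / (972 * kappa ^ 2 * \<tau> ^ 2 * \<nu> ^ 2)"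
    by (simp_all add: power_divide power_mult_distrib)
  moreover have "c3 / 243 * (1 / (kappa * \<tau> * \<nu>)) ^ 3 = c3 / (486 * \<tau> ^ 3 * \<nu> ^ 3)"
    unfolding power_divide power_mult_distrib r(4) by simp
  ultimately show ?thesis
    unfolding r(7-11) \<tau>_def[symmetric] \<nu>_def[symmetric] r(5)[symmetric] r(6)[symmetric] by linarith
qed

text \<open>Along n + 1 the k-th power of v is a constant multiple of (n + 1) powr (- k / 3);
  dropping the index 0 does not affect the asymptotic statement.\<close>

lemma (in scaling) ord_vscale_powr:
  assumes "null_scale.ord (\<lambda>n. v (real n + 1)) k (\<lambda>n. f (Suc n))"
  shows "f \<in> O(\<lambda>n. real n powr (- of_int k / 3))"
proof (rule bigo_Suc_iff)
  interpret null_scale "\<lambda>n. v (real n + 1)" by (rule null_scale_vscale) auto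
  have "v (real n + 1) powi k = (2 * t) powr (- of_int k / 3) * real (Suc n) powr (- of_int k / 3)" for n
  proof -
    have "v (real n + 1) powi k = v (real n + 1) powr of_int k"
      using vscale_pos[of "real n + 1"] by (intro powr_real_of_int'[symmetric]) auto
    also have "\<dots> = (2 * t * real (Suc n)) powr (- of_int k / 3)" by (simp add: vscale_powr add.commute)
    finally show ?thesis using t by (simp add: powr_mult)
  qed
  thus "(\<lambda>n. f (Suc n)) \<in> O(\<lambda>n. real (Suc n) powr (- of_int k / 3))"
    using assms t unfolding ord_def by simp
qed

theorem theorem4p1:
  fixes \<alpha> t :: real and P :: "nat \<Rightarrow> real poly" and a b :: "nat \<Rightarrow> real"
  assumes "\<alpha> > -1" and "t > 0"
    and "monic_orthogonal_polys t \<alpha> P"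
    and "recurrence_coeffs P a b"
  shows
    "(\<lambda>n. a n -
        (2 * real n + \<alpha> + 1
         + t powr (2/3) / (kappa * real n powr (1/3))
         - \<alpha> * t powr (1/3) / (3 * kappa^2 * real n powr (2/3))
         + (\<alpha> + 1) * (\<alpha> * (\<alpha> - 1) - 27 * t)
             / (162 * kappa * t powr (1/3) * real n powr (4/3))
         + (\<alpha>^2 * (\<alpha>^2 - 1) + 54 * \<alpha> * (\<alpha> + 1) * t - 81 * t^2)
             / (486 * kappa^2 * t powr (2/3) * real n powr (5/3))
         + \<alpha> * (\<alpha>^2 + 81 * t^2 - 1) / (972 * t * (real n)^2)))
      \<in> O(\<lambda>n. real n powr (-7/3)) \<and>
     (\<lambda>n. b n -
        ((real n)^2 + \<alpha> * real n
         + t powr (2/3) * real n powr (2/3) / (2 * kappa)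
         - kappa * \<alpha> * t powr (1/3) * real n powr (1/3) / 3
         + (6 * \<alpha>^2 - 1) / 36
         - \<alpha> * (4 * \<alpha>^2 - 27 * t - 4)
             / (162 * kappa * t powr (1/3) * real n powr (1/3))
         - (5 * \<alpha>^4 + \<alpha>^2 * (108 * t - 5) + 81 * t^2)
             / (972 * kappa^2 * t powr (2/3) * real n powr (2/3))
         - \<alpha> * (\<alpha>^2 - 1) / (486 * t * real n)))
      \<in> O(\<lambda>n. real n powr (-4/3))"
proof -
  obtain x s where xs: "\<And>n. x n > 0" "\<And>n. s n > t / 2"
    "\<And>n. (x n + x (Suc n)) * ((s n)\<^sup>2 - (t/2)\<^sup>2) = (2 * real n + 2 + \<alpha>) * s n - \<alpha> * (t/2)"
    "\<And>n. s n + s (Suc n) = (2 * real n + 3 + \<alpha>) / x (Suc n) + 1 / (x (Suc n))\<^sup>2"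
    and ab: "\<And>n. a n = 2 * real n + 1 + \<alpha> + 1 / x n" "\<And>n. b (Suc n) = ((s n)\<^sup>2 - (t/2)\<^sup>2) * x n * x (Suc n)"
    using recurrence_system[OF assms] by metis
  interpret positive_solution t \<alpha> x s by unfold_locales (use assms xs in auto)
  interpret scaling t by unfold_locales (rule assms)
  show ?thesis (is "?f \<in> _ \<and> ?g \<in> _")
  proof
    \<comment> \<open>An exact identity between the two forms of the error. At \<open>Suc n\<close>
      all powers of the index are positive, so v and its conversion are not degenerate.\<close>
    have "(\<lambda>n. 1 / x (Suc n)
     - t * (v (real n + 1) - \<alpha> / 3 * v (real n + 1) ^ 2 + (\<alpha> + 1) * (\<alpha> * (\<alpha> - 1) - 27 * t) / 81 * v (real n + 1) ^ 4
       + (\<alpha>^2 * (\<alpha>^2 - 1) + 54 * \<alpha> * (\<alpha> + 1) * t - 81 * t^2) / 243 * v (real n + 1) ^ 5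
       + \<alpha> * (\<alpha>^2 + 81 * t^2 - 1) / 243 * v (real n + 1) ^ 6)) = (\<lambda>n. ?f (Suc n))"
    proof (rule ext)
      fix n
      have m: "real (Suc n) = real n + 1" "real n + 1 > 0" by simp_all
      show "1 / x (Suc n)
         - t * (v (real n + 1) - \<alpha> / 3 * v (real n + 1) ^ 2 + (\<alpha> + 1) * (\<alpha> * (\<alpha> - 1) - 27 * t) / 81 * v (real n + 1) ^ 4
           + (\<alpha>^2 * (\<alpha>^2 - 1) + 54 * \<alpha> * (\<alpha> + 1) * t - 81 * t^2) / 243 * v (real n + 1) ^ 5
           + \<alpha> * (\<alpha>^2 + 81 * t^2 - 1) / 243 * v (real n + 1) ^ 6) = ?f (Suc n)"
        unfolding powr_to_vscale_a[OF assms(2) m(2), symmetric] ab(1) m(1) by linarith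
    qed
    with a_expansion have "null_scale.ord (\<lambda>n. v (real n + 1)) 7 (\<lambda>n. ?f (Suc n))" by (simp only:)
    from ord_vscale_powr[OF this] show "?f \<in> O(\<lambda>n. real n powr (-7/3))" by simp
    \<comment> \<open>The shift also avoids b 0, whose value the recurrence leaves open.\<close>
    have "(\<lambda>n. ((s n)\<^sup>2 - (t / 2)\<^sup>2) * x n * x (Suc n)
     - ((real n + 1)\<^sup>2 + \<alpha> * (real n + 1) + 1 / (4 * v (real n + 1) ^ 2) - \<alpha> / (3 * v (real n + 1)) + (6 * \<alpha>^2 - 1) / 36
       - \<alpha> * (4 * \<alpha>^2 - 27 * t - 4) / 162 * v (real n + 1)
       - (5 * \<alpha>^4 + \<alpha>^2 * (108 * t - 5) + 81 * t^2) / 972 * v (real n + 1) ^ 2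
       - \<alpha> * (\<alpha>^2 - 1) / 243 * v (real n + 1) ^ 3)) = (\<lambda>n. ?g (Suc n))"
    proof (rule ext)
      fix n
      have m: "real (Suc n) = real n + 1" "real n + 1 > 0" by simp_all
      show "((s n)\<^sup>2 - (t / 2)\<^sup>2) * x n * x (Suc n)
       - ((real n + 1)\<^sup>2 + \<alpha> * (real n + 1) + 1 / (4 * v (real n + 1) ^ 2) - \<alpha> / (3 * v (real n + 1)) + (6 * \<alpha>^2 - 1) / 36
         - \<alpha> * (4 * \<alpha>^2 - 27 * t - 4) / 162 * v (real n + 1)
         - (5 * \<alpha>^4 + \<alpha>^2 * (108 * t - 5) + 81 * t^2) / 972 * v (real n + 1) ^ 2
         - \<alpha> * (\<alpha>^2 - 1) / 243 * v (real n + 1) ^ 3) = ?g (Suc n)"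
        using powr_to_vscale_b[OF assms(2) m(2), of \<alpha> "(6 * \<alpha>^2 - 1) / 36" "\<alpha> * (4 * \<alpha>^2 - 27 * t - 4)"
          "5 * \<alpha>^4 + \<alpha>^2 * (108 * t - 5) + 81 * t^2" "\<alpha> * (\<alpha>^2 - 1)"]
        unfolding ab(2) m(1) by linarith
    qed
    with product_expansion have "null_scale.ord (\<lambda>n. v (real n + 1)) 4 (\<lambda>n. ?g (Suc n))" by (simp only:)
    from ord_vscale_powr[OF this] show "?g \<in> O(\<lambda>n. real n powr (-4/3))" by simp
  qed
qed

end
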